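(* Let $\alpha<0$, let $\vec{a}\in\mathbb{R}^3$ be a unit vector and let $\Pi$ be the plane of equation $\langle p,\vec{a}\rangle=c>0$. Let $M$ be a compact $\alpha$-singular minimal graph on $\Pi$ (with density vector $\vec{a}$) with $\partial M\subset\Pi$. If $h=\max_{p\in M}\langle p,\vec{a}\rangle$, then the area $A(M)$ of $M$ satisfies $$A(M)\geq-\frac{2\pi}{\alpha}\,(h^2-c^2).$$
   Context: For a unit vector $\vec{a}\in\mathbb{R}^3$ let $\mathbb{R}^3_+(\vec{a})=\{p\in\mathbb{R}^3:\langle p,\vec{a}\rangle>0\}$. For $\alpha\in\mathbb{R}$, $\alpha\neq 0$, an $\alpha$-singular minimal surface with density vector $\vec{a}$ is a smooth immersion $\phi:M\to\mathbb{R}^3_+(\vec{a})$ of an oriented surface $M$ (possibly with smooth boundary) such that $2H=\alpha\,\langle N,\vec{a}\rangle/\langle\phi,\vec{a}\rangle$ on $M$, where $N$ is the Gauss map and $H$ the mean curvature (half the sum of the principal curvatures, with sign such that $\Delta\phi=2HN$ for the Laplace-Beltrami operator of the induced metric). A surface $M$ is a graph on the plane $\Pi$ (orthogonal to $\vec{a}$) if it has the form $M=\{q+u(q)\vec{a}:q\in D\}$ for a function $u$ on a domain $D\subset\Pi$. *)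

theory Defs
  imports "HOL-Analysis.Analysis"
begin

primrec Ck_on :: "nat \<Rightarrow> ('a::euclidean_space \<Rightarrow> 'b::real_normed_vector) \<Rightarrow> 'a set \<Rightarrow> bool" where
  "Ck_on 0 f W \<longleftrightarrow> continuous_on W f"
| "Ck_on (Suc k) f W \<longleftrightarrow>
     (\<forall>x\<in>W. f differentiable (at x)) \<and>
     (\<forall>v. Ck_on k (\<lambda>x. frechet_derivative f (at x) v) W)"

text \<open>Intended for open sets only.\<close>

definition smooth_on :: "('a::euclidean_space \<Rightarrow> 'b::real_normed_vector) \<Rightarrow> 'a set \<Rightarrow> bool" where
  "smooth_on f W \<longleftrightarrow> (\<forall>k. Ck_on k f W)"

definition half_plane :: "(real^2) set" where
  "half_plane = {x. 0 \<le> x $ 2}"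

text \<open>
  Local parametrizations of a subset \<open>M\<close> of space, regarded as a surface with (possibly empty)
  boundary. The parameter domain is \<open>W \<inter> half_plane\<close>, and smoothness up to the edge of the
  half-plane means smooth extendability to the open set \<open>W\<close>. Interior parametrizations are those
  with \<open>W\<close> contained in the open half-plane.
\<close>

definition local_parametrization ::
    "(real^3) set \<Rightarrow> (real^2) set \<Rightarrow> (real^2 \<Rightarrow> real^3) \<Rightarrow> bool" where
  "local_parametrization M W \<psi> \<longleftrightarrow>
     open W \<and> smooth_on \<psi> W \<and>
     (\<forall>x\<in>W \<inter> half_plane. inj (frechet_derivative \<psi> (at x))) \<and>
     openin (top_of_set M) (\<psi> ` (W \<inter> half_plane)) \<and>
     (\<exists>g. homeomorphism (W \<inter> half_plane) (\<psi> ` (W \<inter> half_plane)) \<psi> g)"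

definition smooth_surface :: "(real^3) set \<Rightarrow> bool" where
  "smooth_surface M \<longleftrightarrow>
     (\<forall>p\<in>M. \<exists>W \<psi>. local_parametrization M W \<psi> \<and> p \<in> \<psi> ` (W \<inter> half_plane))"

definition surface_boundary :: "(real^3) set \<Rightarrow> (real^3) set" where
  "surface_boundary M =
     {p. \<exists>W \<psi> x. local_parametrization M W \<psi> \<and> x \<in> W \<and> x $ 2 = 0 \<and> p = \<psi> x}"

definition tangent_plane :: "(real^3) set \<Rightarrow> real^3 \<Rightarrow> (real^3) set" where
  "tangent_plane M p =
     {v. \<exists>W \<psi> x w. local_parametrization M W \<psi> \<and> x \<in> W \<inter> half_plane \<and> p = \<psi> x \<and>
        v = frechet_derivative \<psi> (at x) w}"

text \<open>An orientation of a surface in space is the same thing as a choice of Gauss map.\<close>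

definition gauss_map :: "(real^3) set \<Rightarrow> (real^3 \<Rightarrow> real^3) \<Rightarrow> bool" where
  "gauss_map M N \<longleftrightarrow>
     continuous_on M N \<and>
     (\<forall>p\<in>M. norm (N p) = 1 \<and> (\<forall>v\<in>tangent_plane M p. N p \<bullet> v = 0))"

text \<open>
  The principal curvatures are the eigenvalues of the shape operator \<open>- dN\<^sub>p\<close> on the tangent plane,
  listed with multiplicity along an orthonormal basis of principal directions. The derivative
  of \<open>N\<close> within \<open>M\<close> is determined uniquely on the tangent plane only, and is used only there.
  With this sign the unit sphere has principal curvatures \<open>1\<close>, \<open>1\<close> for the inner normal, in
  accordance with \<open>\<Delta>\<phi> = 2HN\<close>.
\<close>

definition principal_curvatures ::
    "(real^3) set \<Rightarrow> (real^3 \<Rightarrow> real^3) \<Rightarrow> real^3 \<Rightarrow> real \<Rightarrow> real \<Rightarrow> bool" where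
  "principal_curvatures M N p k1 k2 \<longleftrightarrow>
     (\<exists>N' e1 e2.
        (N has_derivative N') (at p within M) \<and>
        e1 \<in> tangent_plane M p \<and> e2 \<in> tangent_plane M p \<and>
        norm e1 = 1 \<and> norm e2 = 1 \<and> e1 \<bullet> e2 = 0 \<and>
        - N' e1 = k1 *\<^sub>R e1 \<and> - N' e2 = k2 *\<^sub>R e2)"

text \<open>
  Stated as a relation: on a smooth surface with Gauss map \<open>N\<close> the shape operator is self-adjoint,
  so exactly one \<open>H\<close> satisfies it at each point.
\<close>

definition has_mean_curvature ::
    "(real^3) set \<Rightarrow> (real^3 \<Rightarrow> real^3) \<Rightarrow> real^3 \<Rightarrow> real \<Rightarrow> bool" where
  "has_mean_curvature M N p H \<longleftrightarrow>
     (\<exists>k1 k2. principal_curvatures M N p k1 k2 \<and> H = (k1 + k2) / 2)"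

definition singular_minimal_surface :: "real \<Rightarrow> real^3 \<Rightarrow> (real^3) set \<Rightarrow> bool" where
  "singular_minimal_surface \<alpha> a M \<longleftrightarrow>
     smooth_surface M \<and> (\<forall>p\<in>M. p \<bullet> a > 0) \<and>
     (\<exists>N. gauss_map M N \<and>
        (\<forall>p\<in>M. \<exists>H. has_mean_curvature M N p H \<and> 2 * H = \<alpha> * ((N p \<bullet> a) / (p \<bullet> a))))"

text \<open>
  A domain of the plane, some or all of whose frontier points may be included (a compact graph
  lives over the closure of an open connected set).
\<close>

definition planar_domain :: "(real^3) set \<Rightarrow> (real^3) set \<Rightarrow> bool" where
  "planar_domain P D \<longleftrightarrow>
     D \<subseteq> P \<and>
     (\<exists>G. openin (top_of_set P) G \<and> G \<noteq> {} \<and> connected G \<and> G \<subseteq> D \<and> D \<subseteq> closure G)"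

definition graph_on :: "(real^3) set \<Rightarrow> real^3 \<Rightarrow> (real^3) set \<Rightarrow> bool" where
  "graph_on P a M \<longleftrightarrow>
     (\<exists>D (u :: real^3 \<Rightarrow> real). planar_domain P D \<and> M = {q + u q *\<^sub>R a | q. q \<in> D})"

text \<open>
  The area of the piece \<open>\<psi> ` K\<close> of the surface is the integral over \<open>K\<close> of the area element
  \<open>|\<psi>\<^sub>x \<times> \<psi>\<^sub>y|\<close>. The area of \<open>M\<close> is the supremum of the total area of finitely many disjoint
  Borel pieces, each lying in the image of one local parametrization; if \<open>M\<close> is compact, it is
  attained by cutting all of \<open>M\<close> into such pieces.
\<close>

definition parametrized_area :: "(real^2 \<Rightarrow> real^3) \<Rightarrow> (real^2) set \<Rightarrow> ennreal" where
  "parametrized_area \<psi> K =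
     (\<integral>\<^sup>+ x. ennreal (norm (cross3 (frechet_derivative \<psi> (at x) (axis 1 1))
                               (frechet_derivative \<psi> (at x) (axis 2 1)))) * indicator K x \<partial>lborel)"

definition disjoint_pieces ::
    "(real^3) set \<Rightarrow> ((real^2 \<Rightarrow> real^3) \<times> (real^2) set) set \<Rightarrow> bool" where
  "disjoint_pieces M F \<longleftrightarrow>
     finite F \<and>
     (\<forall>(\<psi>, K)\<in>F. K \<in> sets borel \<and>
        (\<exists>W. local_parametrization M W \<psi> \<and> K \<subseteq> W \<inter> half_plane)) \<and>
     pairwise (\<lambda>(\<psi>, K) (\<psi>', K'). disjnt (\<psi> ` K) (\<psi>' ` K')) F"

definition surface_area :: "(real^3) set \<Rightarrow> ennreal" where
  "surface_area M = (SUP F \<in> Collect (disjoint_pieces M). \<Sum>(\<psi>, K)\<in>F. parametrized_area \<psi> K)"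

end

theory Submission
  imports Defs
begin

text \<open>
  Write \<open>M\<close> over the plane with height \<open>u\<close> and \<open>W = sqrt (1 + |\<nabla>u|\<^sup>2)\<close>, so that
  \<open>div (\<nabla>u / W) = \<alpha> / (u W)\<close> where \<open>u > c\<close>. Let \<open>m(t)\<close> be the area of the planar set \<open>{u > t}\<close>
  and \<open>A(t)\<close> the area of the part of \<open>M\<close> above it. The isoperimetric inequality for \<open>{u > t}\<close>, the
  Cauchy-Schwarz inequality on the level line and the divergence theorem give
  \<open>4 \<pi> m(t) \<le> \<alpha> A'(t) m(t) / t\<close>, and integration over \<open>c < t < h\<close> is the
  claim. To avoid level sets altogether, the isoperimetric inequality is replaced by the sharp
  Sobolev inequality \<open>4 \<pi> \<integral>f\<^sup>2 \<le> (\<integral>|\<nabla>f|)\<^sup>2\<close> (by Knothe transport to the disc) for \<open>f = \<phi>(u)\<close> with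
  \<open>\<phi>\<close> a smoothed step of width \<open>\<epsilon>\<close>, and \<open>A'\<close> by a sum over steps; the ratios \<open>m(t + \<epsilon>) / m(t - \<epsilon>)\<close> are
  absorbed by \<open>r \<ge> 1 + ln r\<close>.

  The function \<open>u\<close> is smooth because \<open>M\<close> has no vertical tangent plane above level \<open>c\<close>. Near such a
  point \<open>M\<close> would be a graph \<open>x = g(y, z)\<close> over a vertical plane, strictly monotone in \<open>z\<close> since \<open>M\<close> is
  a graph, with \<open>g\<^sub>z\<close> vanishing at one point; Hopf's lemma excludes this.
\<close>

section \<open>The sharp Sobolev inequality in the plane\<close>

text \<open>Vertical tangent planes are excluded only above level \<open>c\<close>; at the boundary
  of \<open>M\<close> they may occur, and the projected domain may have a rough frontier. Hence
  every integrand is supported in a compact set \<open>{u \<ge> t}\<close> with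
  \<open>t > c\<close>, the estimate is proved between two levels strictly inside
  \<open>(c, h)\<close>, and these tend to \<open>c\<close> and \<open>h\<close> at the very end.
  Parts of \<open>M\<close> at or below level \<open>c\<close> can only add area, and since
  \<open>surface_area\<close> is a supremum, one family of disjoint pieces covering the part above
  \<open>t\<close> bounds it from below. The Gauss map is given as a continuous unit normal field
  with a derivative within \<open>M\<close>. Continuous second derivatives of the height come
  instead from the smooth unnormalized normal of a chart, whose component ratios agree with those of
  the Gauss map. The sign of \<alpha> turns the divergence identity into an upper bound for the flux
  of \<open>\<nabla>u / W\<close>; in Hopf's lemma it makes the larger height of the shifted point
  act in the favourable direction.\<close>

lemma disc_sector_angle:
  obtains \<theta> :: "real \<Rightarrow> real" where
    "\<And>s. 0 < s \<Longrightarrow> s < pi \<Longrightarrow>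
       0 < \<theta> s \<and> \<theta> s < pi \<and> (\<theta> has_real_derivative 1 / (2 * (sin (\<theta> s))\<^sup>2)) (at s)"
proof -
  \<comment> \<open>\<open>S t\<close> is the area of the part of the unit disc with first
    coordinate below \<open>- cos t\<close>: moving the chord of length \<open>2 * sin t\<close> at
    speed \<open>sin t\<close> gives the derivative \<open>2 * (sin t)\<^sup>2\<close>. So \<theta>
    turns a prescribed area in \<open>(0, pi)\<close> into the angle of the cutting chord.\<close>
  define S :: "real \<Rightarrow> real" where "S t = t - sin t * cos t" for t
  have dS: "(S has_real_derivative 2 * (sin t)\<^sup>2) (at t)" for t
  proof -
    have "(S has_real_derivative 1 - (cos t * cos t + sin t * (- sin t))) (at t)"
      unfolding S_def by (auto intro!: derivative_eq_intros)
    moreover have "1 - (cos t * cos t + sin t * (- sin t)) = 2 * (sin t)\<^sup>2"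
      using sin_cos_squared_add[of t] by (simp add: power2_eq_square algebra_simps)
    ultimately show ?thesis by simp
  qed
  have cS: "isCont S t" for t
    using dS by (rule DERIV_isCont)
  have mono: "S x < S y" if "0 \<le> x" "x < y" "y \<le> pi" for x y
  proof (rule DERIV_pos_imp_increasing_open[OF \<open>x < y\<close>])
    fix t assume "x < t" "t < y"
    then have "0 < sin t" using that by (intro sin_gt_zero) auto
    then show "\<exists>y. (S has_real_derivative y) (at t) \<and> 0 < y" using dS[of t] by fastforce
  qed (use cS in \<open>simp add: continuous_at_imp_continuous_on\<close>)
  have ex: "\<exists>t. 0 < t \<and> t < pi \<and> S t = s" if "0 < s" "s < pi" for s
  proof -
    have "\<exists>t\<ge>0. t \<le> pi \<and> S t = s"
      using that by (intro IVT) (auto simp: cS S_def)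
    then obtain t where "0 \<le> t" "t \<le> pi" "S t = s" by blast
    moreover have "t \<noteq> 0" "t \<noteq> pi" using \<open>S t = s\<close> that by (auto simp: S_def)
    ultimately show ?thesis by (intro exI[of _ t]) auto
  qed
  then obtain \<theta> where th: "\<And>s. 0 < s \<Longrightarrow> s < pi \<Longrightarrow> 0 < \<theta> s \<and> \<theta> s < pi \<and> S (\<theta> s) = s"
    by metis
  have inv: "\<theta> (S t) = t" if "0 < t" "t < pi" for t
  proof -
    have "0 < S t" "S t < pi" using mono[of 0 t] mono[of t pi] that by (auto simp: S_def)
    then have "0 < \<theta> (S t)" "\<theta> (S t) < pi" "S (\<theta> (S t)) = S t" using th by auto
    then show ?thesis
      using mono[of "\<theta> (S t)" t] mono[of t "\<theta> (S t)"] that by (cases "\<theta> (S t)" t rule: linorder_cases) auto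
  qed
  show ?thesis
  proof
    fix s :: real assume s: "0 < s" "s < pi"
    define x where "x = \<theta> s"
    have x: "0 < x" "x < pi" "S x = s" using th s by (auto simp: x_def)
    define d where "d = min x (pi - x) / 2"
    have "isCont \<theta> (S x)"
    proof (rule isCont_inverse_function[where d = d and f = S and x = x])
      show "0 < d" using x by (auto simp: d_def)
      fix z assume "\<bar>z - x\<bar> \<le> d"
      then have "x - z \<le> d" "z - x \<le> d" by (simp_all add: abs_le_iff)
      moreover have "d \<le> x / 2" "d \<le> (pi - x) / 2" by (simp_all add: d_def divide_right_mono)
      ultimately have "x - z < x \<and> z - x < pi - x" using x by auto
      then have "0 < z" "z < pi" by simp_all
      then show "\<theta> (S z) = z" by (rule inv)
      show "isCont S z" by (rule cS)
    qed
    moreover have "0 < sin x" using x by (intro sin_gt_zero) auto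
    ultimately have "(\<theta> has_real_derivative inverse (2 * (sin (\<theta> s))\<^sup>2)) (at s)"
      using s x th by (intro DERIV_inverse_function[of S _ _ _ 0 pi] dS) (auto simp: x_def)
    then show "0 < \<theta> s \<and> \<theta> s < pi \<and> (\<theta> has_real_derivative 1 / (2 * (sin (\<theta> s))\<^sup>2)) (at s)"
      using th s by (simp add: inverse_eq_divide)
  qed
qed

lemma integral_pos_if_continuous:
  fixes k :: "real \<Rightarrow> real"
  assumes "continuous_on {a..b} k" "a < b" "\<And>x. x \<in> {a..b} \<Longrightarrow> 0 \<le> k x" "x \<in> {a..b}" "0 < k x"
  shows "0 < integral {a..b} k"
proof -
  have "0 \<le> integral {a..b} k"
    using assms by (intro integral_nonneg integrable_continuous_real) auto
  moreover have "integral {a..b} k \<noteq> 0"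
    using integral_eq_0_iff[OF assms(1,2,3)] assms(4,5) by force
  ultimately show ?thesis by simp
qed

text \<open>One vertical slice of the Knothe map onto the unit disc: the slice is sent to the chord with
  first coordinate \<open>- cos \<theta>\<close>, whose half-length is \<open>sin \<theta>\<close>.\<close>

lemma knothe_slice:
  fixes p p' a :: "real \<Rightarrow> real"
  assumes R: "0 < R" and cp': "continuous_on {-R..R} p'" and ca: "continuous_on {-R..R} a"
    and dp: "\<And>y. (p has_real_derivative p' y) (at y)"
    and nn: "\<And>y. 0 \<le> p y" and p0: "p (-R) = 0" "p R = 0"
    and m: "m = integral {-R..R} (\<lambda>y. (p y)\<^sup>2)" "0 < m"
    and th: "0 < \<theta>" "\<theta> < pi" and \<kappa>: "0 < \<kappa>"
  shows "2 * sqrt \<kappa> * m + cos \<theta> * integral {-R..R} a - \<kappa> * m / (2 * sin \<theta>) * integral {-R..R} p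
    \<le> integral {-R..R} (\<lambda>y. sqrt ((a y)\<^sup>2 + (p' y)\<^sup>2))"
proof -
  define s where "s = sin \<theta>"
  have s: "0 < s" using th by (simp add: s_def sin_gt_zero)
  have cp: "continuous_on A p" for A
    using dp by (meson DERIV_isCont continuous_at_imp_continuous_on)
  have cp2: "continuous_on A (\<lambda>y. (p y)\<^sup>2)" for A
    by (intro continuous_intros cp)
  define Q where "Q y = integral {-R..y} (\<lambda>y. (p y)\<^sup>2)" for y
  \<comment> \<open>\<open>Q y / m\<close> is the fraction of the mass of \<open>p\<^sup>2\<close>
    below \<open>y\<close>. The slice is moved monotonically onto the chord \<open>[-s, s]\<close>
    so that this mass becomes uniformly distributed.\<close>
  define T where "T y = s * (2 * (Q y / m) - 1)" for y
  have dQ: "(Q has_real_derivative (p y)\<^sup>2) (at y within {-R..R})" if "y \<in> {-R..R}" for y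
    unfolding Q_def using integral_has_real_derivative[OF cp2 that] .
  have dT: "(T has_real_derivative 2 * s * (p y)\<^sup>2 / m) (at y within {-R..R})" if "y \<in> {-R..R}" for y
    unfolding T_def using m(2) by (auto intro!: derivative_eq_intros dQ that)
  have cT: "continuous_on {-R..R} T"
    using dT by (meson DERIV_continuous_on)
  have Q01: "0 \<le> Q y \<and> Q y \<le> m" if "y \<in> {-R..R}" for y
  proof -
    have "Q y \<le> m" unfolding Q_def m(1)
      using that by (intro integral_subset_le integrable_continuous_real cp2) auto
    moreover have "0 \<le> Q y" unfolding Q_def
      by (intro integral_nonneg integrable_continuous_real cp2) auto
    ultimately show ?thesis by simp
  qed
  have T2: "(T y)\<^sup>2 \<le> s\<^sup>2" if "y \<in> {-R..R}" for y
  proof -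
    have "\<bar>2 * (Q y / m) - 1\<bar> \<le> 1"
      using Q01[OF that] m(2) by (auto simp: abs_le_iff field_simps)
    then have "(2 * (Q y / m) - 1)\<^sup>2 \<le> 1" by (simp add: abs_square_le_1)
    then show ?thesis using s by (simp add: T_def power_mult_distrib mult_left_le)
  qed
  \<comment> \<open>The derivative of \<open>p * T\<close>, which vanishes at both ends of the
    slice: integration by parts in the vertical direction.\<close>
  define k where "k y = p' y * T y + 2 * s * (p y)\<^sup>2 / m * p y" for y
  have "((\<lambda>y. p' y * T y + 2 * s * (p y)\<^sup>2 / m * p y) has_integral p R * T R - p (-R) * T (-R)) {-R..R}"
    using R
    by (intro fundamental_theorem_of_calculus)
       (auto simp: has_real_derivative_iff_has_vector_derivative[symmetric]
         intro!: DERIV_mult' derivative_eq_intros dT has_field_derivative_at_within[OF dp])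
  then have k0: "(k has_integral 0) {-R..R}" by (simp add: p0 k_def[abs_def])
  have pw: "cos \<theta> * a y - k y + 2 * sqrt \<kappa> * (p y)\<^sup>2 - \<kappa> * m / (2 * s) * p y
      \<le> sqrt ((a y)\<^sup>2 + (p' y)\<^sup>2)" if y: "y \<in> {-R..R}" for y
  proof -
    \<comment> \<open>Cauchy-Schwarz for the gradient \<open>(a y, p' y)\<close> and the image point
      \<open>(- cos \<theta>, T y)\<close>, which lies in the unit disc.\<close>
    have "cos \<theta> * a y - p' y * T y \<le> sqrt ((a y)\<^sup>2 + (p' y)\<^sup>2) * sqrt ((cos \<theta>)\<^sup>2 + (T y)\<^sup>2)"
    proof -
      have "(cos \<theta> * a y - p' y * T y)\<^sup>2 \<le> ((a y)\<^sup>2 + (p' y)\<^sup>2) * ((cos \<theta>)\<^sup>2 + (T y)\<^sup>2)"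
        using zero_le_power2[of "a y * T y + p' y * cos \<theta>"]
        by (simp add: power2_eq_square algebra_simps)
      then show ?thesis by (metis real_le_rsqrt real_sqrt_mult)
    qed
    also have "(cos \<theta>)\<^sup>2 + (T y)\<^sup>2 \<le> 1"
      using T2[OF y] sin_cos_squared_add[of \<theta>] unfolding s_def by linarith
    then have "sqrt ((a y)\<^sup>2 + (p' y)\<^sup>2) * sqrt ((cos \<theta>)\<^sup>2 + (T y)\<^sup>2) \<le> sqrt ((a y)\<^sup>2 + (p' y)\<^sup>2) * 1"
      by (intro mult_left_mono) auto
    finally have 1: "cos \<theta> * a y - p' y * T y \<le> sqrt ((a y)\<^sup>2 + (p' y)\<^sup>2)" by simp
    \<comment> \<open>Arithmetic and geometric mean of the two diagonal entries of the derivative of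
      the Knothe map. The vertical entry is \<open>2 * s * (p y)\<^sup>2 / m\<close>, the horizontal
      one \<open>\<kappa> * m / (2 * s)\<close>; their product is the Jacobian
      \<open>\<kappa> * (p y)\<^sup>2\<close> prescribed by the transport.\<close>
    have "2 * sqrt \<kappa> * p y \<le> 2 * s * (p y)\<^sup>2 / m + \<kappa> * m / (2 * s)"
    proof -
      have "0 \<le> (2 * s * p y - sqrt \<kappa> * m)\<^sup>2 / (2 * s * m)" using s m(2) by simp
      also have "\<dots> = 2 * s * (p y)\<^sup>2 / m + \<kappa> * m / (2 * s) - 2 * sqrt \<kappa> * p y"
        using s m(2) \<kappa> by (simp add: power2_diff power_mult_distrib divide_simps)
           (simp add: power2_eq_square algebra_simps)
      finally show ?thesis by simp
    qed
    then have "2 * sqrt \<kappa> * p y * p y \<le> (2 * s * (p y)\<^sup>2 / m + \<kappa> * m / (2 * s)) * p y"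
      by (intro mult_right_mono nn)
    then have 2: "2 * sqrt \<kappa> * (p y)\<^sup>2 \<le> 2 * s * (p y)\<^sup>2 / m * p y + \<kappa> * m / (2 * s) * p y"
      by (simp add: power2_eq_square algebra_simps)
    show ?thesis using 1 2 by (simp add: k_def)
  qed
  have "((\<lambda>y. cos \<theta> * a y - k y + 2 * sqrt \<kappa> * (p y)\<^sup>2 - \<kappa> * m / (2 * s) * p y) has_integral
      cos \<theta> * integral {-R..R} a - 0 + 2 * sqrt \<kappa> * m - \<kappa> * m / (2 * s) * integral {-R..R} p) {-R..R}"
    unfolding m(1)
    by (intro has_integral_add has_integral_diff has_integral_mult_right k0
        integrable_integral integrable_continuous_real cp cp2 ca)
  moreover have "((\<lambda>y. sqrt ((a y)\<^sup>2 + (p' y)\<^sup>2)) has_integral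
      integral {-R..R} (\<lambda>y. sqrt ((a y)\<^sup>2 + (p' y)\<^sup>2))) {-R..R}"
    by (intro integrable_integral integrable_continuous_real continuous_intros cp' ca)
  ultimately have "cos \<theta> * integral {-R..R} a - 0 + 2 * sqrt \<kappa> * m - \<kappa> * m / (2 * s) * integral {-R..R} p
      \<le> integral {-R..R} (\<lambda>y. sqrt ((a y)\<^sup>2 + (p' y)\<^sup>2))"
    by (rule has_integral_le) (rule pw)
  then show ?thesis by (simp add: s_def algebra_simps)
qed

text \<open>The measure with density \<open>\<kappa> * f\<^sup>2\<close> is transported to Lebesgue
  measure on the unit disc by a triangular map of norm at most 1 and divergence at least
  \<open>2 * sqrt \<kappa> * f\<close>. Pairing this map with the gradient and integrating by parts
  gives \<open>2 * sqrt \<kappa> * \<integral>f\<^sup>2 \<le> \<integral>|\<nabla>f|\<close>; the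
  total mass must be the area of the disc, so \<open>\<kappa> = pi / MM\<close>, and squaring yields
  \<open>4 * pi\<close>.\<close>

lemma sobolev_plane_square:
  fixes f fx fy :: "real \<Rightarrow> real \<Rightarrow> real"
  assumes R: "0 < R" and nn: "\<And>x y. 0 \<le> f x y"
    and cf: "continuous_on UNIV (\<lambda>(x, y). f x y)"
    and cfx: "continuous_on UNIV (\<lambda>(x, y). fx x y)"
    and cfy: "continuous_on UNIV (\<lambda>(x, y). fy x y)"
    and dfx: "\<And>x y. ((\<lambda>x. f x y) has_real_derivative fx x y) (at x)"
    and dfy: "\<And>x y. (f x has_real_derivative fy x y) (at y)"
    and supp: "\<And>x y. R \<le> \<bar>x\<bar> \<or> R \<le> \<bar>y\<bar> \<Longrightarrow> f x y = 0"
  shows "4 * pi * integral {-R..R} (\<lambda>x. integral {-R..R} (\<lambda>y. (f x y)\<^sup>2))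
    \<le> (integral {-R..R} (\<lambda>x. integral {-R..R} (\<lambda>y. sqrt ((fx x y)\<^sup>2 + (fy x y)\<^sup>2))))\<^sup>2"
proof -
  define m where "m x = integral {-R..R} (\<lambda>y. (f x y)\<^sup>2)" for x
  define F where "F x = integral {-R..R} (f x)" for x
  define F' where "F' x = integral {-R..R} (fx x)" for x
  define g where "g x = integral {-R..R} (\<lambda>y. sqrt ((fx x y)\<^sup>2 + (fy x y)\<^sup>2))" for x
  define MM where "MM = integral {-R..R} m"
  have par: "continuous_on UNIV (\<lambda>x. integral {-R..R} (k x))" if "continuous_on UNIV (\<lambda>(x, y). k x y)"
    for k :: "real \<Rightarrow> real \<Rightarrow> real"
    using integral_continuous_on_param[of UNIV "-R" R k] continuous_on_subset[OF that] by auto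
  have cm: "continuous_on A m" and cF: "continuous_on A F" and cF': "continuous_on A F'"
    and cg: "continuous_on A g" for A
  proof -
    have "continuous_on UNIV (\<lambda>(x, y). (f x y)\<^sup>2)"
      "continuous_on UNIV (\<lambda>(x, y). sqrt ((fx x y)\<^sup>2 + (fy x y)\<^sup>2))"
      using cf cfx cfy by (auto simp: split_beta intro!: continuous_intros)
    then show "continuous_on A m" "continuous_on A F" "continuous_on A F'" "continuous_on A g"
      unfolding m_def F_def F'_def g_def
      by (auto intro!: continuous_on_subset[OF par] cf cfx)
  qed
  have sl: "continuous_on A (k x)" if "continuous_on UNIV (\<lambda>(x, y). k x y)"
    for k :: "real \<Rightarrow> real \<Rightarrow> real" and x A
    using continuous_on_compose2[OF that, of A "\<lambda>y. (x, y)"]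
      continuous_on_Pair[OF continuous_on_const continuous_on_id, of A x] by simp
  note slf = sl[OF cf] and slfx = sl[OF cfx] and slfy = sl[OF cfy]
  have m0: "0 \<le> m x" for x unfolding m_def
    by (intro integral_nonneg integrable_continuous_real continuous_intros slf) auto
  have F0: "0 \<le> F x" for x unfolding F_def
    by (intro integral_nonneg integrable_continuous_real slf) (auto simp: nn)
  have g0: "0 \<le> g x" for x unfolding g_def
    by (intro integral_nonneg integrable_continuous_real continuous_intros slfx slfy) auto
  have Fz: "F x = 0" if "m x = 0" for x
  proof -
    have "\<forall>y\<in>{-R..R}. (f x y)\<^sup>2 = 0"
      using that R unfolding m_def
      by (subst (asm) integral_eq_0_iff) (auto intro!: continuous_intros slf)
    then have "F x = integral {-R..R} (\<lambda>y. 0)"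
      unfolding F_def by (intro integral_cong) auto
    then show ?thesis by simp
  qed
  have dF: "(F has_real_derivative F' x) (at x)" for x
    unfolding F_def F'_def
    using leibniz_rule_field_derivative[of UNIV "-R" R f fx x] continuous_on_subset[OF cfx, of "UNIV \<times> {-R..R}"]
    by (auto simp: dfx intro!: integrable_continuous_real slf)
  show ?thesis
  proof (cases "MM = 0")
    case True then show ?thesis by (simp add: MM_def m_def[abs_def])
  next
    case False
    have "0 \<le> MM" unfolding MM_def using m0 by (intro integral_nonneg integrable_continuous_real cm) auto
    with False have MM: "0 < MM" by simp
    define \<kappa> where "\<kappa> = pi / MM"
    have \<kappa>: "0 < \<kappa>" using MM by (simp add: \<kappa>_def)
    obtain \<theta> :: "real \<Rightarrow> real" where th: "\<And>s. 0 < s \<Longrightarrow> s < pi \<Longrightarrow>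
       0 < \<theta> s \<and> \<theta> s < pi \<and> (\<theta> has_real_derivative 1 / (2 * (sin (\<theta> s))\<^sup>2)) (at s)"
      using disc_sector_angle by metis
    \<comment> \<open>The area of the disc that the mass to the left of \<open>x\<close> has to
      fill. It determines the chord, and \<open>T x\<close> is the first coordinate of the Knothe
      map.\<close>
    define P where "P x = \<kappa> * integral {-R..x} m" for x
    define T where "T x = - cos (\<theta> (P x))" for x
    \<comment> \<open>The derivative of \<open>F * T\<close>. Where \<open>m x = 0\<close>, the
      angle may be an arbitrary value without derivative. Still \<open>F * T\<close> has derivative
      0 there, because \<open>\<bar>F * T\<bar> \<le> F\<close> and \<open>F \<ge> 0\<close> attains
      its minimum 0.\<close>
    define k where "k x = (if m x = 0 then 0 else F' x * T x + \<kappa> * m x / (2 * sin (\<theta> (P x))) * F x)" for x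
    have dP: "(P has_real_derivative \<kappa> * m x) (at x)" if "x \<in> {-R<..<R}" for x
    proof -
      have "((\<lambda>x. integral {-R..x} m) has_real_derivative m x) (at x within {-R..R})"
        using that by (intro integral_has_real_derivative cm) auto
      then have "((\<lambda>x. integral {-R..x} m) has_real_derivative m x) (at x)"
        using that by (simp add: at_within_Icc_at)
      then show ?thesis unfolding P_def by (auto intro!: derivative_eq_intros)
    qed
    have P01: "0 < P x \<and> P x < pi" if x: "x \<in> {-R<..<R}" "m x \<noteq> 0" for x
    proof -
      have mx: "0 < m x" using m0[of x] x by simp
      have 1: "0 < integral {-R..x} m" "0 < integral {x..R} m"
        using x mx by (auto intro!: integral_pos_if_continuous[of _ _ m x] cm m0)
      have "integral {-R..x} m + integral {x..R} m = MM"
        unfolding MM_def using x by (intro Henstock_Kurzweil_Integration.integral_combine integrable_continuous_real cm) auto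
      then have "integral {-R..x} m < MM" using 1 by simp
      then show ?thesis using 1 MM by (simp add: P_def \<kappa>_def field_simps)
    qed
    have bnd: "\<bar>F x * T x\<bar> \<le> F x" for x
      using F0[of x] by (simp add: abs_mult T_def mult_left_le)
    have dK: "((\<lambda>x. F x * T x) has_real_derivative k x) (at x)" if x: "x \<in> {-R<..<R}" for x
    proof (cases "m x = 0")
      case True
      then have Fx: "F x = 0" by (rule Fz)
      have "F' x = 0"
        using DERIV_local_min[OF dF, of 1 x] F0 Fx by auto
      then have "((\<lambda>h. F (x + h) / h) \<longlongrightarrow> 0) (at 0)"
        using dF[of x] Fx by (simp add: DERIV_def)
      then have "((\<lambda>h. F (x + h) * T (x + h) / h) \<longlongrightarrow> 0) (at 0)"
        by (rule Lim_null_comparison[rotated, OF tendsto_norm_zero])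
           (auto simp: abs_divide intro!: always_eventually divide_right_mono bnd[THEN order_trans])
      then show ?thesis using True Fx by (simp add: DERIV_def k_def)
    next
      case False
      note P = P01[OF x False]
      note t = th[OF P[THEN conjunct1] P[THEN conjunct2]]
      have s: "0 < sin (\<theta> (P x))" using t by (intro sin_gt_zero) auto
      have "((\<lambda>x. \<theta> (P x)) has_real_derivative 1 / (2 * (sin (\<theta> (P x)))\<^sup>2) * (\<kappa> * m x)) (at x)"
        using DERIV_chain2[OF _ dP[OF x]] t by blast
      then have "(T has_real_derivative \<kappa> * m x / (2 * sin (\<theta> (P x)))) (at x)"
        unfolding T_def using s by (auto intro!: derivative_eq_intros simp: power2_eq_square)
      then have "((\<lambda>x. F x * T x) has_real_derivative F' x * T x + \<kappa> * m x / (2 * sin (\<theta> (P x))) * F x) (at x)"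
        by (rule DERIV_mult[OF dF])
      then show ?thesis using False by (simp only: k_def if_False)
    qed
    have FR: "F x = 0" if "R \<le> \<bar>x\<bar>" for x
      unfolding F_def using that supp by (intro integral_unique has_integral_is_0) auto
    have "continuous_on {-R..R} (\<lambda>x. F x * T x)"
      unfolding continuous_on_eq_continuous_within
    proof
      fix x assume x: "x \<in> {-R..R}"
      show "continuous (at x within {-R..R}) (\<lambda>x. F x * T x)"
      proof (cases "x \<in> {-R<..<R}")
        case True then show ?thesis using dK DERIV_isCont continuous_at_imp_continuous_at_within by blast
      next
        case False
        then have Fx: "F x = 0" using x by (intro FR) auto
        have "(F \<longlongrightarrow> 0) (at x within {-R..R})"
          using cF[of "{-R..R}", unfolded continuous_on_def, rule_format, OF x] Fx by simp
        then have "((\<lambda>x. F x * T x) \<longlongrightarrow> 0) (at x within {-R..R})"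
          by (rule Lim_null_comparison[rotated]) (auto intro!: always_eventually bnd)
        then show ?thesis using Fx by (simp add: continuous_within)
      qed
    qed
    then have kint: "(k has_integral F R * T R - F (-R) * T (-R)) {-R..R}"
      using R dK by (intro fundamental_theorem_of_calculus_interior)
        (auto simp: has_real_derivative_iff_has_vector_derivative[symmetric])
    then have kint: "(k has_integral 0) {-R..R}" using R by (simp add: FR)
    have "((\<lambda>x. 2 * sqrt \<kappa> * m x - k x) has_integral 2 * sqrt \<kappa> * MM - 0) {-R..R}"
      unfolding MM_def
      by (intro has_integral_diff has_integral_mult_right integrable_integral integrable_continuous_real cm kint)
    then have "((\<lambda>x. 2 * sqrt \<kappa> * m x - k x) has_integral 2 * sqrt \<kappa> * MM - 0) {-R<..<R}"
      by (simp add: has_integral_Icc_iff_Ioo)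
    moreover have "(g has_integral integral {-R..R} g) {-R<..<R}"
      using integrable_integral[OF integrable_continuous_real[OF cg]] by (simp add: has_integral_Icc_iff_Ioo)
    ultimately have "2 * sqrt \<kappa> * MM - 0 \<le> integral {-R..R} g"
    proof (rule has_integral_le)
      fix x assume x: "x \<in> {-R<..<R}"
      show "2 * sqrt \<kappa> * m x - k x \<le> g x"
      proof (cases "m x = 0")
        case True then show ?thesis using g0 by (simp add: k_def)
      next
        case False
        note P = P01[OF x False]
        note t = th[OF P[THEN conjunct1] P[THEN conjunct2]]
        have "0 < m x" using m0[of x] False by simp
        then have "2 * sqrt \<kappa> * m x + cos (\<theta> (P x)) * F' x - \<kappa> * m x / (2 * sin (\<theta> (P x))) * F x \<le> g x"
          unfolding g_def F'_def F_def using R t \<kappa>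
          by (intro knothe_slice dfy slfx slfy nn supp) (auto simp: m_def)
        then show ?thesis using False by (simp add: k_def T_def algebra_simps)
      qed
    qed
    then have "(2 * sqrt \<kappa> * MM)\<^sup>2 \<le> (integral {-R..R} g)\<^sup>2"
      using \<kappa> MM by (intro power_mono) auto
    moreover have "(2 * sqrt \<kappa> * MM)\<^sup>2 = 4 * pi * MM"
      using \<kappa> MM by (simp add: power_mult_distrib) (simp add: \<kappa>_def power2_eq_square)
    ultimately show ?thesis by (simp add: MM_def m_def[abs_def] g_def[abs_def])
  qed
qed

section \<open>Integrals and derivatives in \<open>real^2\<close>\<close>

lemma vector2_eq: "(vector [x, y] :: real^2) = x *\<^sub>R axis 1 1 + y *\<^sub>R axis 2 1"
  by (simp add: vec_eq_iff forall_2 axis_def)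

lemma inner_vec2: "(x :: real^2) \<bullet> y = x $ 1 * y $ 1 + x $ 2 * y $ 2"
  by (simp add: inner_vec_def sum_2)

lemma norm_vec2: "norm (x :: real^2) = sqrt ((x $ 1)\<^sup>2 + (x $ 2)\<^sup>2)"
  by (simp add: norm_eq_sqrt_inner inner_vec2 power2_eq_square)

lemma linear_vec2:
  fixes f :: "real^2 \<Rightarrow> 'b::real_vector"
  assumes "linear f"
  shows "f v = v $ 1 *\<^sub>R f (axis 1 1) + v $ 2 *\<^sub>R f (axis 2 1)"
proof -
  have "v = v $ 1 *\<^sub>R axis 1 1 + v $ 2 *\<^sub>R axis 2 1"
    by (simp add: vec_eq_iff forall_2 axis_def)
  then have "f v = f (v $ 1 *\<^sub>R axis 1 1 + v $ 2 *\<^sub>R axis 2 1)" by simp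
  then show ?thesis using assms by (simp add: linear_add linear_cmul)
qed

text \<open>The coordinate map between \<open>real^2\<close> and pairs of reals sends boxes to boxes
  of the same content, so gauge integrals can be carried along it; over pairs, the integral of a
  continuous function is iterated.\<close>

lemma integral_plane_iterated:
  fixes k :: "real^2 \<Rightarrow> real"
  assumes ck: "continuous_on UNIV k" and R: "0 \<le> R"
    and supp: "\<And>x. R < norm x \<Longrightarrow> k x = 0"
  shows "(k has_integral integral {-R..R} (\<lambda>x. integral {-R..R} (\<lambda>y. k (vector [x, y])))) UNIV"
proof -
  define h :: "real \<times> real \<Rightarrow> real^2" where "h z = vector [fst z, snd z]" for z
  define g :: "real^2 \<Rightarrow> real \<times> real" where "g x = (x $ 1, x $ 2)" for x
  define f where "f z = k (h z)" for z
  have hg: "h (g x) = x" for x by (simp add: h_def g_def vec_eq_iff forall_2)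
  have gh: "g (h z) = z" for z by (simp add: h_def g_def)
  have ch: "continuous_on A h" for A
    unfolding h_def vector2_eq by (intro continuous_intros)
  have g_box: "g ` cbox u v = cbox (g u) (g v)" for u v
  proof
    show "g ` cbox u v \<subseteq> cbox (g u) (g v)" by (auto simp: g_def mem_box_cart)
    show "cbox (g u) (g v) \<subseteq> g ` cbox u v"
    proof
      fix z assume "z \<in> cbox (g u) (g v)"
      then have "h z \<in> cbox u v" by (cases z) (auto simp: h_def g_def mem_box_cart forall_2)
      then show "z \<in> g ` cbox u v" using gh[of z] by (metis imageI)
    qed
  qed
  have h_box: "h ` cbox u v = cbox (h u) (h v)" for u v
  proof -
    have "h ` cbox u v = h ` g ` cbox (h u) (h v)" by (simp add: g_box gh)
    then show ?thesis by (simp add: image_image hg)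
  qed
  have content: "measure lborel (g ` cbox u v) = 1 * measure lborel (cbox u v)" for u v :: "real^2"
  proof (cases "cbox u v = {}")
    case False
    then have le: "u $ 1 \<le> v $ 1" "u $ 2 \<le> v $ 2" by (auto simp: box_ne_empty cart_eq_inner_axis forall_2 Basis_vec_def axis_eq_axis)
    then have "measure lborel (cbox u v) = (v $ 1 - u $ 1) * (v $ 2 - u $ 2)"
      using content_cbox_cart[OF False] by (simp add: UNIV_2)
    moreover have "measure lborel (g ` cbox u v) = (v $ 1 - u $ 1) * (v $ 2 - u $ 2)"
      unfolding g_box using le by (simp add: g_def content_Pair)
    ultimately show ?thesis by simp
  qed auto
  have cf: "continuous_on A f" for A
    unfolding f_def by (intro continuous_on_compose2[OF ck ch]) auto
  let ?I = "integral (cbox (-R, -R) (R, R)) f"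
  have "(f has_integral ?I) (cbox (-R, -R) (R, R))"
    by (intro integrable_integral integrable_continuous cf)
  then have "((\<lambda>x. f (g x)) has_integral (1 / 1) *\<^sub>R ?I) (h ` cbox (-R, -R) (R, R))"
  proof (rule has_integral_twiddle[where g = g and h = h, rotated -1])
    show "continuous (at x) g" for x
      unfolding g_def by (intro continuous_intros)
    show "\<exists>w z. g ` cbox u v = cbox w z" "\<exists>w z. h ` cbox u' v' = cbox w z" for u v u' v'
      using g_box h_box by blast+
  qed (use hg gh content in auto)
  moreover have "k x = 0" if "x \<notin> h ` cbox (-R, -R) (R, R)" for x
  proof (rule supp)
    have "\<not> (\<bar>x $ 1\<bar> \<le> R \<and> \<bar>x $ 2\<bar> \<le> R)"
      using that by (auto simp: h_box mem_box_cart forall_2) (auto simp: h_def)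
    then show "R < norm x"
      using component_le_norm_cart[of x 1] component_le_norm_cart[of x 2] by linarith
  qed
  ultimately have "(k has_integral ?I) UNIV"
    using has_integral_on_superset[of k ?I "h ` cbox (-R, -R) (R, R)" UNIV]
    by (simp add: f_def hg)
  also have "?I = integral {-R..R} (\<lambda>x. integral {-R..R} (\<lambda>y. k (vector [x, y])))"
    using integral_prod_continuous[OF cf, of "-R" "-R" R R] by (simp add: f_def h_def)
  finally show ?thesis .
qed

lemma has_real_derivative_vector2:
  fixes f :: "real^2 \<Rightarrow> real"
  assumes "\<And>x. (f has_derivative f' x) (at x)"
  shows "((\<lambda>x. f (vector [x, y])) has_real_derivative f' (vector [x, y]) (axis 1 1)) (at x)"
    and "((\<lambda>y. f (vector [x, y])) has_real_derivative f' (vector [x, y]) (axis 2 1)) (at y)"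
proof -
  have lin: "linear (f' z)" for z using assms has_derivative_linear by blast
  have "((\<lambda>x. vector [x, y] :: real^2) has_derivative (\<lambda>t. t *\<^sub>R axis 1 1)) (at x)"
    "((\<lambda>y. vector [x, y] :: real^2) has_derivative (\<lambda>t. t *\<^sub>R axis 2 1)) (at y)"
    unfolding vector2_eq by (auto intro!: derivative_eq_intros)
  then have "((\<lambda>x. f (vector [x, y])) has_derivative (\<lambda>t. f' (vector [x, y]) (t *\<^sub>R axis 1 1))) (at x)"
    "((\<lambda>y. f (vector [x, y])) has_derivative (\<lambda>t. f' (vector [x, y]) (t *\<^sub>R axis 2 1))) (at y)"
    using assms by (auto intro: has_derivative_compose)
  then show "((\<lambda>x. f (vector [x, y])) has_real_derivative f' (vector [x, y]) (axis 1 1)) (at x)"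
    "((\<lambda>y. f (vector [x, y])) has_real_derivative f' (vector [x, y]) (axis 2 1)) (at y)"
    by (simp_all add: has_field_derivative_def linear_cmul[OF lin] mult.commute[of _ "f' _ _"] mult_commute_abs)
qed

lemma continuous_on_vector2:
  assumes "continuous_on UNIV (k :: real^2 \<Rightarrow> 'b::topological_space)"
  shows "continuous_on UNIV (\<lambda>(x, y). k (vector [x, y]))"
  unfolding split_beta vector2_eq
  by (rule continuous_on_compose2[OF assms]) (auto intro!: continuous_intros)

lemma sobolev_plane:
  fixes f :: "real^2 \<Rightarrow> real" and G :: "real^2 \<Rightarrow> real^2"
  assumes df: "\<And>x. (f has_derivative (\<lambda>v. G x \<bullet> v)) (at x)"
    and cG: "continuous_on UNIV G" and nn: "\<And>x. 0 \<le> f x"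
    and supp: "\<And>x. R \<le> norm x \<Longrightarrow> f x = 0 \<and> G x = 0" and R: "0 < R"
  shows "4 * pi * integral UNIV (\<lambda>x. (f x)\<^sup>2) \<le> (integral UNIV (\<lambda>x. norm (G x)))\<^sup>2"
proof -
  have cf: "continuous_on UNIV f"
    using df by (meson has_derivative_continuous continuous_at_imp_continuous_on)
  have n: "R \<le> norm (vector [x, y] :: real^2)" if "R \<le> \<bar>x\<bar> \<or> R \<le> \<bar>y\<bar>" for x y
    using that component_le_norm_cart[of "vector [x, y] :: real^2" 1]
      component_le_norm_cart[of "vector [x, y] :: real^2" 2] by auto
  have "4 * pi * integral {-R..R} (\<lambda>x. integral {-R..R} (\<lambda>y. (f (vector [x, y]))\<^sup>2))
    \<le> (integral {-R..R} (\<lambda>x. integral {-R..R} (\<lambda>y.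
        sqrt ((G (vector [x, y]) $ 1)\<^sup>2 + (G (vector [x, y]) $ 2)\<^sup>2))))\<^sup>2"
  proof (rule sobolev_plane_square[OF R])
    show "continuous_on UNIV (\<lambda>(x, y). G (vector [x, y]) $ 1)"
      "continuous_on UNIV (\<lambda>(x, y). G (vector [x, y]) $ 2)"
      by (rule continuous_on_vector2, intro continuous_intros cG)+
    show "((\<lambda>x. f (vector [x, y])) has_real_derivative G (vector [x, y]) $ 1) (at x)"
      "((\<lambda>y. f (vector [x, y])) has_real_derivative G (vector [x, y]) $ 2) (at y)" for x y
      using has_real_derivative_vector2[OF df] by (simp_all add: inner_axis)
  qed (use nn supp n continuous_on_vector2[OF cf] in auto)
  moreover have "integral UNIV (\<lambda>x. (f x)\<^sup>2) =
      integral {-R..R} (\<lambda>x. integral {-R..R} (\<lambda>y. (f (vector [x, y]))\<^sup>2))"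
    using R supp by (intro integral_unique integral_plane_iterated continuous_intros cf) auto
  moreover have "integral UNIV (\<lambda>x. norm (G x)) =
      integral {-R..R} (\<lambda>x. integral {-R..R} (\<lambda>y. norm (G (vector [x, y]))))"
    using R supp by (intro integral_unique integral_plane_iterated continuous_intros cG) auto
  ultimately show ?thesis by (simp add: norm_vec2)
qed

text \<open>Each partial derivative is integrated along its own axis, where it yields a difference
  of two vanishing values of \<open>Y\<close>. For the first of them the order of integration is
  exchanged beforehand.\<close>

lemma divergence_plane:
  fixes Y :: "real^2 \<Rightarrow> real^2"
  assumes dY: "\<And>x. (Y has_derivative Y' x) (at x)"
    and cY: "\<And>v. continuous_on UNIV (\<lambda>x. Y' x v)"
    and supp: "\<And>x. R \<le> norm x \<Longrightarrow> Y x = 0 \<and> Y' x = (\<lambda>v. 0)" and R: "0 < R"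
  shows "integral UNIV (\<lambda>x. Y' x (axis 1 1) $ 1 + Y' x (axis 2 1) $ 2) = 0"
proof -
  define k1 where "k1 x y = Y' (vector [x, y]) (axis 1 1) $ 1" for x y
  define k2 where "k2 x y = Y' (vector [x, y]) (axis 2 1) $ 2" for x y
  have n: "R \<le> norm (vector [x, y] :: real^2)" if "R \<le> \<bar>x\<bar> \<or> R \<le> \<bar>y\<bar>" for x y
    using that component_le_norm_cart[of "vector [x, y] :: real^2" 1]
      component_le_norm_cart[of "vector [x, y] :: real^2" 2] by auto
  have c: "continuous_on UNIV (\<lambda>(x, y). k1 x y)" "continuous_on UNIV (\<lambda>(x, y). k2 x y)"
    unfolding k1_def k2_def by (rule continuous_on_vector2, intro continuous_intros cY)+
  have i1: "integral {-R..R} (\<lambda>x. k1 x y) = 0" for y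
  proof -
    have "((\<lambda>x. k1 x y) has_integral Y (vector [R, y]) $ 1 - Y (vector [-R, y]) $ 1) {-R..R}"
      unfolding k1_def using R
        has_real_derivative_vector2(1)[OF bounded_linear.has_derivative[OF bounded_linear_vec_nth dY]]
      by (intro fundamental_theorem_of_calculus)
        (auto simp: has_real_derivative_iff_has_vector_derivative intro: has_vector_derivative_at_within)
    then show ?thesis using R supp[OF n[of R y]] supp[OF n[of "-R" y]] by (simp add: integral_unique)
  qed
  have i2: "integral {-R..R} (\<lambda>y. k2 x y) = 0" for x
  proof -
    have "((\<lambda>y. k2 x y) has_integral Y (vector [x, R]) $ 2 - Y (vector [x, -R]) $ 2) {-R..R}"
      unfolding k2_def using R
        has_real_derivative_vector2(2)[OF bounded_linear.has_derivative[OF bounded_linear_vec_nth dY]]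
      by (intro fundamental_theorem_of_calculus)
        (auto simp: has_real_derivative_iff_has_vector_derivative intro: has_vector_derivative_at_within)
    then show ?thesis using R supp[OF n[of x R]] supp[OF n[of x "-R"]] by (simp add: integral_unique)
  qed
  have "((\<lambda>x. Y' x (axis 1 1) $ 1) has_integral
      integral {-R..R} (\<lambda>x. integral {-R..R} (\<lambda>y. k1 x y))) UNIV"
    unfolding k1_def using R supp by (intro integral_plane_iterated continuous_intros cY) auto
  also have "integral {-R..R} (\<lambda>x. integral {-R..R} (\<lambda>y. k1 x y)) = 0"
    using integral_swap_continuous[of "-R" "-R" R R k1] continuous_on_subset[OF c(1)] by (simp add: i1)
  finally have 1: "((\<lambda>x. Y' x (axis 1 1) $ 1) has_integral 0) UNIV" .
  have "((\<lambda>x. Y' x (axis 2 1) $ 2) has_integral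
      integral {-R..R} (\<lambda>x. integral {-R..R} (\<lambda>y. k2 x y))) UNIV"
    unfolding k2_def using R supp by (intro integral_plane_iterated continuous_intros cY) auto
  then have 2: "((\<lambda>x. Y' x (axis 2 1) $ 2) has_integral 0) UNIV" by (simp add: i2)
  show ?thesis using has_integral_add[OF 1 2] by (simp add: integral_unique)
qed

section \<open>Heights of singular minimal graphs\<close>

text \<open>The \<open>W\<close> of the overview: the density of the area of the graph over the
  plane, and by \<open>slope_of_normal\<close> the reciprocal of the component of the unit normal in
  the direction of the graph.\<close>

definition slope :: "real^2 \<Rightarrow> real" where
  "slope G = sqrt (1 + G \<bullet> G)"

text \<open>The mean curvature operator \<open>(1 + u\<^sub>y\<^sup>2) u\<^sub>x\<^sub>x - 2 u\<^sub>x u\<^sub>y u\<^sub>x\<^sub>y + (1 + u\<^sub>x\<^sup>2) u\<^sub>y\<^sub>y\<close>, for a gradient \<open>G\<close> with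
  derivative \<open>B\<close>. Writing the quadratic terms through the rotated gradient makes it a sum of pure
  second derivatives.\<close>

definition rot :: "real^2 \<Rightarrow> real^2" where
  "rot G = vector [G $ 2, - (G $ 1)]"

definition mc_op :: "(real^2 \<Rightarrow> real^2) \<Rightarrow> real^2 \<Rightarrow> real" where
  "mc_op B G = B (axis 1 1) $ 1 + B (axis 2 1) $ 2 + B (rot G) \<bullet> rot G"

lemma slope_pos: "0 < slope G" and slope_ge_1: "1 \<le> slope G" and slope_sq: "(slope G)\<^sup>2 = 1 + G \<bullet> G"
proof -
  have "0 \<le> G \<bullet> G" by simp
  then show "0 < slope G" "1 \<le> slope G" "(slope G)\<^sup>2 = 1 + G \<bullet> G"
    unfolding slope_def by (simp_all add: add_pos_nonneg del: inner_ge_zero)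
qed

lemma slope_nz: "slope G \<noteq> 0"
  using slope_pos[of G] by simp

lemma has_derivative_slope:
  assumes "(G has_derivative B) (at x)"
  shows "((\<lambda>x. slope (G x)) has_derivative (\<lambda>v. (G x \<bullet> B v) / slope (G x))) (at x)"
proof -
  have "0 < 1 + G x \<bullet> G x" using slope_sq[of "G x"] slope_pos[of "G x"] by (metis zero_less_power)
  then show ?thesis
    unfolding slope_def using assms
    by (auto intro!: derivative_eq_intros simp: inner_commute field_simps)
qed

lemma has_derivative_unit_gradient:
  assumes "(G has_derivative B) (at x)"
  shows "((\<lambda>x. (1 / slope (G x)) *\<^sub>R G x) has_derivative
      (\<lambda>v. (1 / slope (G x)) *\<^sub>R B v - ((G x \<bullet> B v) / (slope (G x)) ^ 3) *\<^sub>R G x)) (at x)"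
proof -
  have "((\<lambda>x. 1 / slope (G x)) has_derivative
      (\<lambda>v. - ((G x \<bullet> B v) / (slope (G x)) ^ 3))) (at x)"
    using slope_pos[of "G x"] has_derivative_slope[OF assms]
    by (auto intro!: derivative_eq_intros simp: field_simps power2_eq_square power3_eq_cube)
  from has_derivative_scaleR[OF this assms] show ?thesis
    by (simp add: algebra_simps)
qed

text \<open>\<open>G\<close> and \<open>rot G\<close> are orthogonal and of equal length, so
  \<open>G \<bullet> G\<close> times the trace of \<open>B\<close> is
  \<open>G \<bullet> B G + B (rot G) \<bullet> rot G\<close>. Expanding the divergence over the
  denominator \<open>(slope G) ^ 3\<close> leaves the trace and the rotated term.\<close>

lemma div_unit_gradient:
  fixes B :: "real^2 \<Rightarrow> real^2" and G :: "real^2"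
  assumes "linear B"
  defines "D \<equiv> \<lambda>v. (1 / slope G) *\<^sub>R B v - ((G \<bullet> B v) / (slope G) ^ 3) *\<^sub>R G"
  shows "D (axis 1 1) $ 1 + D (axis 2 1) $ 2 = mc_op B G / (slope G) ^ 3"
proof -
  have r: "B (rot G) = G $ 2 *\<^sub>R B (axis 1 1) - G $ 1 *\<^sub>R B (axis 2 1)"
    using linear_vec2[OF assms(1), of "rot G"] by (simp add: rot_def)
  have "D (axis 1 1) $ 1 + D (axis 2 1) $ 2 =
     ((slope G)\<^sup>2 * (B (axis 1 1) $ 1 + B (axis 2 1) $ 2)
      - ((G \<bullet> B (axis 1 1)) * G $ 1 + (G \<bullet> B (axis 2 1)) * G $ 2)) / (slope G) ^ 3"
    using slope_pos[of G] unfolding D_def by (simp add: field_simps power2_eq_square power3_eq_cube)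
  also have "\<dots> = mc_op B G / (slope G) ^ 3"
    unfolding slope_sq mc_op_def r by (simp add: inner_vec2 rot_def algebra_simps)
  finally show ?thesis .
qed

text \<open>\<Omega> and the complement of \<open>K\<close> are open and cover the space, and on the
  complement the extension is identically 0. Regularity of the frontier of \<Omega> never
  enters.\<close>

lemma continuous_on_ext0:
  fixes k :: "'a::t2_space \<Rightarrow> 'b::real_normed_vector"
  assumes "open \<Omega>" "compact K" "K \<subseteq> \<Omega>" "continuous_on \<Omega> k" "\<And>x. x \<in> \<Omega> - K \<Longrightarrow> k x = 0"
  shows "continuous_on UNIV (\<lambda>x. if x \<in> \<Omega> then k x else 0)"
proof -
  let ?e = "\<lambda>x. if x \<in> \<Omega> then k x else 0"
  have "continuous_on (\<Omega> \<union> - K) ?e"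
  proof (rule continuous_on_open_Un)
    show "continuous_on \<Omega> ?e" using assms(4) by (rule continuous_on_eq) auto
    show "continuous_on (- K) ?e"
      by (rule continuous_on_eq[of _ "\<lambda>x. 0"]) (use assms(5) in auto)
  qed (use assms compact_imp_closed in auto)
  moreover have "\<Omega> \<union> - K = UNIV" using assms by auto
  ultimately show ?thesis by simp
qed

lemma has_derivative_ext0:
  fixes k :: "'a::real_normed_vector \<Rightarrow> 'b::real_normed_vector"
  assumes "open \<Omega>" "compact K" "K \<subseteq> \<Omega>" "\<And>x. x \<in> \<Omega> - K \<Longrightarrow> k x = 0"
    and d: "\<And>x. x \<in> \<Omega> \<Longrightarrow> (k has_derivative k' x) (at x)"
  shows "((\<lambda>x. if x \<in> \<Omega> then k x else 0) has_derivative (if x \<in> \<Omega> then k' x else (\<lambda>v. 0))) (at x)"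
proof (cases "x \<in> \<Omega>")
  case True
  have "((\<lambda>x. if x \<in> \<Omega> then k x else 0) has_derivative k' x) (at x)"
    using has_derivative_transform_within_open[OF d[OF True] assms(1) True] by simp
  then show ?thesis using True by simp
next
  case False
  have "open (- K)" using compact_imp_closed[OF assms(2)] by (rule open_Compl)
  then have "((\<lambda>x. if x \<in> \<Omega> then k x else 0) has_derivative (\<lambda>v. 0)) (at x)"
    by (rule has_derivative_transform_within_open[OF has_derivative_const]) (use assms False in auto)
  then show ?thesis using False by simp
qed

lemma discriminant_le:
  fixes S P R :: real
  assumes "\<And>s. 0 \<le> s\<^sup>2 * P + 2 * s * S + R" and "0 \<le> P"
  shows "S\<^sup>2 \<le> P * R"
proof (cases "P = 0")
  case True
  have "S = 0"
  proof (rule ccontr)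
    assume "S \<noteq> 0"
    \<comment> \<open>At this argument the expression, affine since \<open>P = 0\<close>, has the
      value \<open>-1\<close>.\<close>
    then show False using assms(1)[of "- (R + 1) / (2 * S)"] True by (simp add: field_simps)
  qed
  then show ?thesis using True by simp
next
  case False
  with \<open>0 \<le> P\<close> have "P > 0" by simp
  then show ?thesis using assms(1)[of "- S / P"] by (simp add: power2_eq_square field_simps)
qed

text \<open>The part of the graph above level \<open>c\<close>, reduced to analysis in the plane
  with gradient \<open>G\<close> and Hessian \<open>G'\<close>. The condition \<open>cpt\<close>
  stands for the boundary values: \<open>u\<close> tends to \<open>c\<close> when the argument
  leaves the compact subsets of \<Omega>.\<close>

locale singular_height =
  fixes \<Omega> :: "(real^2) set" and u :: "real^2 \<Rightarrow> real" and G :: "real^2 \<Rightarrow> real^2"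
    and G' :: "real^2 \<Rightarrow> real^2 \<Rightarrow> real^2" and \<alpha> c :: real
  assumes op: "open \<Omega>"
    and du: "\<And>x. x \<in> \<Omega> \<Longrightarrow> (u has_derivative (\<lambda>v. G x \<bullet> v)) (at x)"
    and dG: "\<And>x. x \<in> \<Omega> \<Longrightarrow> (G has_derivative G' x) (at x)"
    and cG': "\<And>v. continuous_on \<Omega> (\<lambda>x. G' x v)"
    and gt: "\<And>x. x \<in> \<Omega> \<Longrightarrow> c < u x"
    and cpt: "\<And>t. c < t \<Longrightarrow> compact {x \<in> \<Omega>. t \<le> u x}"
    and eqn: "\<And>x. x \<in> \<Omega> \<Longrightarrow> mc_op (G' x) (G x) = \<alpha> * (slope (G x))\<^sup>2 / u x"
    and c0: "0 < c" and \<alpha>: "\<alpha> < 0"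
begin

text \<open>Exactly what makes the extension by 0 continuous with compact support. The threshold
  \<open>t\<close> may depend on the integrand, which keeps the class closed under sums.\<close>

definition adm :: "(real^2 \<Rightarrow> 'b::real_normed_vector) \<Rightarrow> bool" where
  "adm k \<longleftrightarrow> continuous_on \<Omega> k \<and> (\<exists>t>c. \<forall>x\<in>\<Omega>. u x < t \<longrightarrow> k x = 0)"

definition E :: "(real^2 \<Rightarrow> real) \<Rightarrow> real" where
  "E k = integral UNIV (\<lambda>x. if x \<in> \<Omega> then k x else 0)"

lemma cu: "continuous_on \<Omega> u" and cG: "continuous_on \<Omega> G"
  using du dG by (meson has_derivative_continuous continuous_at_imp_continuous_on)+

lemma cslope: "continuous_on \<Omega> (\<lambda>x. slope (G x))"
  unfolding slope_def by (intro continuous_intros cG)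

lemma adm_cont: "adm k \<Longrightarrow> continuous_on UNIV (\<lambda>x. if x \<in> \<Omega> then k x else 0)"
  unfolding adm_def using op cpt
  by (auto intro!: continuous_on_ext0[where K = "{x \<in> \<Omega>. t \<le> u x}" for t])

lemma radius:
  assumes "c < t"
  obtains R where "0 < R" "\<And>x. x \<in> \<Omega> \<Longrightarrow> t \<le> u x \<Longrightarrow> norm x < R"
  using compact_imp_bounded[OF cpt[OF assms]] unfolding bounded_pos_less by auto

lemma adm_int:
  fixes k :: "real^2 \<Rightarrow> real"
  assumes "adm k" shows "(\<lambda>x. if x \<in> \<Omega> then k x else 0) integrable_on UNIV"
proof -
  obtain t where t: "c < t" "\<And>x. x \<in> \<Omega> \<Longrightarrow> u x < t \<Longrightarrow> k x = 0"
    using assms unfolding adm_def by auto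
  obtain R where R: "0 < R" "\<And>x. x \<in> \<Omega> \<Longrightarrow> t \<le> u x \<Longrightarrow> norm x < R"
    using radius[OF t(1)] by metis
  have "k x = 0" if "x \<in> \<Omega>" "R < norm x" for x
    using t(2)[OF that(1)] R(2)[OF that(1)] that(2) by fastforce
  then show ?thesis
    using R(1) integral_plane_iterated[OF adm_cont[OF assms], of R] by (force intro: has_integral_integrable)
qed

lemma E_mono: "adm k \<Longrightarrow> adm k' \<Longrightarrow> (\<And>x. x \<in> \<Omega> \<Longrightarrow> k x \<le> k' x) \<Longrightarrow> E k \<le> E k'"
  unfolding E_def by (intro integral_le adm_int) auto

lemma E_add: "adm k \<Longrightarrow> adm k' \<Longrightarrow> E (\<lambda>x. k x + k' x) = E k + E k'"
  unfolding E_def by (subst Henstock_Kurzweil_Integration.integral_add[symmetric])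
    (auto intro!: adm_int Henstock_Kurzweil_Integration.integral_cong)

lemma E_cmul: "E (\<lambda>x. r * k x) = r * E k"
proof -
  have "(\<lambda>x. if x \<in> \<Omega> then r * k x else 0) = (\<lambda>x. r * (if x \<in> \<Omega> then k x else 0))" by auto
  then show ?thesis by (simp add: E_def)
qed

lemma adm_add: "adm k \<Longrightarrow> adm k' \<Longrightarrow> adm (\<lambda>x. k x + k' x)"
  unfolding adm_def
proof (elim conjE exE, intro conjI continuous_intros; assumption?)
  fix t t' assume "c < t" "\<forall>x\<in>\<Omega>. u x < t \<longrightarrow> k x = 0" "c < t'" "\<forall>x\<in>\<Omega>. u x < t' \<longrightarrow> k' x = 0"
  then show "\<exists>t>c. \<forall>x\<in>\<Omega>. u x < t \<longrightarrow> k x + k' x = 0" by (intro exI[of _ "min t t'"]) auto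
qed

lemma adm_cmul: "adm k \<Longrightarrow> adm (\<lambda>x. r * (k x :: real))"
  unfolding adm_def by (auto intro!: continuous_intros)

lemma E_nonneg: "adm k \<Longrightarrow> (\<And>x. x \<in> \<Omega> \<Longrightarrow> 0 \<le> k x) \<Longrightarrow> 0 \<le> E k"
  unfolding E_def by (intro integral_nonneg adm_int) auto

lemma E_pos:
  assumes "adm k" "\<And>x. x \<in> \<Omega> \<Longrightarrow> 0 \<le> k x" "x \<in> \<Omega>" "0 < k x"
  shows "0 < E k"
proof -
  let ?e = "\<lambda>x. if x \<in> \<Omega> then k x else 0"
  let ?C = "cbox (x - One) (x + One)"
  have ce: "continuous_on ?C ?e" by (rule continuous_on_subset[OF adm_cont[OF assms(1)]]) simp
  have box: "x \<in> box (x - One) (x + One)" "x \<in> ?C" by (simp_all add: mem_box inner_simps)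
  have "integral ?C ?e = 0 \<longleftrightarrow> (\<forall>y\<in>?C. ?e y = 0)"
    by (rule integral_cbox_eq_0_iff[OF ce]) (use box(1) assms(2) in auto)
  moreover have "?e x \<noteq> 0" using assms(3,4) by simp
  ultimately have "integral ?C ?e \<noteq> 0" using box(2) by blast
  moreover have "0 \<le> integral ?C ?e"
    using assms(2) by (intro integral_nonneg integrable_continuous ce) auto
  moreover have "integral ?C ?e \<le> E k"
    unfolding E_def using assms(2) by (intro integral_subset_le integrable_continuous ce adm_int assms(1)) auto
  ultimately show ?thesis by simp
qed

text \<open>The Sobolev inequality for \<open>\<phi>(u)\<close>, combined with the equation tested against \<open>\<phi>(u)\<close>.\<close>

lemma level_step:
  assumes d\<phi>: "\<And>s. (\<phi> has_real_derivative \<phi>' s) (at s)" and c\<phi>: "continuous_on UNIV \<phi>'"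
    and nn: "\<And>s. 0 \<le> \<phi> s" "\<And>s. 0 \<le> \<phi>' s" and z: "\<And>s. s \<le> t \<Longrightarrow> \<phi> s = 0 \<and> \<phi>' s = 0" and t: "c < t"
  shows "4 * pi * E (\<lambda>x. (\<phi> (u x))\<^sup>2)
    \<le> (- \<alpha> / t) * E (\<lambda>x. \<phi> (u x)) * E (\<lambda>x. \<phi>' (u x) * slope (G x))"
proof -
  have c\<phi>0: "continuous_on UNIV \<phi>" using d\<phi> by (meson DERIV_isCont continuous_at_imp_continuous_on)
  have cc[continuous_intros]: "continuous_on \<Omega> (\<lambda>x. \<phi> (u x))" "continuous_on \<Omega> (\<lambda>x. \<phi>' (u x))"
    using continuous_on_compose2[OF c\<phi>0 cu] continuous_on_compose2[OF c\<phi> cu] by auto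
  note [continuous_intros] = cu cG cG' cslope
  have u0: "0 < u x" if "x \<in> \<Omega>" for x using gt[OF that] c0 by simp
  let ?K = "{x \<in> \<Omega>. t \<le> u x}"
  note K = op cpt[OF t]
  obtain R where R: "0 < R" "\<And>x. x \<in> \<Omega> \<Longrightarrow> t \<le> u x \<Longrightarrow> norm x < R" using radius[OF t] by metis
  have zR: "\<phi> (u x) = 0 \<and> \<phi>' (u x) = 0" if "x \<in> \<Omega>" "R \<le> norm x" for x
    using z R(2)[OF that(1)] that(2) by fastforce
  have d\<phi>u: "((\<lambda>x. \<phi> (u x)) has_derivative (\<lambda>v. (\<phi>' (u x) *\<^sub>R G x) \<bullet> v)) (at x)" if "x \<in> \<Omega>" for x
    using has_derivative_compose[OF du[OF that] d\<phi>[unfolded has_field_derivative_def]] by simp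
  have adm1: "adm (\<lambda>x. \<phi>' (u x) * norm (G x))" "adm (\<lambda>x. \<phi>' (u x) * (G x \<bullet> G x) / slope (G x))"
    "adm (\<lambda>x. \<phi>' (u x) * slope (G x))" "adm (\<lambda>x. \<phi> (u x) / u x / slope (G x))" "adm (\<lambda>x. \<phi> (u x))"
    unfolding adm_def using t z slope_pos u0
    by (auto intro!: continuous_intros exI[of _ t] simp: slope_nz less_imp_neq[OF u0, symmetric])
  \<comment> \<open>If \<phi> approaches a jump, \<open>S\<close> becomes the length of the level
    line, \<open>P\<close> the flux of the unit gradient \<open>G / slope G\<close> through it, and
    \<open>Q\<close> the rate at which the area above the level decreases.\<close>
  define S where "S = E (\<lambda>x. \<phi>' (u x) * norm (G x))"
  define P where "P = E (\<lambda>x. \<phi>' (u x) * (G x \<bullet> G x) / slope (G x))"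
  define Q where "Q = E (\<lambda>x. \<phi>' (u x) * slope (G x))"
  have sob: "4 * pi * E (\<lambda>x. (\<phi> (u x))\<^sup>2) \<le> S\<^sup>2"
  proof -
    have "4 * pi * integral UNIV (\<lambda>x. (if x \<in> \<Omega> then \<phi> (u x) else 0)\<^sup>2)
      \<le> (integral UNIV (\<lambda>x. norm (if x \<in> \<Omega> then \<phi>' (u x) *\<^sub>R G x else 0)))\<^sup>2"
    proof (rule sobolev_plane[OF _ _ _ _ R(1)])
      show "((\<lambda>x. if x \<in> \<Omega> then \<phi> (u x) else 0) has_derivative
          (\<lambda>v. (if x \<in> \<Omega> then \<phi>' (u x) *\<^sub>R G x else 0) \<bullet> v)) (at x)" for x
      proof -
        have "((\<lambda>x. if x \<in> \<Omega> then \<phi> (u x) else 0) has_derivative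
            (if x \<in> \<Omega> then (\<lambda>v. (\<phi>' (u x) *\<^sub>R G x) \<bullet> v) else (\<lambda>v. 0))) (at x)"
          by (rule has_derivative_ext0[OF K _ _ d\<phi>u]) (use z in auto)
        then show ?thesis by (cases "x \<in> \<Omega>") (simp_all del: inner_scaleR_left)
      qed
      show "continuous_on UNIV (\<lambda>x. if x \<in> \<Omega> then \<phi>' (u x) *\<^sub>R G x else 0)"
        using z by (intro continuous_on_ext0[OF K]) (auto intro!: continuous_intros)
    qed (use nn zR in auto)
    also have "(\<lambda>x. norm (if x \<in> \<Omega> then \<phi>' (u x) *\<^sub>R G x else 0)) =
        (\<lambda>x. if x \<in> \<Omega> then \<phi>' (u x) * norm (G x) else 0)" using nn by auto
    finally show ?thesis unfolding E_def S_def by (simp add: if_distrib[of "\<lambda>x. x ^ 2"] cong: if_cong)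
  qed
  \<comment> \<open>Cauchy-Schwarz with weight \<open>\<phi>' (u x)\<close> for the splitting of
    \<open>norm G\<close> into \<open>norm G / sqrt (slope G)\<close> and
    \<open>sqrt (slope G)\<close>.\<close>
  have cs: "S\<^sup>2 \<le> P * Q"
  proof (rule discriminant_le)
    show "0 \<le> P" unfolding P_def
      using nn slope_pos by (intro E_nonneg adm1) (simp add: less_imp_le)
    fix s :: real
    have "0 \<le> E (\<lambda>x. s\<^sup>2 * (\<phi>' (u x) * (G x \<bullet> G x) / slope (G x)) + (2 * s * (\<phi>' (u x) * norm (G x))
        + \<phi>' (u x) * slope (G x)))"
    proof (rule E_nonneg)
      fix x
      have "s\<^sup>2 * (\<phi>' (u x) * (G x \<bullet> G x) / slope (G x)) + (2 * s * (\<phi>' (u x) * norm (G x))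
        + \<phi>' (u x) * slope (G x)) = \<phi>' (u x) * (s * norm (G x) + slope (G x))\<^sup>2 / slope (G x)"
        using slope_pos[of "G x"] by (simp add: power2_eq_square field_simps power2_norm_eq_inner[unfolded power2_eq_square, symmetric])
      then show "0 \<le> s\<^sup>2 * (\<phi>' (u x) * (G x \<bullet> G x) / slope (G x)) + (2 * s * (\<phi>' (u x) * norm (G x))
        + \<phi>' (u x) * slope (G x))" using nn slope_pos[of "G x"] by simp
    qed (intro adm_add adm_cmul adm1)
    also have "\<dots> = s\<^sup>2 * P + 2 * s * S + Q"
    proof -
      have "E (\<lambda>x. s\<^sup>2 * (\<phi>' (u x) * (G x \<bullet> G x) / slope (G x)) + (2 * s * (\<phi>' (u x) * norm (G x))
          + \<phi>' (u x) * slope (G x))) = E (\<lambda>x. s\<^sup>2 * (\<phi>' (u x) * (G x \<bullet> G x) / slope (G x)))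
          + E (\<lambda>x. 2 * s * (\<phi>' (u x) * norm (G x)) + \<phi>' (u x) * slope (G x))"
        by (intro E_add adm_add adm_cmul adm1)
      also have "E (\<lambda>x. 2 * s * (\<phi>' (u x) * norm (G x)) + \<phi>' (u x) * slope (G x))
          = E (\<lambda>x. 2 * s * (\<phi>' (u x) * norm (G x))) + Q"
        unfolding Q_def by (intro E_add adm_cmul adm1)
      finally show ?thesis unfolding E_cmul P_def S_def by simp
    qed
    finally show "0 \<le> s\<^sup>2 * P + 2 * s * S + Q" .
  qed
  \<comment> \<open>The field \<open>\<phi>(u) G / slope G\<close> has compact support, so its
    divergence has integral 0. Differentiating the factor \<open>\<phi>(u)\<close> gives
    \<open>P\<close>; the divergence of the unit gradient is known from the equation.\<close>
  have PE: "P + \<alpha> * E (\<lambda>x. \<phi> (u x) / u x / slope (G x)) = 0"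
  proof -
    define k where "k x = \<phi> (u x) *\<^sub>R (1 / slope (G x)) *\<^sub>R G x" for x
    define D where "D x v = (1 / slope (G x)) *\<^sub>R G' x v - ((G x \<bullet> G' x v) / (slope (G x)) ^ 3) *\<^sub>R G x" for x v
    define k' where "k' x v = \<phi> (u x) *\<^sub>R D x v + ((\<phi>' (u x) *\<^sub>R G x) \<bullet> v) *\<^sub>R ((1 / slope (G x)) *\<^sub>R G x)" for x v
    have dk: "(k has_derivative k' x) (at x)" if "x \<in> \<Omega>" for x
      unfolding k_def k'_def D_def
      by (rule has_derivative_scaleR[OF d\<phi>u[OF that] has_derivative_unit_gradient[OF dG[OF that]]])
    let ?Y' = "\<lambda>x. if x \<in> \<Omega> then k' x else (\<lambda>v. 0)"
    have "integral UNIV (\<lambda>x. ?Y' x (axis 1 1) $ 1 + ?Y' x (axis 2 1) $ 2) = 0"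
    proof (rule divergence_plane[OF _ _ _ R(1)])
      show "((\<lambda>x. if x \<in> \<Omega> then k x else 0) has_derivative ?Y' x) (at x)" for x
        using z by (intro has_derivative_ext0[OF K _ _ dk]) (auto simp: k_def)
      show "continuous_on UNIV (\<lambda>x. ?Y' x v)" for v
      proof -
        have "continuous_on UNIV (\<lambda>x. if x \<in> \<Omega> then k' x v else 0)"
        proof (rule continuous_on_ext0[OF K])
          have "continuous_on \<Omega> (\<lambda>x. D x v)"
            unfolding D_def by (intro continuous_intros) (simp_all add: slope_nz)
          then show "continuous_on \<Omega> (\<lambda>x. k' x v)"
            unfolding k'_def by (intro continuous_intros) (simp_all add: slope_nz)
        qed (use z in \<open>auto simp: k'_def\<close>)
        then show ?thesis by (simp add: if_distrib[of "\<lambda>k. k v"] cong: if_cong)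
      qed
    qed (use zR in \<open>auto simp: k_def k'_def\<close>)
    also have "(\<lambda>x. ?Y' x (axis 1 1) $ 1 + ?Y' x (axis 2 1) $ 2) =
       (\<lambda>x. if x \<in> \<Omega> then \<phi>' (u x) * (G x \<bullet> G x) / slope (G x) + \<alpha> * (\<phi> (u x) / u x / slope (G x)) else 0)"
    proof (rule ext)
      fix x
      show "?Y' x (axis 1 1) $ 1 + ?Y' x (axis 2 1) $ 2 =
        (if x \<in> \<Omega> then \<phi>' (u x) * (G x \<bullet> G x) / slope (G x) + \<alpha> * (\<phi> (u x) / u x / slope (G x)) else 0)"
      proof (cases "x \<in> \<Omega>")
        case x: True
        have "D x (axis 1 1) $ 1 + D x (axis 2 1) $ 2 = mc_op (G' x) (G x) / (slope (G x)) ^ 3"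
          unfolding D_def by (rule div_unit_gradient[OF has_derivative_linear[OF dG[OF x]]])
        also have "\<dots> = \<alpha> / (u x * slope (G x))"
          unfolding eqn[OF x] using slope_pos[of "G x"] u0[OF x] by (simp add: field_simps power2_eq_square power3_eq_cube)
        finally have "\<phi> (u x) * (D x (axis 1 1) $ 1 + D x (axis 2 1) $ 2) = \<alpha> * (\<phi> (u x) / u x / slope (G x))"
          by simp
        moreover have "(axis 1 1 :: real^2) $ 2 = 0" "(axis 2 1 :: real^2) $ 1 = 0"
          by (simp_all add: axis_def)
        ultimately show ?thesis using x
          by (simp add: k'_def algebra_simps inner_vec2 add_divide_distrib)
      qed auto
    qed
    finally have *: "E (\<lambda>x. \<phi>' (u x) * (G x \<bullet> G x) / slope (G x) + \<alpha> * (\<phi> (u x) / u x / slope (G x))) = 0"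
      by (simp only: E_def)
    then show ?thesis unfolding P_def E_cmul[symmetric] by (subst E_add[symmetric]) (intro adm1 adm_cmul)+
  qed
  \<comment> \<open>On the support of \<open>\<phi>(u)\<close> the height is at least
    \<open>t\<close>, and \<open>slope\<close> is at least 1. That \<open>- \<alpha>\<close> is
    positive preserves the direction of the estimate.\<close>
  have "P \<le> (- \<alpha> / t) * E (\<lambda>x. \<phi> (u x))"
  proof -
    have "E (\<lambda>x. \<phi> (u x) / u x / slope (G x)) \<le> E (\<lambda>x. (1 / t) * \<phi> (u x))"
    proof (intro E_mono adm_cmul adm1)
      fix x assume x: "x \<in> \<Omega>"
      show "\<phi> (u x) / u x / slope (G x) \<le> (1 / t) * \<phi> (u x)"
      proof (cases "t \<le> u x")
        case True
        have "t * 1 \<le> u x * slope (G x)"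
          using True t c0 slope_ge_1 by (intro mult_mono) auto
        then have "\<phi> (u x) / (u x * slope (G x)) \<le> \<phi> (u x) / t"
          using t c0 nn by (intro divide_left_mono mult_pos_pos u0[OF x] slope_pos) auto
        then show ?thesis by simp
      qed (use z in auto)
    qed
    then have "- \<alpha> * E (\<lambda>x. \<phi> (u x) / u x / slope (G x)) \<le> - \<alpha> * ((1 / t) * E (\<lambda>x. \<phi> (u x)))"
      unfolding E_cmul using \<alpha> by (intro mult_left_mono) auto
    then show ?thesis using PE by simp
  qed
  moreover have "0 \<le> Q" unfolding Q_def using nn slope_pos by (intro E_nonneg adm1) (simp add: less_imp_le)
  ultimately have "P * Q \<le> (- \<alpha> / t) * E (\<lambda>x. \<phi> (u x)) * Q" by (rule mult_right_mono)
  then show ?thesis using sob cs by (simp add: Q_def)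
qed

lemma adm_comp:
  assumes "continuous_on UNIV \<phi>" "c < t" "\<And>s. s \<le> t \<Longrightarrow> \<phi> s = 0"
  shows "adm (\<lambda>x. \<phi> (u x))"
  unfolding adm_def using continuous_on_compose2[OF assms(1) cu] assms(2,3)
  by (auto intro!: exI[of _ t])

lemma E_sum:
  assumes "finite I" "\<And>i. i \<in> I \<Longrightarrow> adm (k i)"
  shows "E (\<lambda>x. \<Sum>i\<in>I. k i x) = (\<Sum>i\<in>I. E (k i)) \<and> adm (\<lambda>x. \<Sum>i\<in>I. k i x)"
  using assms
proof (induction I rule: finite_induct)
  case empty
  have "adm (\<lambda>x. 0 :: real)" unfolding adm_def by (auto intro!: exI[of _ "c + 1"])
  then show ?case by (simp add: E_def)
qed (simp add: E_add adm_add)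

end

text \<open>A \<open>C\<^sup>1\<close> step function rising from 0 to 1 on \<open>[\<tau> - \<epsilon>, \<tau> + \<epsilon>]\<close>; its derivative is a hat function, so
  that the derivatives of consecutive steps form a partition of unity.\<close>

definition hat :: "real \<Rightarrow> real \<Rightarrow> real \<Rightarrow> real" where
  "hat \<tau> \<epsilon> s = (max 0 (s - (\<tau> - \<epsilon>)) - 2 * max 0 (s - \<tau>) + max 0 (s - (\<tau> + \<epsilon>))) / \<epsilon>\<^sup>2"

definition ramp :: "real \<Rightarrow> real \<Rightarrow> real \<Rightarrow> real" where
  "ramp \<tau> \<epsilon> s =
    ((max 0 (s - (\<tau> - \<epsilon>)))\<^sup>2 - 2 * (max 0 (s - \<tau>))\<^sup>2 + (max 0 (s - (\<tau> + \<epsilon>)))\<^sup>2) / (2 * \<epsilon>\<^sup>2)"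

lemma has_derivative_max0_sq:
  "((\<lambda>s :: real. (max 0 (s - r))\<^sup>2) has_real_derivative 2 * max 0 (s - r)) (at s)"
proof -
  have "((\<lambda>s :: real. s * max 0 s) has_real_derivative 2 * max 0 s) (at s)" for s
  proof (cases s "0 :: real" rule: linorder_cases)
    case less
    have "((\<lambda>s :: real. 0) has_real_derivative 0) (at s)" by simp
    then have "((\<lambda>s :: real. s * max 0 s) has_real_derivative 0) (at s)"
      by (rule has_field_derivative_transform_within_open[where S = "{..<0}"]) (use less in auto)
    then show ?thesis using less by simp
  next
    case equal
    have "((\<lambda>h :: real. max 0 h) \<longlongrightarrow> 0) (at 0)" by (rule tendsto_eq_intros) (auto intro!: tendsto_eq_intros)
    then have "((\<lambda>h :: real. (0 + h) * max 0 (0 + h) / h) \<longlongrightarrow> 0) (at 0)"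
      by (rule Lim_transform_eventually) (auto simp: eventually_at intro!: exI[of _ 1])
    then show ?thesis using equal by (simp add: DERIV_def)
  next
    case greater
    have "((\<lambda>s :: real. s * s) has_real_derivative 2 * s) (at s)"
      by (auto intro!: derivative_eq_intros)
    then have "((\<lambda>s :: real. s * max 0 s) has_real_derivative 2 * s) (at s)"
      by (rule has_field_derivative_transform_within_open[where S = "{0<..}"]) (use greater in auto)
    then show ?thesis using greater by simp
  qed
  moreover have "((\<lambda>s. s - r) has_real_derivative 1) (at s)"
    by (auto intro!: derivative_eq_intros)
  ultimately have "((\<lambda>s. (s - r) * max 0 (s - r)) has_real_derivative 2 * max 0 (s - r) * 1) (at s)"
    by (rule DERIV_chain2)
  moreover have "(\<lambda>s. (s - r) * max 0 (s - r)) = (\<lambda>s. (max 0 (s - r))\<^sup>2)"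
    by (auto simp: max_def power2_eq_square)
  ultimately show ?thesis by (metis mult.right_neutral)
qed

lemma
  assumes "0 < \<epsilon>"
  shows DERIV_ramp: "(ramp \<tau> \<epsilon> has_real_derivative hat \<tau> \<epsilon> s) (at s)"
    and continuous_on_hat: "continuous_on A (hat \<tau> \<epsilon>)"
    and continuous_on_ramp: "continuous_on A (ramp \<tau> \<epsilon>)"
    and hat_nonneg: "0 \<le> hat \<tau> \<epsilon> s"
    and hat_zero: "s \<le> \<tau> - \<epsilon> \<Longrightarrow> hat \<tau> \<epsilon> s = 0"
    and ramp_zero: "s \<le> \<tau> - \<epsilon> \<Longrightarrow> ramp \<tau> \<epsilon> s = 0"
    and ramp_one: "\<tau> + \<epsilon> \<le> s \<Longrightarrow> ramp \<tau> \<epsilon> s = 1"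
    and ramp_nonneg: "0 \<le> ramp \<tau> \<epsilon> s"
    and ramp_le_1: "ramp \<tau> \<epsilon> s \<le> 1"
proof -
  show dr: "(ramp \<tau> \<epsilon> has_real_derivative hat \<tau> \<epsilon> s) (at s)" for s
  proof -
    have "(ramp \<tau> \<epsilon> has_real_derivative (2 * max 0 (s - (\<tau> - \<epsilon>)) - 2 * (2 * max 0 (s - \<tau>))
        + 2 * max 0 (s - (\<tau> + \<epsilon>))) / (2 * \<epsilon>\<^sup>2)) (at s)"
      unfolding ramp_def
      by (intro DERIV_cdivide DERIV_add DERIV_diff DERIV_cmult has_derivative_max0_sq)
    moreover have "(2 * X - 2 * (2 * Y) + 2 * Z) / (2 * \<epsilon>\<^sup>2) = (X - 2 * Y + Z) / \<epsilon>\<^sup>2" for X Y Z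
      using assms by (simp add: field_simps)
    ultimately show ?thesis unfolding hat_def by metis
  qed
  show "continuous_on A (hat \<tau> \<epsilon>)" "continuous_on A (ramp \<tau> \<epsilon>)"
    unfolding ramp_def hat_def using assms by (auto intro!: continuous_intros)
  show hn: "0 \<le> hat \<tau> \<epsilon> s" for s
    unfolding hat_def using assms by (intro divide_nonneg_nonneg) (auto simp: max_def)
  show "s \<le> \<tau> - \<epsilon> \<Longrightarrow> hat \<tau> \<epsilon> s = 0" using assms by (simp add: hat_def max_def)
  show z: "s \<le> \<tau> - \<epsilon> \<Longrightarrow> ramp \<tau> \<epsilon> s = 0" for s using assms by (simp add: ramp_def max_def)
  show o: "\<tau> + \<epsilon> \<le> s \<Longrightarrow> ramp \<tau> \<epsilon> s = 1" for s
    using assms by (simp add: ramp_def max_def field_simps power2_eq_square)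
  have m: "s \<le> s' \<Longrightarrow> ramp \<tau> \<epsilon> s \<le> ramp \<tau> \<epsilon> s'" for s s'
    by (rule DERIV_nonneg_imp_nondecreasing[of s s']) (use dr hn in blast)+
  show "0 \<le> ramp \<tau> \<epsilon> s" using z m[of "min s (\<tau> - \<epsilon>)" s] by (simp add: z)
  show "ramp \<tau> \<epsilon> s \<le> 1" using m[of s "max s (\<tau> + \<epsilon>)"] by (simp add: o)
qed

text \<open>Each \<open>\<epsilon> * hat\<close> is a second difference in \<open>k\<close> of the
  functions \<open>?p k\<close>, divided by \<epsilon>. The sum telescopes to two first differences,
  of which one is at most \<epsilon> and the subtracted one nonnegative. Used as weights,
  consecutive hats therefore count no part of the surface more than once.\<close>

lemma sum_hat_le:
  assumes "0 < \<epsilon>"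
  shows "(\<Sum>k=1..N. \<epsilon> * hat (t + real k * \<epsilon>) \<epsilon> s) \<le> 1"
proof -
  let ?p = "\<lambda>k. max 0 (s - (t + real k * \<epsilon>))"
  have "(\<Sum>k=1..N. \<epsilon> * hat (t + real k * \<epsilon>) \<epsilon> s) = ((?p 0 - ?p 1) - (?p N - ?p (N + 1))) / \<epsilon>"
  proof (induction N)
    case (Suc N)
    have "\<epsilon> * hat (t + real (Suc N) * \<epsilon>) \<epsilon> s = (?p N - 2 * ?p (N + 1) + ?p (N + 2)) / \<epsilon>"
    proof -
      have e: "\<epsilon> * (X / \<epsilon>\<^sup>2) = X / \<epsilon>" for X using assms by (simp add: power2_eq_square)
      show ?thesis unfolding hat_def e by (simp add: algebra_simps)
    qed
    then show ?case using Suc by (simp add: diff_divide_distrib add_divide_distrib)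
  qed simp
  also have "\<dots> \<le> \<epsilon> / \<epsilon>"
  proof (rule divide_right_mono)
    have "?p (N + 1) \<le> ?p N" "?p 0 - ?p 1 \<le> \<epsilon>" using assms by (auto simp: max_def algebra_simps)
    then show "(?p 0 - ?p 1) - (?p N - ?p (N + 1)) \<le> \<epsilon>" by simp
  qed (use assms in simp)
  finally show ?thesis using assms by simp
qed

section \<open>Summation of the estimates over thin height intervals\<close>

context singular_height
begin

text \<open>The hypothesis \<open>bound\<close> is all that is known here about the area:
  \<open>A\<close> dominates every weighted area with a weight of values in \<open>[0, 1]\<close>
  that vanishes up to \<open>t0\<close>. The sum of the scaled hats is such a weight, and the sum of
  the level estimates is a Riemann sum of \<open>4 * pi * \<tau>\<close> over \<open>[t0, T]\<close>
  up to an error of order \<epsilon>.\<close>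

lemma height_bound:
  assumes t: "c < t0" "t0 < T" "T < u x0" and x0: "x0 \<in> \<Omega>"
    and bound: "\<And>\<psi>. continuous_on UNIV \<psi> \<Longrightarrow> (\<And>s. 0 \<le> \<psi> s \<and> \<psi> s \<le> 1) \<Longrightarrow> (\<And>s. s \<le> t0 \<Longrightarrow> \<psi> s = 0)
        \<Longrightarrow> E (\<lambda>x. \<psi> (u x) * slope (G x)) \<le> A"
  shows "2 * pi * (T\<^sup>2 - t0\<^sup>2) \<le> - \<alpha> * A"
proof -
  \<comment> \<open>Room above \<open>T\<close> for the last steps, which overshoot it by up to
    \<open>3 * \<epsilon>\<close>; \<open>T' < u x0\<close> keeps \<open>b\<close> positive.\<close>
  define T' where "T' = (T + u x0) / 2"
  have T': "T < T'" "T' < u x0" using t by (auto simp: T'_def)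
  define l where "l = (c + t0) / 2"
  have l: "c < l" "l < t0" using t by (auto simp: l_def)
  define \<psi>0 where "\<psi>0 = ramp ((l + t0) / 2) ((t0 - l) / 2)"
  define \<psi>1 where "\<psi>1 = ramp ((T' + u x0) / 2) ((u x0 - T') / 2)"
  have e0: "0 < (t0 - l) / 2" and e1: "0 < (u x0 - T') / 2" using l T' by auto
  have \<psi>0: "continuous_on UNIV \<psi>0" "\<And>s. s \<le> l \<Longrightarrow> \<psi>0 s = 0" "\<And>s. t0 \<le> s \<Longrightarrow> \<psi>0 s = 1" "\<And>s. 0 \<le> \<psi>0 s"
    unfolding \<psi>0_def
    by (auto intro!: continuous_on_ramp ramp_zero ramp_one ramp_nonneg e0) (auto simp: field_simps)
  have \<psi>1: "continuous_on UNIV \<psi>1" "\<And>s. s \<le> T' \<Longrightarrow> \<psi>1 s = 0" "\<psi>1 (u x0) = 1" "\<And>s. 0 \<le> \<psi>1 s" "\<And>s. \<psi>1 s \<le> 1"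
    unfolding \<psi>1_def
    by (auto intro!: continuous_on_ramp ramp_zero ramp_one ramp_nonneg ramp_le_1 e1) (auto simp: field_simps)
  have a0: "adm (\<lambda>x. \<psi>0 (u x))" using \<psi>0 l by (intro adm_comp) auto
  have a1: "adm (\<lambda>x. \<psi>1 (u x))" using \<psi>1 T' t by (intro adm_comp[of _ T']) auto
  define B where "B = E (\<lambda>x. \<psi>0 (u x))"
  define b where "b = E (\<lambda>x. \<psi>1 (u x))"
  have b: "0 < b" unfolding b_def using \<psi>1 by (intro E_pos[OF a1 _ x0]) auto
  \<comment> \<open>\<open>B\<close> and \<open>b\<close> bound the masses \<open>m k\<close> that
    occur from above and below, independently of the number of steps. The factor 2 is there because
    the logarithms are compared two indices apart, so that two terms survive at each end of the
    telescoping sum.\<close>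
  define L where "L = 2 * (ln B - ln b)"
  have main: "4 * pi * ((T\<^sup>2 - t0\<^sup>2) / 2 - \<epsilon> * ((T - t0) / 2 + T * L)) \<le> - \<alpha> * A"
    if N: "1 \<le> N" and eN: "\<epsilon> = (T - t0) / real N" and small: "3 * \<epsilon> \<le> T' - T" for N \<epsilon>
  proof -
    have \<epsilon>: "0 < \<epsilon>" using t N by (simp add: eN)
    have NT: "real N * \<epsilon> = T - t0" using N by (simp add: eN)
    define \<tau> where "\<tau> k = t0 + real k * \<epsilon>" for k
    define \<phi> where "\<phi> k = ramp (\<tau> k) \<epsilon>" for k
    define m where "m k = E (\<lambda>x. \<phi> k (u x))" for k
    define r where "r k = E (\<lambda>x. hat (\<tau> k) \<epsilon> (u x) * slope (G x))" for k
    have \<tau>S: "\<tau> (Suc k) = \<tau> k + \<epsilon>" for k by (simp add: \<tau>_def algebra_simps)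
    have \<tau>0: "t0 \<le> \<tau> k" for k using \<epsilon> by (simp add: \<tau>_def)
    have \<tau>mono: "\<tau> j \<le> \<tau> k" if "j \<le> k" for j k using that \<epsilon> by (simp add: \<tau>_def mult_right_mono)
    have \<tau>N: "\<tau> N = T" using NT by (simp add: \<tau>_def)
    have \<phi>z: "\<phi> (Suc k) s = 0" "hat (\<tau> (Suc k)) \<epsilon> s = 0" if "s \<le> \<tau> k" for k s
      unfolding \<phi>_def using that \<epsilon> by (auto intro!: ramp_zero hat_zero simp: \<tau>S)
    have \<phi>o: "\<phi> k s = 1" if "\<tau> (Suc k) \<le> s" for k s
      unfolding \<phi>_def using that \<epsilon> by (auto intro!: ramp_one simp: \<tau>S)
    have \<phi>01: "0 \<le> \<phi> k s" "\<phi> k s \<le> 1" for k s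
      unfolding \<phi>_def using \<epsilon> ramp_nonneg ramp_le_1 by auto
    have c\<phi>: "continuous_on UNIV (\<phi> k)" for k unfolding \<phi>_def by (rule continuous_on_ramp[OF \<epsilon>])
    have am: "adm (\<lambda>x. \<phi> (Suc k) (u x))" "adm (\<lambda>x. (\<phi> (Suc k) (u x))\<^sup>2)" for k
      using t \<tau>0[of k] \<phi>z(1)
      by (auto intro!: adm_comp[where t = t0] adm_comp[where t = t0 and \<phi> = "\<lambda>s. (\<phi> (Suc k) s)\<^sup>2"] continuous_intros c\<phi>)
    have ar: "adm (\<lambda>x. \<epsilon> * (hat (\<tau> (Suc k)) \<epsilon> (u x) * slope (G x)))" for k
    proof -
      have "adm (\<lambda>x. hat (\<tau> (Suc k)) \<epsilon> (u x))"
        using t \<tau>0[of k] \<phi>z(2) by (intro adm_comp[where t = t0] continuous_on_hat \<epsilon>) auto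
      then have "adm (\<lambda>x. hat (\<tau> (Suc k)) \<epsilon> (u x) * slope (G x))"
        unfolding adm_def by (auto intro!: continuous_intros cslope)
      then show ?thesis by (rule adm_cmul)
    qed
    have m_le: "m (Suc k) \<le> B" for k
      unfolding m_def B_def
    proof (intro E_mono am a0)
      fix x show "\<phi> (Suc k) (u x) \<le> \<psi>0 (u x)"
        using \<phi>z(1)[of "u x" k] \<tau>0[of k] \<phi>01 \<psi>0 by (cases "u x \<le> t0") auto
    qed
    have m_ge: "b \<le> m (Suc k)" if "k \<le> N + 1" for k
      unfolding m_def b_def
    proof (intro E_mono am a1)
      fix x
      have "\<tau> (Suc (Suc k)) \<le> \<tau> (N + 3)" using that by (intro \<tau>mono) auto
      also have "\<dots> = T + 3 * \<epsilon>" using \<tau>N by (simp add: \<tau>_def algebra_simps)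
      finally have "\<tau> (Suc (Suc k)) \<le> T'" using small by simp
      then show "\<psi>1 (u x) \<le> \<phi> (Suc k) (u x)"
        using \<phi>o[of "Suc k" "u x"] \<phi>01 \<psi>1 by (cases "u x \<le> T'") auto
    qed
    have m_pos: "0 < m (Suc k)" if "k \<le> N + 1" for k using m_ge[OF that] b by simp
    \<comment> \<open>\<open>\<phi> (k + 3)\<close> starts to rise at \<open>\<tau> (k + 2)\<close>,
      where \<open>\<phi> (k + 1)\<close> has reached 1, and so lies below its square. The shift by
      two indices is the price of the square in the Sobolev inequality.\<close>
    have m_sq: "m (k + 3) \<le> E (\<lambda>x. (\<phi> (Suc k) (u x))\<^sup>2)" "E (\<lambda>x. (\<phi> (Suc k) (u x))\<^sup>2) \<le> m (Suc k)" for k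
    proof -
      show "m (k + 3) \<le> E (\<lambda>x. (\<phi> (Suc k) (u x))\<^sup>2)"
        unfolding m_def
      proof (rule E_mono)
        show "adm (\<lambda>x. \<phi> (k + 3) (u x))" using am(1)[of "k + 2"] by (simp add: numeral_3_eq_3)
        show "\<phi> (k + 3) (u x) \<le> (\<phi> (Suc k) (u x))\<^sup>2" for x
          using \<phi>z(1)[of "u x" "k + 2"] \<phi>o[of "Suc k" "u x"] \<phi>01
          by (cases "u x \<le> \<tau> (k + 2)") (auto simp: numeral_3_eq_3 numeral_2_eq_2)
      qed (rule am)
      show "E (\<lambda>x. (\<phi> (Suc k) (u x))\<^sup>2) \<le> m (Suc k)"
        unfolding m_def using \<phi>01 by (intro E_mono am) (simp add: power2_eq_square mult_left_le)
    qed
    have step: "4 * pi * (\<tau> k - T * (ln (m (k + 1)) - ln (m (k + 3)))) \<le> - \<alpha> * r (k + 1)" if k: "k < N" for k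
    proof -
      have mp: "0 < m (k + 1)" "0 < m (k + 3)" using m_pos[of k] m_pos[of "k + 2"] k by (auto simp: numeral_3_eq_3)
      have \<tau>p: "0 < \<tau> k" "\<tau> k \<le> T" using \<tau>0[of k] t c0 \<tau>mono[of k N] k \<tau>N by auto
      have "4 * pi * m (k + 3) \<le> 4 * pi * E (\<lambda>x. (\<phi> (Suc k) (u x))\<^sup>2)"
        using m_sq(1) by simp
      also have "\<dots> \<le> (- \<alpha> / \<tau> k) * m (k + 1) * r (k + 1)"
        unfolding m_def r_def using \<phi>01 \<epsilon> \<phi>z t \<tau>0[of k]
        by (simp only: Suc_eq_plus1[symmetric], intro level_step)
           (auto simp: \<phi>_def intro!: DERIV_ramp continuous_on_hat hat_nonneg)
      finally have "4 * pi * m (k + 3) * (\<tau> k / m (k + 1)) \<le> (- \<alpha> / \<tau> k) * m (k + 1) * r (k + 1) * (\<tau> k / m (k + 1))"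
        using mp \<tau>p by (intro mult_right_mono) auto
      moreover have "(- \<alpha> / \<tau> k) * m (k + 1) * r (k + 1) * (\<tau> k / m (k + 1)) = - \<alpha> * r (k + 1)"
        using mp \<tau>p by simp
      ultimately have 1: "4 * pi * (\<tau> k * (m (k + 3) / m (k + 1))) \<le> - \<alpha> * r (k + 1)"
        by (simp add: mult_ac)
      have "ln (m (k + 3) / m (k + 1)) \<le> m (k + 3) / m (k + 1) - 1"
        using mp by (intro ln_le_minus_one) auto
      then have "1 - (ln (m (k + 1)) - ln (m (k + 3))) \<le> m (k + 3) / m (k + 1)"
        using mp by (simp add: ln_div)
      then have "\<tau> k * (1 - (ln (m (k + 1)) - ln (m (k + 3)))) \<le> \<tau> k * (m (k + 3) / m (k + 1))"
        using \<tau>p by (intro mult_left_mono) auto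
      \<comment> \<open>The difference of logarithms is nonnegative, so its coefficient may be
        raised to \<open>T\<close>. It no longer depends on \<open>k\<close>, and the sum over
        \<open>k\<close> telescopes.\<close>
      moreover have "\<tau> k * (ln (m (k + 1)) - ln (m (k + 3))) \<le> T * (ln (m (k + 1)) - ln (m (k + 3)))"
        using \<tau>p mp m_sq[of k] by (intro mult_right_mono) auto
      ultimately have "\<tau> k - T * (ln (m (k + 1)) - ln (m (k + 3))) \<le> \<tau> k * (m (k + 3) / m (k + 1))"
        by (simp add: right_diff_distrib)
      then have "4 * pi * (\<tau> k - T * (ln (m (k + 1)) - ln (m (k + 3)))) \<le> 4 * pi * (\<tau> k * (m (k + 3) / m (k + 1)))"
        by (intro mult_left_mono) auto
      then show ?thesis using 1 by linarith
    qed
    have sum_ln: "(\<Sum>k<n. ln (m (k + 1)) - ln (m (k + 3))) = ln (m 1) + ln (m 2) - ln (m (n + 1)) - ln (m (n + 2))" for n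
      by (induction n) (simp_all add: numeral_3_eq_3 numeral_2_eq_2)
    have sum_\<tau>: "(\<Sum>k<n. \<epsilon> * \<tau> k) = real n * \<epsilon> * t0 + (real n * \<epsilon>)\<^sup>2 / 2 - \<epsilon> * (real n * \<epsilon>) / 2" for n
      by (induction n) (simp_all add: \<tau>_def power2_eq_square field_simps)
    have "ln (m 1) \<le> ln B" "ln (m 2) \<le> ln B" "ln b \<le> ln (m (N + 1))" "ln b \<le> ln (m (N + 2))"
      using m_le[of 0] m_le[of 1] m_ge[of N] m_ge[of "N + 1"] b m_pos[of 0] m_pos[of 1] N
      by (auto simp: numeral_2_eq_2)
    then have Lb: "(\<Sum>k<N. ln (m (k + 1)) - ln (m (k + 3))) \<le> L"
      unfolding sum_ln L_def by simp
    have "(T\<^sup>2 - t0\<^sup>2) / 2 - \<epsilon> * ((T - t0) / 2 + T * L)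
        = (\<Sum>k<N. \<epsilon> * \<tau> k) - \<epsilon> * T * L"
      unfolding sum_\<tau> NT by (simp add: power2_eq_square field_simps)
    also have "\<dots> \<le> (\<Sum>k<N. \<epsilon> * \<tau> k) - \<epsilon> * T * (\<Sum>k<N. ln (m (k + 1)) - ln (m (k + 3)))"
      using Lb \<epsilon> t c0 by (intro diff_left_mono mult_left_mono) auto
    also have "\<dots> = (\<Sum>k<N. \<epsilon> * (\<tau> k - T * (ln (m (k + 1)) - ln (m (k + 3)))))"
      by (simp add: sum_distrib_left sum_subtractf right_diff_distrib mult.assoc)
    finally have "4 * pi * ((T\<^sup>2 - t0\<^sup>2) / 2 - \<epsilon> * ((T - t0) / 2 + T * L))
        \<le> 4 * pi * (\<Sum>k<N. \<epsilon> * (\<tau> k - T * (ln (m (k + 1)) - ln (m (k + 3)))))"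
      by (intro mult_left_mono) auto
    also have "\<dots> = (\<Sum>k<N. \<epsilon> * (4 * pi * (\<tau> k - T * (ln (m (k + 1)) - ln (m (k + 3))))))"
      by (simp add: sum_distrib_left mult_ac)
    also have "\<dots> \<le> (\<Sum>k<N. \<epsilon> * (- \<alpha> * r (k + 1)))"
      using \<epsilon> step by (intro sum_mono mult_left_mono) auto
    also have "\<dots> = - \<alpha> * (\<Sum>k<N. \<epsilon> * r (k + 1))"
      by (simp add: sum_distrib_left mult_ac)
    also have "(\<Sum>k<N. \<epsilon> * r (k + 1)) = E (\<lambda>x. \<Sum>k<N. \<epsilon> * (hat (\<tau> (Suc k)) \<epsilon> (u x) * slope (G x)))"
      using E_sum[of "{..<N}" "\<lambda>k x. \<epsilon> * (hat (\<tau> (Suc k)) \<epsilon> (u x) * slope (G x))", OF _ ar]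
      by (simp add: E_cmul r_def)
    also have "\<dots> = E (\<lambda>x. (\<Sum>k=1..N. \<epsilon> * hat (\<tau> k) \<epsilon> (u x)) * slope (G x))"
      by (simp add: sum_distrib_right mult.assoc sum.atLeast1_atMost_eq)
    finally have *: "4 * pi * ((T\<^sup>2 - t0\<^sup>2) / 2 - \<epsilon> * ((T - t0) / 2 + T * L))
        \<le> - \<alpha> * E (\<lambda>x. (\<Sum>k=1..N. \<epsilon> * hat (\<tau> k) \<epsilon> (u x)) * slope (G x))" .
    have "E (\<lambda>x. (\<Sum>k=1..N. \<epsilon> * hat (\<tau> k) \<epsilon> (u x)) * slope (G x)) \<le> A"
    proof (rule bound)
      show "continuous_on UNIV (\<lambda>s. \<Sum>k=1..N. \<epsilon> * hat (\<tau> k) \<epsilon> s)"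
        by (intro continuous_intros continuous_on_hat \<epsilon>)
      show "0 \<le> (\<Sum>k=1..N. \<epsilon> * hat (\<tau> k) \<epsilon> s) \<and> (\<Sum>k=1..N. \<epsilon> * hat (\<tau> k) \<epsilon> s) \<le> 1" for s
        using sum_hat_le[OF \<epsilon>] hat_nonneg[OF \<epsilon>] \<epsilon> by (auto simp: \<tau>_def intro!: sum_nonneg mult_nonneg_nonneg)
      show "(\<Sum>k=1..N. \<epsilon> * hat (\<tau> k) \<epsilon> s) = 0" if "s \<le> t0" for s
      proof (rule sum.neutral, rule ballI)
        fix k assume "k \<in> {1..N}"
        then obtain j where "k = Suc j" by (cases k) auto
        then show "\<epsilon> * hat (\<tau> k) \<epsilon> s = 0" using \<phi>z(2)[of s j] \<tau>0[of j] that by simp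
      qed
    qed
    then have "- \<alpha> * E (\<lambda>x. (\<Sum>k=1..N. \<epsilon> * hat (\<tau> k) \<epsilon> (u x)) * slope (G x)) \<le> - \<alpha> * A"
      using \<alpha> by (intro mult_left_mono) auto
    with * show ?thesis by linarith
  qed
  have e: "(\<lambda>N. (T - t0) / real N) \<longlonglongrightarrow> 0" by (rule lim_const_over_n)
  have "(\<lambda>N. 4 * pi * ((T\<^sup>2 - t0\<^sup>2) / 2 - (T - t0) / real N * ((T - t0) / 2 + T * L)))
      \<longlonglongrightarrow> 4 * pi * ((T\<^sup>2 - t0\<^sup>2) / 2 - 0 * ((T - t0) / 2 + T * L))"
    by (intro tendsto_intros e)
  moreover have "\<forall>\<^sub>F N in sequentially. 4 * pi * ((T\<^sup>2 - t0\<^sup>2) / 2 - (T - t0) / real N * ((T - t0) / 2 + T * L)) \<le> - \<alpha> * A"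
  proof -
    have "\<forall>\<^sub>F N in sequentially. (T - t0) / real N < (T' - T) / 3"
      using T' by (intro order_tendstoD(2)[OF e]) auto
    then show ?thesis using eventually_ge_at_top[of 1]
    proof eventually_elim
      case (elim N)
      define q where "q = (T - t0) / real N"
      have "3 * q \<le> T' - T" using elim(1) unfolding q_def[symmetric] by (simp add: field_simps)
      then show ?case using main[OF elim(2) q_def] by (simp only: q_def)
    qed
  qed
  ultimately have "4 * pi * ((T\<^sup>2 - t0\<^sup>2) / 2 - 0 * ((T - t0) / 2 + T * L)) \<le> - \<alpha> * A"
    by (rule tendsto_upperbound) auto
  then show ?thesis by simp
qed

end

section \<open>Hopf's lemma for monotone graphs\<close>

text \<open>\<open>f'\<close> is differentiable at 0 only. If \<open>D\<close> were negative,
  \<open>f'\<close> would be negative just to the right of 0, and by the mean value theorem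
  \<open>f\<close> would fall below its minimum.\<close>

lemma second_order_min:
  fixes f f' :: "real \<Rightarrow> real"
  assumes "0 < \<delta>" "\<And>t. \<bar>t\<bar> < \<delta> \<Longrightarrow> (f has_real_derivative f' t) (at t)"
    and d2: "(f' has_real_derivative D) (at 0)"
    and min: "\<And>t. \<bar>t\<bar> < \<delta> \<Longrightarrow> f 0 \<le> f t"
  shows "f' 0 = 0" "0 \<le> D"
proof -
  show f'0: "f' 0 = 0"
    using DERIV_local_min[of f "f' 0" 0 \<delta>] assms by auto
  show "0 \<le> D"
  proof (rule ccontr)
    assume "\<not> 0 \<le> D"
    then obtain d where d: "0 < d" "\<And>h. 0 < h \<Longrightarrow> h < d \<Longrightarrow> f' h < 0"
      using DERIV_neg_dec_right[OF d2] f'0 by force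
    define t where "t = min d \<delta> / 2"
    have t: "0 < t" "t < d" "t < \<delta>" using d assms(1) by (auto simp: t_def min_def)
    obtain z where "0 < z" "z < t" "f t - f 0 = (t - 0) * f' z"
      using MVT2[of 0 t f f'] assms(2) t by force
    then have "f t < f 0" using d(2)[of z] t mult_pos_neg[of t "f' z"] by simp
    then show False using min[of t] t by simp
  qed
qed

lemma norm_rot: "norm (rot p) = norm p" and rot_diff: "rot (p - q) = rot p - rot q"
  by (auto simp: norm_vec2 rot_def vec_eq_iff forall_2 add.commute)

text \<open>The nonlinear terms of the equation are Lipschitz in the gradient on the ball of radius
  \<open>K\<close>. Subtracting the equations at two points then costs a multiple of
  \<open>norm (p' - p)\<close>, a first order term that the barrier absorbs.\<close>

lemma mc_op_diff_le:
  assumes B: "linear B" "\<And>v. norm (B v) \<le> K * norm v"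
    and p: "norm p \<le> K" "norm p' \<le> K" and K: "0 \<le> K"
  shows "\<bar>B (rot p') \<bullet> rot p' - B (rot p) \<bullet> rot p\<bar> \<le> 2 * K\<^sup>2 * norm (p' - p)"
    and "\<bar>p' $ 2 * (slope p')\<^sup>2 - p $ 2 * (slope p)\<^sup>2\<bar> \<le> (1 + 3 * K\<^sup>2) * norm (p' - p)"
proof -
  let ?d = "norm (p' - p)"
  have "B (rot p') \<bullet> rot p' - B (rot p) \<bullet> rot p = B (rot (p' - p)) \<bullet> rot p' + B (rot p) \<bullet> rot (p' - p)"
    unfolding rot_diff linear_diff[OF B(1)] by (simp add: inner_diff_left inner_diff_right)
  also have "\<bar>\<dots>\<bar> \<le> norm (B (rot (p' - p))) * norm (rot p') + norm (B (rot p)) * norm (rot (p' - p))"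
    by (intro order_trans[OF abs_triangle_ineq] add_mono Cauchy_Schwarz_ineq2)
  also have "\<dots> \<le> (K * ?d) * K + (K * K) * ?d"
    using p K B(2)[of "rot (p' - p)"] B(2)[of "rot p"]
    by (intro add_mono mult_mono) (auto simp: norm_rot intro: order_trans mult_left_mono)
  finally show "\<bar>B (rot p') \<bullet> rot p' - B (rot p) \<bullet> rot p\<bar> \<le> 2 * K\<^sup>2 * ?d"
    by (simp add: power2_eq_square mult_ac)
  have 1: "\<bar>(p' - p) $ 2\<bar> \<le> ?d" by (rule component_le_norm_cart)
  have 2: "\<bar>p $ 2\<bar> \<le> K" using component_le_norm_cart[of p 2] p by linarith
  have 3: "p' \<bullet> p' \<le> K\<^sup>2" using p by (metis power2_norm_eq_inner power_mono norm_ge_zero)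
  have "p' \<bullet> p' - p \<bullet> p = (p' - p) \<bullet> (p' + p)" by (simp add: inner_simps inner_commute)
  also have "\<bar>\<dots>\<bar> \<le> ?d * norm (p' + p)" by (rule Cauchy_Schwarz_ineq2)
  also have "\<dots> \<le> ?d * (K + K)" using norm_triangle_ineq[of p' p] p by (intro mult_left_mono) auto
  finally have 4: "\<bar>p' \<bullet> p' - p \<bullet> p\<bar> \<le> ?d * (K + K)" .
  have "p' $ 2 * (slope p')\<^sup>2 - p $ 2 * (slope p)\<^sup>2 =
      (p' - p) $ 2 * (1 + p' \<bullet> p') + p $ 2 * (p' \<bullet> p' - p \<bullet> p)"
    by (simp add: slope_sq algebra_simps)
  also have "\<bar>\<dots>\<bar> \<le> \<bar>(p' - p) $ 2\<bar> * (1 + p' \<bullet> p') + \<bar>p $ 2\<bar> * \<bar>p' \<bullet> p' - p \<bullet> p\<bar>"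
    by (intro order_trans[OF abs_triangle_ineq]) (simp add: abs_mult)
  also have "\<dots> \<le> ?d * (1 + K\<^sup>2) + K * (?d * (K + K))"
    using 1 2 3 4 K by (intro add_mono mult_mono) auto
  finally show "\<bar>p' $ 2 * (slope p')\<^sup>2 - p $ 2 * (slope p)\<^sup>2\<bar> \<le> (1 + 3 * K\<^sup>2) * ?d"
    by (simp add: power2_eq_square algebra_simps)
qed

text \<open>Up to a constant, the barrier in Hopf's lemma.\<close>

definition gauss :: "real \<Rightarrow> real^2 \<Rightarrow> real^2 \<Rightarrow> real" where
  "gauss l q x = exp (- l * ((x - q) \<bullet> (x - q)))"

lemma has_derivative_gauss:
  "(gauss l q has_derivative (\<lambda>h. (- 2 * l * gauss l q x) *\<^sub>R (x - q) \<bullet> h)) (at x)"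
  unfolding gauss_def
  by (auto intro!: derivative_eq_intros simp: inner_commute algebra_simps)

lemma has_derivative_grad_gauss:
  "((\<lambda>x. (- 2 * l * gauss l q x) *\<^sub>R (x - q)) has_derivative
     (\<lambda>h. (- 2 * l * gauss l q x) *\<^sub>R h + (4 * l\<^sup>2 * gauss l q x * ((x - q) \<bullet> h)) *\<^sub>R (x - q))) (at x)"
  by (auto intro!: derivative_eq_intros has_derivative_gauss[THEN has_derivative_eq_rhs]
      simp: power2_eq_square algebra_simps)

text \<open>\<open>H\<close> is the second derivative of the barrier, and \<open>C\<close> leaves room for first order terms.\<close>

lemma gauss_subsolution:
  assumes r: "r / 2 < norm (x - q)" "norm (x - q) \<le> r" "0 < r" and w: "norm w \<le> K"
    and l: "4 + 2 * K\<^sup>2 + 2 * C * r \<le> l * r\<^sup>2" and l0: "0 < l" and C: "0 \<le> C"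
  defines "H \<equiv> \<lambda>h. (- 2 * l * gauss l q x) *\<^sub>R h + (4 * l\<^sup>2 * gauss l q x * ((x - q) \<bullet> h)) *\<^sub>R (x - q)"
  shows "C * norm ((- 2 * l * gauss l q x) *\<^sub>R (x - q)) < H (axis 1 1) $ 1 + H (axis 2 1) $ 2 + H w \<bullet> w"
proof -
  define g where "g = gauss l q x"
  have g: "0 < g" by (simp add: g_def gauss_def)
  define n where "n = norm (x - q)"
  have nn: "(x - q) \<bullet> (x - q) = n\<^sup>2" by (simp add: n_def power2_norm_eq_inner)
  have tr: "H (axis 1 1) $ 1 + H (axis 2 1) $ 2 = - 4 * l * g + 4 * l\<^sup>2 * g * n\<^sup>2"
    unfolding H_def g_def nn[symmetric] by (simp add: inner_vec2 axis_def algebra_simps)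
  have "(r / 2)\<^sup>2 < n\<^sup>2" using r by (intro power_strict_mono) (auto simp: n_def)
  then have "4 * l\<^sup>2 * g * (r / 2)\<^sup>2 < 4 * l\<^sup>2 * g * n\<^sup>2"
    using g l0 by (intro mult_strict_left_mono) auto
  then have 1: "l\<^sup>2 * g * r\<^sup>2 < 4 * l\<^sup>2 * g * n\<^sup>2" by (simp add: power_divide)
  have "w \<bullet> w \<le> K\<^sup>2" using w by (metis power2_norm_eq_inner power_mono norm_ge_zero)
  then have "2 * l * g * (w \<bullet> w) \<le> 2 * l * g * K\<^sup>2" using g l0 by (intro mult_left_mono) auto
  moreover have "H w \<bullet> w = - (2 * l * g * (w \<bullet> w)) + 4 * l\<^sup>2 * g * ((x - q) \<bullet> w)\<^sup>2"
    unfolding H_def g_def by (simp add: inner_add_left inner_diff_left power2_eq_square algebra_simps)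
  moreover have "0 \<le> 4 * l\<^sup>2 * g * ((x - q) \<bullet> w)\<^sup>2" using g by simp
  ultimately have 2: "- (2 * l * g * K\<^sup>2) \<le> H w \<bullet> w" by linarith
  have "C * norm ((- 2 * l * gauss l q x) *\<^sub>R (x - q)) = C * (2 * l * g * n)"
    using g l0 by (simp add: g_def n_def abs_mult)
  also have "\<dots> \<le> C * (2 * l * g * r)"
    using C g l0 r by (intro mult_left_mono) (auto simp: n_def)
  finally have 3: "C * norm ((- 2 * l * gauss l q x) *\<^sub>R (x - q)) \<le> C * (2 * l * g * r)" .
  \<comment> \<open>The three summands pay for the negative part of the Laplacian, for the quadratic
    form at \<open>w\<close> and for the first order term. The right side is below
    \<open>4 * l\<^sup>2 * g * n\<^sup>2\<close>, the positive part of the Laplacian, since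
    \<open>x\<close> is away from the centre.\<close>
  have "(4 + 2 * K\<^sup>2 + 2 * C * r) * (l * g) \<le> (l * r\<^sup>2) * (l * g)"
    using l g l0 by (intro mult_right_mono) auto
  then have "4 * l * g + 2 * l * g * K\<^sup>2 + C * (2 * l * g * r) \<le> l\<^sup>2 * g * r\<^sup>2"
    by (simp add: power2_eq_square algebra_simps)
  then show ?thesis using tr 1 2 3 by linarith
qed

text \<open>The comparison step of Hopf's lemma. The increment \<open>g(x + s e) - g x\<close> takes the place of
  its infinitesimal version \<open>g\<^sub>z\<close>, so that the equation need not be differentiated.\<close>

lemma increment_no_touching:
  fixes g :: "real^2 \<Rightarrow> real" and G :: "real^2 \<Rightarrow> real^2"
  defines "e \<equiv> axis 2 1 :: real^2"
  assumes \<alpha>: "\<alpha> < 0" and s: "0 < s" and m: "0 < m"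
    and U: "open U" "x \<in> U"
    and dg: "\<And>y. y \<in> U \<Longrightarrow> (g has_derivative (\<lambda>v. G y \<bullet> v)) (at y)"
      "\<And>y. y \<in> U \<Longrightarrow> (g has_derivative (\<lambda>v. G (y + s *\<^sub>R e) \<bullet> v)) (at (y + s *\<^sub>R e))"
    and dG: "(G has_derivative B) (at x)" "(G has_derivative B') (at (x + s *\<^sub>R e))"
    and eqn: "mc_op B (G x) = - \<alpha> * G x $ 2 * (slope (G x))\<^sup>2 / x $ 2"
      "mc_op B' (G (x + s *\<^sub>R e)) = - \<alpha> * G (x + s *\<^sub>R e) $ 2 * (slope (G (x + s *\<^sub>R e)))\<^sup>2 / (x $ 2 + s)"
    and z: "0 < x $ 2" "1 / x $ 2 \<le> K" and nn: "0 \<le> G (x + s *\<^sub>R e) $ 2"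
    and bd: "norm (G x) \<le> K" "norm (G (x + s *\<^sub>R e)) \<le> K" "\<And>v. norm (B v) \<le> K * norm v"
    and ring: "r / 2 < norm (x - q)" "norm (x - q) \<le> r" "0 < r"
    and l: "4 + 2 * K\<^sup>2 + 2 * (- \<alpha> * K * (1 + 3 * K\<^sup>2) + 2 * K\<^sup>2) * r \<le> l * r\<^sup>2" "0 < l"
    and min: "\<And>y. y \<in> U \<Longrightarrow> g (x + s *\<^sub>R e) - g x - s * m * gauss l q x
        \<le> g (y + s *\<^sub>R e) - g y - s * m * gauss l q y"
  shows False
proof -
  \<comment> \<open>The first summand comes from the right-hand sides of the two equations, where
    \<open>1 / x $ 2 \<le> K\<close>, the second from the quadratic form at the two rotated
    gradients.\<close>
  define C where "C = - \<alpha> * K * (1 + 3 * K\<^sup>2) + 2 * K\<^sup>2"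
  have K: "0 < K" using z by (metis less_le_trans zero_less_divide_1_iff)
  have C: "0 \<le> C" unfolding C_def using \<alpha> K by (intro add_nonneg_nonneg mult_nonneg_nonneg) auto
  let ?n = "\<lambda>y. (- 2 * l * gauss l q y) *\<^sub>R (y - q)"
  define F where "F y = g (y + s *\<^sub>R e) - g y - s * m * gauss l q y" for y
  define P where "P y = G (y + s *\<^sub>R e) - G y - (s * m) *\<^sub>R ?n y" for y
  define Hv where "Hv h = (- 2 * l * gauss l q x) *\<^sub>R h + (4 * l\<^sup>2 * gauss l q x * ((x - q) \<bullet> h)) *\<^sub>R (x - q)" for h
  define H where "H h = B' h - B h - (s * m) *\<^sub>R Hv h" for h
  have shift: "((\<lambda>y. y + s *\<^sub>R e) has_derivative (\<lambda>h. h)) (at y)" for y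
    by (auto intro!: derivative_eq_intros)
  have dF: "(F has_derivative (\<lambda>h. P y \<bullet> h)) (at y)" if "y \<in> U" for y
  proof -
    have "(F has_derivative (\<lambda>h. G (y + s *\<^sub>R e) \<bullet> h - G y \<bullet> h - s * m * (?n y \<bullet> h))) (at y)"
      unfolding F_def
      by (intro has_derivative_diff has_derivative_mult_right has_derivative_gauss
          has_derivative_compose[OF shift dg(2)] dg that)
    moreover have "(\<lambda>h. G (y + s *\<^sub>R e) \<bullet> h - G y \<bullet> h - s * m * (?n y \<bullet> h)) = (\<lambda>h. P y \<bullet> h)"
      by (simp add: P_def inner_diff_left inner_add_left fun_eq_iff algebra_simps)
    ultimately show ?thesis by simp
  qed
  have dP: "(P has_derivative H) (at x)"
    unfolding P_def H_def Hv_def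
    by (intro has_derivative_diff has_derivative_scaleR_right has_derivative_grad_gauss
        has_derivative_compose[OF shift dG(2)] dG)
  obtain \<delta>0 where \<delta>0: "0 < \<delta>0" "ball x \<delta>0 \<subseteq> U" using U openE by blast
  \<comment> \<open>\<open>F\<close> has a minimum at \<open>x\<close>. The test along lines
    suffices, because \<open>mc_op\<close> involves pure second derivatives only.\<close>
  have line: "P x \<bullet> w = 0 \<and> 0 \<le> H w \<bullet> w" for w
  proof -
    define \<delta> where "\<delta> = \<delta>0 / (norm w + 1)"
    have nw: "0 < norm w + 1" by (simp add: add_nonneg_pos)
    have \<delta>: "0 < \<delta>" using \<delta>0 nw by (simp add: \<delta>_def)
    have inU: "x + t *\<^sub>R w \<in> U" if "\<bar>t\<bar> < \<delta>" for t
    proof -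
      have "\<bar>t\<bar> * norm w \<le> \<bar>t\<bar> * (norm w + 1)" by (intro mult_left_mono) auto
      also have "\<dots> < \<delta>0" using that nw by (simp add: \<delta>_def field_simps)
      finally show ?thesis using \<delta>0(2) by (auto simp: dist_norm)
    qed
    have dl: "((\<lambda>t. x + t *\<^sub>R w) has_derivative (\<lambda>h. h *\<^sub>R w)) (at t)" for t :: real
      by (auto intro!: derivative_eq_intros)
    have 1: "((\<lambda>t. F (x + t *\<^sub>R w)) has_real_derivative P (x + t *\<^sub>R w) \<bullet> w) (at t)" if "\<bar>t\<bar> < \<delta>" for t
      using has_derivative_compose[OF dl dF[OF inU[OF that]]]
      by (simp add: has_field_derivative_def mult_commute_abs)
    have 2: "((\<lambda>t. P (x + t *\<^sub>R w) \<bullet> w) has_real_derivative H w \<bullet> w) (at 0)"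
    proof -
      have "((\<lambda>t. P (x + t *\<^sub>R w)) has_derivative (\<lambda>h. H (h *\<^sub>R w))) (at 0)"
        using has_derivative_compose[OF dl[of 0], of P H] dP by simp
      then have "((\<lambda>t. P (x + t *\<^sub>R w) \<bullet> w) has_derivative (\<lambda>h. H (h *\<^sub>R w) \<bullet> w)) (at 0)"
        by (rule has_derivative_inner_left)
      then show ?thesis
        using has_derivative_linear[OF dP] by (simp add: has_field_derivative_def linear_cmul mult_commute_abs)
    qed
    have "P (x + 0 *\<^sub>R w) \<bullet> w = 0" "0 \<le> H w \<bullet> w"
      by (rule second_order_min[where f = "\<lambda>t. F (x + t *\<^sub>R w)" and f' = "\<lambda>t. P (x + t *\<^sub>R w) \<bullet> w" and \<delta> = \<delta>];
          use \<delta> 1 2 min inU in \<open>auto simp: F_def\<close>)+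
    then show ?thesis by simp
  qed
  define p where "p = G x"
  define p' where "p' = G (x + s *\<^sub>R e)"
  \<comment> \<open>The two gradients differ exactly by the gradient of the scaled barrier, so every
    error proportional to \<open>norm (p' - p)\<close> is a multiple of it.\<close>
  have "P x = 0" using line[of "P x"] by simp
  then have pp: "p' - p = (s * m) *\<^sub>R ?n x"
    unfolding P_def p_def p'_def by (simp only: right_minus_eq)
  \<comment> \<open>The direction \<open>rot p'\<close> fits the operator at the shifted point. At
    \<open>x\<close> the fitting direction is \<open>rot p\<close>, and the difference enters as a
    correction.\<close>
  have "0 \<le> H (axis 1 1) $ 1 + H (axis 2 1) $ 2 + H (rot p') \<bullet> rot p'"
    using line[of "axis 1 1"] line[of "axis 2 1"] line[of "rot p'"] by (simp add: inner_axis)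
  also have "\<dots> = mc_op B' p' - (mc_op B p + (B (rot p') \<bullet> rot p' - B (rot p) \<bullet> rot p))
      - s * m * (Hv (axis 1 1) $ 1 + Hv (axis 2 1) $ 2 + Hv (rot p') \<bullet> rot p')"
    by (simp add: H_def mc_op_def inner_diff_left algebra_simps)
  finally have ineq: "s * m * (Hv (axis 1 1) $ 1 + Hv (axis 2 1) $ 2 + Hv (rot p') \<bullet> rot p')
      \<le> mc_op B' p' - mc_op B p - (B (rot p') \<bullet> rot p' - B (rot p) \<bullet> rot p)" by simp
  have np: "norm p \<le> K" "norm p' \<le> K" using bd by (auto simp: p_def p'_def)
  \<comment> \<open>The sign of \<alpha> enters here: the numerator
    \<open>- \<alpha> * p' $ 2 * (slope p')\<^sup>2\<close> is nonnegative, so replacing the height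
    \<open>x $ 2 + s\<close> of the shifted point by \<open>x $ 2\<close> gives an upper
    bound.\<close>
  have "mc_op B' p' \<le> - \<alpha> * p' $ 2 * (slope p')\<^sup>2 / x $ 2"
    unfolding eqn(2)[folded p'_def] using z s \<alpha> nn
    by (intro divide_left_mono mult_nonneg_nonneg mult_pos_pos) (auto simp: p'_def)
  then have "mc_op B' p' - mc_op B p \<le> (- \<alpha> * (1 / x $ 2)) * (p' $ 2 * (slope p')\<^sup>2 - p $ 2 * (slope p)\<^sup>2)"
    unfolding eqn(1)[folded p_def] by (simp add: algebra_simps diff_divide_distrib)
  also have "\<dots> \<le> (- \<alpha> * (1 / x $ 2)) * ((1 + 3 * K\<^sup>2) * norm (p' - p))"
    using mc_op_diff_le(2)[OF has_derivative_linear[OF dG(1)] bd(3) np] \<alpha> z K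
    by (intro mult_left_mono) (auto simp: abs_le_iff divide_nonpos_pos)
  also have "\<dots> \<le> (- \<alpha> * K) * ((1 + 3 * K\<^sup>2) * norm (p' - p))"
    using \<alpha> z by (intro mult_right_mono mult_left_mono) auto
  finally have "mc_op B' p' - mc_op B p - (B (rot p') \<bullet> rot p' - B (rot p) \<bullet> rot p) \<le> C * norm (p' - p)"
    using mc_op_diff_le(1)[OF has_derivative_linear[OF dG(1)] bd(3) np] K
    by (simp add: C_def algebra_simps abs_le_iff)
  also have "\<dots> = s * m * (C * norm (?n x))" using s m by (simp add: pp abs_mult)
  also have "\<dots> < s * m * (Hv (axis 1 1) $ 1 + Hv (axis 2 1) $ 2 + Hv (rot p') \<bullet> rot p')"
    unfolding Hv_def using s m
    by (intro mult_strict_left_mono gauss_subsolution[OF ring _ _ l(2) C]) (use np l in \<open>auto simp: norm_rot C_def\<close>)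
  finally show False using ineq by simp
qed

lemma DERIV_neg_at_0:
  fixes f :: "real \<Rightarrow> real"
  assumes "(f has_real_derivative D) (at 0)" "D < 0"
  obtains d where "0 < d" "\<And>h. 0 < h \<Longrightarrow> h < d \<Longrightarrow> f h < f 0"
  using DERIV_neg_dec_right[OF assms] by auto

lemma has_real_derivative_along:
  fixes g :: "'a::real_inner \<Rightarrow> real"
  assumes "(g has_derivative (\<lambda>v. G \<bullet> v)) (at (x + t *\<^sub>R w))"
  shows "((\<lambda>t. g (x + t *\<^sub>R w)) has_real_derivative G \<bullet> w) (at t)"
proof -
  have "((\<lambda>t. x + t *\<^sub>R w) has_derivative (\<lambda>h. h *\<^sub>R w)) (at t)"
    by (auto intro!: derivative_eq_intros)
  from has_derivative_compose[OF this assms] show ?thesis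
    by (simp add: has_field_derivative_def mult_commute_abs)
qed

lemma uniform_linear_bound:
  fixes G' :: "real^2 \<Rightarrow> real^2 \<Rightarrow> real^2"
  assumes "compact C" "\<And>x. x \<in> C \<Longrightarrow> linear (G' x)" "\<And>v. continuous_on C (\<lambda>x. G' x v)"
  obtains K where "\<And>x v. x \<in> C \<Longrightarrow> norm (G' x v) \<le> K * norm v"
proof -
  have "bounded ((\<lambda>x. G' x v) ` C)" for v
    using assms by (intro compact_imp_bounded compact_continuous_image)
  then obtain k where k: "\<And>v x. x \<in> C \<Longrightarrow> norm (G' x v) \<le> k v"
    unfolding bounded_iff by (auto, metis)
  show ?thesis
  proof (rule that)
    fix x v assume x: "x \<in> C"
    have "norm (G' x v) \<le> \<bar>v $ 1\<bar> * norm (G' x (axis 1 1)) + \<bar>v $ 2\<bar> * norm (G' x (axis 2 1))"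
      using norm_triangle_ineq[of "v $ 1 *\<^sub>R G' x (axis 1 1)" "v $ 2 *\<^sub>R G' x (axis 2 1)"]
      by (simp add: linear_vec2[OF assms(2)[OF x], of v])
    also have "\<dots> \<le> norm v * k (axis 1 1) + norm v * k (axis 2 1)"
      using x k by (intro add_mono mult_mono component_le_norm_cart) auto
    finally show "norm (G' x v) \<le> (k (axis 1 1) + k (axis 2 1)) * norm v"
      by (simp add: algebra_simps)
  qed
qed

text \<open>A ball around a point with positive \<open>G $ 2\<close>, enlarged until it meets the
  zero set, touches it in a point \<open>p1\<close>. In an annulus of this ball \<open>G $ 2\<close>
  dominates a multiple of a barrier that vanishes at \<open>p1\<close> with positive inward
  derivative. But \<open>p1\<close> is also a minimum of \<open>G $ 2\<close> in the open set
  \<open>V\<close>, so the inward derivative of \<open>G $ 2\<close> is 0.\<close>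

lemma hopf_monotone_graph:
  fixes g :: "real^2 \<Rightarrow> real" and G :: "real^2 \<Rightarrow> real^2"
  defines "e \<equiv> axis 2 1 :: real^2"
  assumes V: "open V" and x0: "x0 \<in> V" and \<alpha>: "\<alpha> < 0"
    and dg: "\<And>x. x \<in> V \<Longrightarrow> (g has_derivative (\<lambda>v. G x \<bullet> v)) (at x)"
    and dG: "\<And>x. x \<in> V \<Longrightarrow> (G has_derivative G' x) (at x)"
    and cG': "\<And>v. continuous_on V (\<lambda>x. G' x v)"
    and z: "\<And>x. x \<in> V \<Longrightarrow> 0 < x $ 2"
    and eqn: "\<And>x. x \<in> V \<Longrightarrow> mc_op (G' x) (G x) = - \<alpha> * G x $ 2 * (slope (G x))\<^sup>2 / x $ 2"
    and mono: "\<And>x s. x \<in> V \<Longrightarrow> 0 < s \<Longrightarrow> x + s *\<^sub>R e \<in> V \<Longrightarrow> g x < g (x + s *\<^sub>R e)"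
  shows "G x0 $ 2 \<noteq> 0"
proof
  assume zero: "G x0 $ 2 = 0"
  have ne: "norm e = 1" "e $ 2 = 1" by (auto simp: e_def)
  have Ge: "G x \<bullet> e = G x $ 2" for x by (simp add: e_def inner_axis)
  have cg: "continuous_on V g" and cG: "continuous_on V G"
    using dg dG by (meson has_derivative_continuous continuous_at_imp_continuous_on)+
  have along: "((\<lambda>t. g (x + t *\<^sub>R e)) has_real_derivative G (x + t *\<^sub>R e) $ 2) (at t)" if "x + t *\<^sub>R e \<in> V" for x t
    using has_real_derivative_along[OF dg[OF that]] by (simp add: Ge)
  have \<eta>0: "0 \<le> G x $ 2" if x: "x \<in> V" for x
  proof (rule ccontr)
    assume "\<not> 0 \<le> G x $ 2"
    then have neg: "G x $ 2 < 0" by simp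
    have "((\<lambda>t. g (x + t *\<^sub>R e)) has_real_derivative G x $ 2) (at 0)"
      using along[of x 0] x by simp
    from DERIV_neg_at_0[OF this neg] obtain d
      where d: "0 < d" "\<And>h. 0 < h \<Longrightarrow> h < d \<Longrightarrow> g (x + h *\<^sub>R e) < g (x + 0 *\<^sub>R e)" by blast
    obtain \<rho> where \<rho>: "0 < \<rho>" "ball x \<rho> \<subseteq> V" using V x openE by blast
    define h where "h = min d \<rho> / 2"
    have h: "0 < h" "h < d" "h < \<rho>" using d(1) \<rho>(1) by (auto simp: h_def min_def)
    then have "x + h *\<^sub>R e \<in> V" by (intro subsetD[OF \<rho>(2)]) (simp add: dist_norm ne)
    then show False using mono[OF x h(1)] d(2)[OF h(1,2)] by simp
  qed
  obtain \<rho>0 where \<rho>0: "0 < \<rho>0" "cball x0 \<rho>0 \<subseteq> V" using open_contains_cball V x0 by metis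
  \<comment> \<open>One third each for the distance to the centre \<open>q\<close>, for the radius
    of the ball around \<open>q\<close>, and for the vertical shifts.\<close>
  define \<rho> where "\<rho> = \<rho>0 / 3"
  have \<rho>: "0 < \<rho>" "cball x0 (3 * \<rho>) \<subseteq> V" using \<rho>0 by (auto simp: \<rho>_def)
  have inV: "y \<in> V" if "dist x0 y \<le> 3 * \<rho>" for y using \<rho>(2) that by auto
  \<comment> \<open>If \<open>G $ 2\<close> vanished near \<open>x0\<close>, then \<open>g\<close>
    would be constant along a short vertical segment, against strict monotonicity.\<close>
  obtain q where q: "dist x0 q < \<rho>" "0 < G q $ 2"
  proof (rule ccontr)
    assume obt: "\<not> thesis"
    note ob = that
    have nil: "G y $ 2 = 0" if "dist x0 y < \<rho>" for y
    proof -
      have "dist x0 y \<le> 3 * \<rho>" using \<open>dist x0 y < \<rho>\<close> \<rho>(1) by simp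
      then have "0 \<le> G y $ 2" by (intro \<eta>0 inV)
      moreover have "\<not> 0 < G y $ 2" using obt ob[of y] \<open>dist x0 y < \<rho>\<close> by blast
      ultimately show ?thesis by simp
    qed
    have "\<exists>t>0. t < \<rho> / 2 \<and> g (x0 + (\<rho> / 2) *\<^sub>R e) - g (x0 + 0 *\<^sub>R e) = (\<rho> / 2 - 0) * G (x0 + t *\<^sub>R e) $ 2"
      using \<rho>(1) by (intro MVT2 along inV) (auto simp: dist_norm ne)
    then obtain t where "0 < t" "t < \<rho> / 2" "g (x0 + (\<rho> / 2) *\<^sub>R e) - g x0 = (\<rho> / 2) * G (x0 + t *\<^sub>R e) $ 2"
      by auto
    moreover have "G (x0 + t *\<^sub>R e) $ 2 = 0" using calculation by (intro nil) (auto simp: dist_norm ne)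
    moreover have "g x0 < g (x0 + (\<rho> / 2) *\<^sub>R e)" using \<rho>(1) by (intro mono x0 inV) (auto simp: dist_norm ne)
    ultimately show False by simp
  qed
  define Z where "Z = {x \<in> cball x0 (2 * \<rho>). G x $ 2 = 0}"
  have "closed Z" unfolding Z_def
    by (intro continuous_closed_preimage_constant continuous_intros continuous_on_subset[OF cG])
       (use inV \<rho>(1) in auto)
  moreover have "x0 \<in> Z" using zero \<rho> by (simp add: Z_def)
  ultimately obtain p1 where p1: "p1 \<in> Z" "\<And>y. y \<in> Z \<Longrightarrow> dist q p1 \<le> dist q y"
    using distance_attains_inf[of Z q] by blast
  define r where "r = dist q p1"
  have r: "0 < r" "r < \<rho>"
    using p1(1) q p1(2)[OF \<open>x0 \<in> Z\<close>] by (auto simp: r_def Z_def dist_commute)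
  have near: "dist x0 y < 2 * \<rho>" if "dist q y \<le> r" for y
    using dist_triangle[of x0 y q] that q r by linarith
  have inVr: "y \<in> V" if "dist q y \<le> r" for y
    using near[OF that] \<rho>(1) by (intro inV) simp
  have \<eta>pos: "0 < G y $ 2" if "dist q y < r" for y
  proof -
    have "y \<notin> Z" using p1(2)[of y] that by (auto simp: r_def)
    then have "G y $ 2 \<noteq> 0" using near[of y] that by (auto simp: Z_def)
    moreover have "0 \<le> G y $ 2" using near[of y] that \<rho>(1) by (intro \<eta>0 inV) auto
    ultimately show ?thesis by simp
  qed
  obtain K where K: "\<And>x. x \<in> cball x0 (3 * \<rho>) \<Longrightarrow> norm (G x) \<le> K"
     "\<And>x v. x \<in> cball x0 (3 * \<rho>) \<Longrightarrow> norm (G' x v) \<le> K * norm v"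
     "\<And>x. x \<in> cball x0 (3 * \<rho>) \<Longrightarrow> 1 / x $ 2 \<le> K"
  proof -
    let ?C = "cball x0 (3 * \<rho>)"
    have "bounded (G ` ?C)"
      by (intro compact_imp_bounded compact_continuous_image continuous_on_subset[OF cG] \<rho>(2)) auto
    then obtain K1 where K1: "\<And>x. x \<in> ?C \<Longrightarrow> norm (G x) \<le> K1" unfolding bounded_iff by blast
    obtain K2 where K2: "\<And>x v. x \<in> ?C \<Longrightarrow> norm (G' x v) \<le> K2 * norm v"
      using uniform_linear_bound[of ?C G'] dG \<rho>(2) continuous_on_subset[OF cG' \<rho>(2)]
      by (metis compact_cball has_derivative_linear subsetD)
    have "bounded ((\<lambda>x. 1 / x $ 2) ` ?C)"
      using z \<rho>(2) by (intro compact_imp_bounded compact_continuous_image continuous_intros) (auto, fastforce)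
    then obtain K3 where K3: "\<And>x. x \<in> ?C \<Longrightarrow> \<bar>1 / x $ 2\<bar> \<le> K3" unfolding bounded_iff image_iff real_norm_def by blast
    show ?thesis
    proof (rule that[of "max K1 (max K2 K3)"])
      fix x v :: "real^2" assume x: "x \<in> ?C"
      show "norm (G x) \<le> max K1 (max K2 K3)" "1 / x $ 2 \<le> max K1 (max K2 K3)"
        using K1[OF x] abs_le_D1[OF K3[OF x]] by (simp_all only: le_max_iff_disj simp_thms)
      have "K2 * norm v \<le> max K1 (max K2 K3) * norm v" by (intro mult_right_mono) auto
      then show "norm (G' x v) \<le> max K1 (max K2 K3) * norm v" using K2[OF x, of v] by linarith
    qed
  qed
  define Cc where "Cc = - \<alpha> * K * (1 + 3 * K\<^sup>2) + 2 * K\<^sup>2"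
  have "0 \<le> norm (G x0)" by simp
  also have "\<dots> \<le> K" using \<rho> by (intro K(1)) auto
  finally have K0: "0 \<le> K" .
  have Cc: "0 \<le> Cc" unfolding Cc_def using \<alpha> K0 by (intro add_nonneg_nonneg mult_nonneg_nonneg) auto
  define l where "l = (4 + 2 * K\<^sup>2 + 2 * Cc * r) / r\<^sup>2"
  have l0: "0 < l" unfolding l_def using r Cc by (intro divide_pos_pos add_pos_nonneg) auto
  have lr: "4 + 2 * K\<^sup>2 + 2 * Cc * r \<le> l * r\<^sup>2" using r by (simp add: l_def)
  \<comment> \<open>The radius is \<open>r / 2 + r / 4\<close>: points of the inner circle stay in
    this ball when shifted by at most \<open>r / 4\<close>, and there \<open>G $ 2\<close> is at
    least \<open>m\<close>.\<close>
  have "compact (cball q (3 * r / 4))" "cball q (3 * r / 4) \<noteq> {}" using r by auto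
  moreover have "continuous_on (cball q (3 * r / 4)) (\<lambda>x. G x $ 2)"
    using r by (intro continuous_intros continuous_on_subset[OF cG] subsetI inVr) simp
  ultimately obtain y0 where y0: "y0 \<in> cball q (3 * r / 4)" "\<And>y. y \<in> cball q (3 * r / 4) \<Longrightarrow> G y0 $ 2 \<le> G y $ 2"
    using continuous_attains_inf by metis
  define m where "m = G y0 $ 2"
  have m: "0 < m" unfolding m_def using y0(1) r by (intro \<eta>pos) auto
  define v where "v x = gauss l q x - exp (- l * r\<^sup>2)" for x
  have gq: "gauss l q x = exp (- l * (dist q x)\<^sup>2)" for x
    unfolding gauss_def dist_norm norm_minus_commute[of q x] power2_norm_eq_inner ..
  have v1: "v x \<le> 1" for x
  proof -
    have "gauss l q x \<le> 1" using l0 by (simp add: gq)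
    then show ?thesis unfolding v_def using exp_ge_zero[of "- l * r\<^sup>2"] by linarith
  qed
  define A where "A = {x. r / 2 \<le> dist q x \<and> dist q x \<le> r}"
  have cA: "compact A"
  proof -
    have "A = cball q r - ball q (r / 2)" by (auto simp: A_def)
    then show ?thesis by (simp add: compact_diff)
  qed
  \<comment> \<open>A failure makes the minimum of \<open>F\<close> over the annulus negative. On
    the outer circle the barrier is 0 and the increment positive by strict monotonicity; on the
    inner circle the mean value theorem gives an increment of at least \<open>s * m\<close>; inside,
    \<open>increment_no_touching\<close> applies.\<close>
  have key: "s * m * v x \<le> g (x + s *\<^sub>R e) - g x" if s: "0 < s" "s \<le> r / 4" and x: "x \<in> A" for s x
  proof (rule ccontr)
    assume neg: "\<not> s * m * v x \<le> g (x + s *\<^sub>R e) - g x"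
    define F where "F y = g (y + s *\<^sub>R e) - g y - s * m * v y" for y
    have sV: "dist x0 (y + t *\<^sub>R e) \<le> 3 * \<rho>" if "dist q y \<le> r" "0 \<le> t" "t \<le> s" for y t
      using near[OF that(1)] norm_triangle_ineq[of "y - x0" "t *\<^sub>R e"] that r s
      by (simp add: dist_norm norm_minus_commute[of x0] ne algebra_simps)
    have AV: "y \<in> V" "y + s *\<^sub>R e \<in> V" if "dist q y \<le> r" for y
      using sV[OF that, of 0] sV[OF that, of s] s by (auto intro: inV)
    have "continuous_on A F"
      unfolding F_def v_def gauss_def
      by (intro continuous_intros continuous_on_compose2[OF cg] ) (use AV in \<open>auto simp: A_def\<close>)
    then obtain y where y: "y \<in> A" "\<And>y'. y' \<in> A \<Longrightarrow> F y \<le> F y'"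
      using continuous_attains_inf[OF cA] x by blast
    have Fy: "F y < 0" using y(2)[OF x] neg by (simp add: F_def)
    have dy: "r / 2 \<le> dist q y" "dist q y \<le> r" using y(1) by (auto simp: A_def)
    have incr: "g y < g (y + s *\<^sub>R e)" using AV[OF dy(2)] s by (intro mono)
    have "dist q y \<noteq> r"
    proof
      assume "dist q y = r"
      then have "v y = 0" by (simp add: v_def gq)
      then show False using Fy incr by (simp add: F_def)
    qed
    moreover have "dist q y \<noteq> r / 2"
    proof
      assume d: "dist q y = r / 2"
      have "\<exists>t>0. t < s \<and> g (y + s *\<^sub>R e) - g (y + 0 *\<^sub>R e) = (s - 0) * G (y + t *\<^sub>R e) $ 2"
        using s dy by (intro MVT2 along inV sV) auto
      then obtain t where t: "0 < t" "t < s" "g (y + s *\<^sub>R e) - g y = s * G (y + t *\<^sub>R e) $ 2"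
        by auto
      have "dist q (y + t *\<^sub>R e) \<le> dist q y + t"
        using dist_triangle[of q "y + t *\<^sub>R e" y] t by (simp add: dist_norm ne)
      then have "m \<le> G (y + t *\<^sub>R e) $ 2" unfolding m_def using d t s by (intro y0(2)) auto
      moreover have "m * v y \<le> m * 1" using m v1 by (intro mult_left_mono) auto
      ultimately have "s * (m * v y) \<le> s * G (y + t *\<^sub>R e) $ 2" using s by (intro mult_left_mono) auto
      then show False using Fy t by (simp add: F_def mult.assoc)
    qed
    ultimately have dy': "r / 2 < dist q y" "dist q y < r" using dy by auto
    define U where "U = ball q r - cball q (r / 2)"
    have UA: "y' \<in> A" "dist q y' \<le> r" if "y' \<in> U" for y' using that by (auto simp: U_def A_def)
    have y2: "0 < y $ 2" "(y + s *\<^sub>R e) $ 2 = y $ 2 + s" using z AV[OF dy(2)] by (auto simp: ne)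
    have yC: "y \<in> cball x0 (3 * \<rho>)" "y + s *\<^sub>R e \<in> cball x0 (3 * \<rho>)"
      using sV[OF dy(2), of 0] sV[OF dy(2), of s] s by auto
    show False
    proof (rule increment_no_touching[of \<alpha> s m U y g G "G' y" "G' (y + s *\<^sub>R e)" K r q l, folded e_def])
      show "open U" "y \<in> U" using dy' by (auto simp: U_def)
      show "(g has_derivative (\<bullet>) (G y')) (at y')"
        "(g has_derivative (\<bullet>) (G (y' + s *\<^sub>R e))) (at (y' + s *\<^sub>R e))" if "y' \<in> U" for y'
        using AV[OF UA(2)[OF that]] dg by auto
      show "mc_op (G' (y + s *\<^sub>R e)) (G (y + s *\<^sub>R e)) =
        - \<alpha> * G (y + s *\<^sub>R e) $ 2 * (slope (G (y + s *\<^sub>R e)))\<^sup>2 / (y $ 2 + s)"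
        using eqn[OF AV(2)[OF dy(2)]] y2(2) by simp
      show "g (y + s *\<^sub>R e) - g y - s * m * gauss l q y
          \<le> g (y' + s *\<^sub>R e) - g y' - s * m * gauss l q y'" if "y' \<in> U" for y'
        using y(2)[OF UA(1)[OF that]] by (simp add: F_def v_def algebra_simps)
    qed (use AV[OF dy(2)] s m \<alpha> dG eqn y2 K yC \<eta>0 dy' r l0 lr in \<open>auto simp: Cc_def dist_norm norm_minus_commute[of q]\<close>)
  qed
  \<comment> \<open>\<open>key\<close> divided by \<open>s\<close>, as \<open>s\<close> tends to
    0.\<close>
  have \<eta>v: "m * v x \<le> G x $ 2" if x: "x \<in> A" for x
  proof (rule ccontr)
    assume neg: "\<not> m * v x \<le> G x $ 2"
    then have neg': "G x $ 2 - m * v x < 0" by simp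
    have xV: "x \<in> V" using x by (intro inVr) (simp add: A_def)
    have "((\<lambda>t. g (x + t *\<^sub>R e) - t * (m * v x)) has_real_derivative G x $ 2 - m * v x) (at 0)"
      using along[of x 0] xV by (auto intro!: derivative_eq_intros)
    from DERIV_neg_at_0[OF this] neg' obtain d where d: "0 < d"
      "\<And>h. 0 < h \<Longrightarrow> h < d \<Longrightarrow> g (x + h *\<^sub>R e) - h * (m * v x) < g (x + 0 *\<^sub>R e) - 0 * (m * v x)"
      by blast
    define h where "h = min (d / 2) (r / 4)"
    have "0 < h" "h < d" "h \<le> r / 4" using d(1) r by (auto simp: h_def min_def)
    then show False using d(2)[of h] key[of h x] x by (simp add: mult.assoc)
  qed
  have p1V: "p1 \<in> V" by (intro inVr) (simp add: r_def)
  have Gp1: "G p1 $ 2 = 0" using p1(1) by (simp add: Z_def)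
  define w where "w = q - p1"
  have "((\<lambda>t. G (p1 + t *\<^sub>R w) $ 2) has_derivative (\<lambda>h. G' p1 (h *\<^sub>R w) $ 2)) (at 0)"
  proof -
    have "((\<lambda>t. p1 + t *\<^sub>R w) has_derivative (\<lambda>h. h *\<^sub>R w)) (at 0)"
      by (auto intro!: derivative_eq_intros)
    from has_derivative_compose[OF this, of G "G' p1"] dG[OF p1V]
    show ?thesis by (intro bounded_linear.has_derivative[OF bounded_linear_vec_nth]) auto
  qed
  then have d1: "((\<lambda>t. G (p1 + t *\<^sub>R w) $ 2) has_real_derivative G' p1 w $ 2) (at 0)"
    using has_derivative_linear[OF dG[OF p1V]] by (simp add: has_field_derivative_def linear_cmul mult_commute_abs)
  obtain \<delta>0 where \<delta>0: "0 < \<delta>0" "ball p1 \<delta>0 \<subseteq> V" using V p1V openE by blast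
  have "norm w = r" by (simp add: w_def r_def dist_norm)
  \<comment> \<open>\<open>G $ 2\<close> is nonnegative in all of \<open>V\<close>, also outside the
    ball, so \<open>p1\<close> is a two-sided minimum on the line through \<open>q\<close>.\<close>
  have "G' p1 w $ 2 = 0"
  proof (rule DERIV_local_min[OF d1, of "\<delta>0 / r"])
    show "0 < \<delta>0 / r" using \<delta>0 r by simp
    show "\<forall>t. \<bar>0 - t\<bar> < \<delta>0 / r \<longrightarrow> G (p1 + 0 *\<^sub>R w) $ 2 \<le> G (p1 + t *\<^sub>R w) $ 2"
    proof (intro allI impI)
      fix t assume "\<bar>0 - t\<bar> < \<delta>0 / r"
      then have "p1 + t *\<^sub>R w \<in> ball p1 \<delta>0" using \<open>norm w = r\<close> r by (simp add: dist_norm field_simps)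
      then show "G (p1 + 0 *\<^sub>R w) $ 2 \<le> G (p1 + t *\<^sub>R w) $ 2" using \<delta>0 \<eta>0 Gp1 by auto
    qed
  qed
  then have d1: "((\<lambda>t. G (p1 + t *\<^sub>R w) $ 2) has_real_derivative 0) (at 0)" using d1 by simp
  define L where "L t = exp (- l * ((1 - t) * r)\<^sup>2)" for t
  have vL: "v (p1 + t *\<^sub>R w) = L t - L 0" if "0 \<le> t" "t \<le> 1" for t
  proof -
    have "p1 + t *\<^sub>R w - q = (t - 1) *\<^sub>R w" by (simp add: w_def algebra_simps)
    then have "dist q (p1 + t *\<^sub>R w) = (1 - t) * r"
      using that \<open>norm w = r\<close> by (simp add: dist_norm norm_minus_commute[of q])
    then show ?thesis by (simp add: v_def gq L_def)
  qed
  have "(L has_real_derivative exp (- l * r\<^sup>2) * (2 * l * r\<^sup>2)) (at 0)"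
    unfolding L_def by (auto intro!: derivative_eq_intros simp: power2_eq_square)
  with d1 have "((\<lambda>t. G (p1 + t *\<^sub>R w) $ 2 - m * (L t - L 0)) has_real_derivative 0 - m * (exp (- l * r\<^sup>2) * (2 * l * r\<^sup>2))) (at 0)"
    by (auto intro!: derivative_eq_intros)
  moreover have "0 - m * (exp (- l * r\<^sup>2) * (2 * l * r\<^sup>2)) < 0" using m l0 r by simp
  ultimately obtain d where d: "0 < d"
    "\<And>h. 0 < h \<Longrightarrow> h < d \<Longrightarrow> G (p1 + h *\<^sub>R w) $ 2 - m * (L h - L 0) < G (p1 + 0 *\<^sub>R w) $ 2 - m * (L 0 - L 0)"
    by (rule DERIV_neg_at_0) blast
  define h where "h = min (d / 2) (1 / 2)"
  have h: "0 < h" "h < d" "h \<le> 1 / 2" using d(1) by (auto simp: h_def min_def)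
  have "p1 + h *\<^sub>R w - q = (h - 1) *\<^sub>R w" by (simp add: w_def algebra_simps)
  then have "dist q (p1 + h *\<^sub>R w) = (1 - h) * r"
    using h \<open>norm w = r\<close> by (simp add: dist_norm norm_minus_commute[of q])
  then have "p1 + h *\<^sub>R w \<in> A" using h r by (simp add: A_def mult_left_le_one_le)
  from \<eta>v[OF this] show False using d(2)[OF h(1,2)] vL[of h] h Gp1 by simp
qed

section \<open>Local graphs over a chart\<close>

lemma Lagrange_left: "cross3 (cross3 x y) z = (x \<bullet> z) *\<^sub>R y - (y \<bullet> z) *\<^sub>R x"
  by (simp add: cross3_simps forall_3)

text \<open>A right-handed orthonormal basis. With \<open>b\<close> given as a cross product, the
  \<open>b\<close>-component of any cross product is a two-by-two determinant in the other
  coordinates, see \<open>inner_cross_frame\<close>.\<close>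

definition frame :: "real^3 \<Rightarrow> real^3 \<Rightarrow> real^3 \<Rightarrow> bool" where
  "frame e1 e2 b \<longleftrightarrow> norm e1 = 1 \<and> norm e2 = 1 \<and> e1 \<bullet> e2 = 0 \<and> b = cross3 e1 e2"

lemma frame_inner:
  assumes "frame e1 e2 b"
  shows "e1 \<bullet> e1 = 1" "e2 \<bullet> e2 = 1" "b \<bullet> b = 1" "e1 \<bullet> e2 = 0" "e2 \<bullet> e1 = 0"
    "e1 \<bullet> b = 0" "b \<bullet> e1 = 0" "e2 \<bullet> b = 0" "b \<bullet> e2 = 0"
proof -
  have e: "norm e1 = 1" "norm e2 = 1" "e1 \<bullet> e2 = 0" "b = cross3 e1 e2" using assms by (auto simp: frame_def)
  show "e1 \<bullet> e1 = 1" "e2 \<bullet> e2 = 1" "e1 \<bullet> e2 = 0" "e2 \<bullet> e1 = 0"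
    using e by (auto simp: norm_eq_1 inner_commute)
  show "e1 \<bullet> b = 0" "b \<bullet> e1 = 0" "e2 \<bullet> b = 0" "b \<bullet> e2 = 0"
    unfolding e(4) by (simp_all add: dot_cross_self inner_commute)
  show "b \<bullet> b = 1" using norm_cross_dot[of e1 e2] e by (simp add: power2_norm_eq_inner)
qed

lemma frame_eqI:
  assumes f: "frame e1 e2 b" and "x \<bullet> e1 = y \<bullet> e1" "x \<bullet> e2 = y \<bullet> e2" "x \<bullet> b = y \<bullet> b"
  shows "x = y"
proof -
  define d where "d = x - y"
  have d: "d \<bullet> e1 = 0" "d \<bullet> e2 = 0" "d \<bullet> b = 0" using assms by (simp_all add: d_def inner_diff_left)
  have "cross3 d (cross3 e1 e2) = (d \<bullet> e2) *\<^sub>R e1 - (d \<bullet> e1) *\<^sub>R e2" by (rule Lagrange)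
  then have "cross3 d b = 0" using d f by (simp add: frame_def)
  then have "d = 0 \<or> b = 0" using d norm_and_cross_eq_0 by blast
  moreover have "b \<noteq> 0" using frame_inner(3)[OF f] by auto
  ultimately show ?thesis by (simp add: d_def)
qed

lemma frame_expand:
  assumes f: "frame e1 e2 b"
  shows "x = (x \<bullet> e1) *\<^sub>R e1 + (x \<bullet> e2) *\<^sub>R e2 + (x \<bullet> b) *\<^sub>R b"
  by (rule frame_eqI[OF f]) (simp_all add: inner_add_left frame_inner[OF f])

lemma frame_completion:
  assumes "norm e1 = 1" "norm b = 1" "e1 \<bullet> b = 0"
  shows "frame e1 (cross3 b e1) b" "frame (cross3 e1 b) e1 b"
proof -
  have 1: "norm (cross3 b e1) = 1" "norm (cross3 e1 b) = 1"
    using norm_cross_dot[of b e1] norm_cross_dot[of e1 b] assms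
    by (simp_all add: inner_commute power2_eq_1_iff) (smt (verit) norm_ge_zero)+
  have "cross3 e1 (cross3 b e1) = (e1 \<bullet> e1) *\<^sub>R b - (e1 \<bullet> b) *\<^sub>R e1"
    "cross3 (cross3 e1 b) e1 = (e1 \<bullet> e1) *\<^sub>R b - (e1 \<bullet> b) *\<^sub>R e1"
    by (simp_all add: Lagrange Lagrange_left inner_commute)
  then have 2: "b = cross3 e1 (cross3 b e1)" "b = cross3 (cross3 e1 b) e1"
    using assms by (simp_all add: norm_eq_1)
  show "frame e1 (cross3 b e1) b" "frame (cross3 e1 b) e1 b"
    using assms 1 2 by (simp_all add: frame_def dot_cross_self)
qed

lemma inner_cross_cross:
  "cross3 x y \<bullet> cross3 p q = (x \<bullet> p) * (y \<bullet> q) - (x \<bullet> q) * (y \<bullet> p)"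
  by (simp add: cross3_simps)

lemma inner_cross_frame:
  assumes "frame e1 e2 b"
  shows "cross3 x y \<bullet> b = (x \<bullet> e1) * (y \<bullet> e2) - (x \<bullet> e2) * (y \<bullet> e1)"
  using assms inner_cross_cross by (simp add: frame_def)

text \<open>The trace of the shape operator, computed in the basis \<open>t1\<close>, \<open>t2\<close> of the tangent plane that
  projects onto \<open>e1\<close>, \<open>e2\<close> along \<open>b\<close>.\<close>

lemma shape_operator_trace:
  assumes f: "frame e1 e2 b"
    and on: "norm e = 1" "norm f = 1" "e \<bullet> f = 0" "n \<bullet> e = 0" "n \<bullet> f = 0" "n \<bullet> b \<noteq> 0"
    and t: "n \<bullet> t1 = 0" "n \<bullet> t2 = 0" "t1 \<bullet> e1 = 1" "t1 \<bullet> e2 = 0" "t2 \<bullet> e1 = 0" "t2 \<bullet> e2 = 1"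
    and L: "linear L" "- L e = k1 *\<^sub>R e" "- L f = k2 *\<^sub>R f"
  shows "L t1 \<bullet> e1 + L t2 \<bullet> e2 = - (k1 + k2)"
proof -
  have proj: "x = (x \<bullet> e1) *\<^sub>R t1 + (x \<bullet> e2) *\<^sub>R t2" if "n \<bullet> x = 0" for x
  proof -
    define d where "d = x - ((x \<bullet> e1) *\<^sub>R t1 + (x \<bullet> e2) *\<^sub>R t2)"
    have "d \<bullet> e1 = 0" "d \<bullet> e2 = 0" by (simp_all add: d_def inner_diff_left inner_add_left t)
    then have d: "d = (d \<bullet> b) *\<^sub>R b" using frame_expand[OF f, of d] by simp
    have "n \<bullet> d = 0" by (simp add: d_def inner_diff_right inner_add_right t that)
    then have "(d \<bullet> b) * (n \<bullet> b) = 0" by (subst (asm) d) simp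
    then have "d \<bullet> b = 0" using on by simp
    with d have "d = 0" by simp
    then show ?thesis by (simp add: d_def)
  qed
  define g where "g = cross3 e f"
  have fr: "frame e f g" using on by (simp add: frame_def g_def)
  have "n = (n \<bullet> g) *\<^sub>R g" using frame_expand[OF fr, of n] on by simp
  moreover have "n \<noteq> 0" using on by auto
  ultimately have ng: "n \<bullet> g \<noteq> 0" by (metis scaleR_zero_left)
  have ex: "x = (x \<bullet> e) *\<^sub>R e + (x \<bullet> f) *\<^sub>R f" if "n \<bullet> x = 0" for x
  proof -
    have "(n \<bullet> g) * (g \<bullet> x) = 0" using that \<open>n = (n \<bullet> g) *\<^sub>R g\<close> by (metis inner_scaleR_left)
    then have "x \<bullet> g = 0" using ng by (simp add: inner_commute)
    then show ?thesis using frame_expand[OF fr, of x] by simp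
  qed
  have Le: "L e = - k1 *\<^sub>R e" "L f = - k2 *\<^sub>R f" using L(2,3) by (simp_all add: minus_equation_iff[of "L _"])
  have Lt: "L x = - (k1 * (x \<bullet> e)) *\<^sub>R e - (k2 * (x \<bullet> f)) *\<^sub>R f" if "n \<bullet> x = 0" for x
  proof -
    have "L x = L ((x \<bullet> e) *\<^sub>R e + (x \<bullet> f) *\<^sub>R f)" using ex[OF that] by simp
    also have "\<dots> = (x \<bullet> e) *\<^sub>R L e + (x \<bullet> f) *\<^sub>R L f" using L(1) by (simp add: linear_add linear_cmul)
    finally show ?thesis by (simp add: Le mult.commute)
  qed
  \<comment> \<open>On the tangent plane, pairing with \<open>e1\<close> and \<open>e2\<close> is
    the dual basis of \<open>t1\<close>, \<open>t2\<close>. Expanding \<open>e\<close> and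
    \<open>f\<close> in this basis and pairing each with itself converts the mixed expression into
    the trace along the principal directions.\<close>
  have 1: "(e \<bullet> e1) * (t1 \<bullet> e) + (e \<bullet> e2) * (t2 \<bullet> e) = 1"
    using arg_cong[OF proj[OF on(4)], of "\<lambda>x. x \<bullet> e"] on by (simp add: inner_add_left norm_eq_1)
  have 2: "(f \<bullet> e1) * (t1 \<bullet> f) + (f \<bullet> e2) * (t2 \<bullet> f) = 1"
    using arg_cong[OF proj[OF on(5)], of "\<lambda>x. x \<bullet> f"] on by (simp add: inner_add_left norm_eq_1)
  have "L t1 \<bullet> e1 + L t2 \<bullet> e2 = - k1 * ((e \<bullet> e1) * (t1 \<bullet> e) + (e \<bullet> e2) * (t2 \<bullet> e))
      - k2 * ((f \<bullet> e1) * (t1 \<bullet> f) + (f \<bullet> e2) * (t2 \<bullet> f))"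
    unfolding Lt[OF t(1)] Lt[OF t(2)] by (simp add: inner_diff_left algebra_simps)
  then show ?thesis unfolding 1 2 by simp
qed

section \<open>Charts away from the boundary as graphs over planes\<close>

definition proj :: "real^3 \<Rightarrow> real^3 \<Rightarrow> real^3 \<Rightarrow> real^2" where
  "proj e1 e2 p = vector [p \<bullet> e1, p \<bullet> e2]"

lemma proj_nth: "proj e1 e2 p $ 1 = p \<bullet> e1" "proj e1 e2 p $ 2 = p \<bullet> e2"
  by (simp_all add: proj_def)

text \<open>A graph over the plane of \<open>e1\<close>, \<open>e2\<close> with unit normal
  \<open>n\<close> has this vector as its gradient, and the squares of the three components of
  \<open>n\<close> add up to 1.\<close>

lemma slope_of_normal:
  assumes f: "frame e1 e2 b" and n: "norm n = 1" "n \<bullet> b \<noteq> 0"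
  shows "slope (- (1 / (n \<bullet> b)) *\<^sub>R proj e1 e2 n) = 1 / \<bar>n \<bullet> b\<bar>"
proof -
  let ?G = "- (1 / (n \<bullet> b)) *\<^sub>R proj e1 e2 n"
  have "1 = n \<bullet> n" using n by (simp add: norm_eq_1)
  also have "\<dots> = (n \<bullet> e1)\<^sup>2 + (n \<bullet> e2)\<^sup>2 + (n \<bullet> b)\<^sup>2"
    using arg_cong[OF frame_expand[OF f, of n], of "\<lambda>x. n \<bullet> x"] by (simp add: inner_add_right power2_eq_square)
  finally have "(slope ?G)\<^sup>2 = (1 / \<bar>n \<bullet> b\<bar>)\<^sup>2"
    unfolding slope_sq using n(2) by (simp add: inner_vec2 proj_nth power2_eq_square field_simps)
  then show ?thesis using slope_pos[of ?G]
    by (metis power2_eq_iff_nonneg less_imp_le zero_le_divide_1_iff abs_ge_zero)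
qed

locale interior_chart =
  fixes M :: "(real^3) set" and W :: "(real^2) set" and \<psi> :: "real^2 \<Rightarrow> real^3" and N :: "real^3 \<Rightarrow> real^3"
  assumes lp: "local_parametrization M W \<psi>" and int: "W \<subseteq> {x. 0 < x $ 2}" and gm: "gauss_map M N"
begin

definition D :: "real^2 \<Rightarrow> real^2 \<Rightarrow> real^3" where
  "D x v = frechet_derivative \<psi> (at x) v"

definition D2 :: "real^2 \<Rightarrow> real^2 \<Rightarrow> real^2 \<Rightarrow> real^3" where
  "D2 x v w = frechet_derivative (\<lambda>x. D x v) (at x) w"

text \<open>The normal that can be differentiated in the chart, while the Gauss map is by definition
  only continuous. Ratios of components agree for both by \<open>\<nu>_quot\<close>, whatever the
  relative sign and length.\<close>

definition \<nu> :: "real^2 \<Rightarrow> real^3" where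
  "\<nu> x = cross3 (D x (axis 1 1)) (D x (axis 2 1))"

lemma op: "open W" and half: "W \<inter> half_plane = W"
  using lp int by (auto simp: local_parametrization_def half_plane_def)

lemma Ck: "Ck_on k \<psi> W"
  using lp by (simp add: local_parametrization_def smooth_on_def)

lemma d\<psi>: "x \<in> W \<Longrightarrow> (\<psi> has_derivative D x) (at x)"
  using Ck[of 1] by (auto simp: D_def[abs_def] frechet_derivative_works)

lemma dD: "x \<in> W \<Longrightarrow> ((\<lambda>x. D x v) has_derivative D2 x v) (at x)"
  using Ck[of 2] by (auto simp: D_def D2_def[abs_def] numeral_2_eq_2 frechet_derivative_works)

lemma cD: "continuous_on W (\<lambda>x. D x v)"
  using dD by (meson has_derivative_continuous continuous_at_imp_continuous_on)

lemma cD2: "continuous_on W (\<lambda>x. D2 x v w)"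
  using Ck[of 2] by (auto simp: D_def D2_def numeral_2_eq_2)

lemma injD: "x \<in> W \<Longrightarrow> inj (D x)"
  using lp half by (auto simp: local_parametrization_def D_def[abs_def])

lemma linD: "x \<in> W \<Longrightarrow> linear (D x)"
  using d\<psi> has_derivative_linear by blast

lemma in_M: "x \<in> W \<Longrightarrow> \<psi> x \<in> M"
  using lp half openin_imp_subset unfolding local_parametrization_def by fastforce

lemma \<nu>_nz: assumes x: "x \<in> W" shows "\<nu> x \<noteq> 0"
proof
  assume "\<nu> x = 0"
  then have "collinear {0, D x (axis 1 1), D x (axis 2 1)}" by (simp add: \<nu>_def cross_eq_0)
  then consider "D x (axis 1 1) = 0" | c where "D x (axis 2 1) = c *\<^sub>R D x (axis 1 1)"
    unfolding collinear_lemma by (metis scaleR_zero_left)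
  then show False
  proof cases
    case 1
    then have "D x (axis 1 1) = D x 0" using linear_0[OF linD[OF x]] by simp
    then have "(axis 1 1 :: real^2) = 0" using injD[OF x] by (simp add: inj_eq)
    then show False by (simp add: axis_eq_0_iff)
  next
    case (2 c)
    then have "D x (axis 2 1) = D x (c *\<^sub>R axis 1 1)" using linD[OF x] by (simp add: linear_cmul)
    then have "(axis 2 1 :: real^2) = c *\<^sub>R axis 1 1" using injD[OF x] by (simp add: inj_eq)
    then show False by (auto simp: vec_eq_iff forall_2 axis_def)
  qed
qed

lemma normal_D: "x \<in> W \<Longrightarrow> N (\<psi> x) \<bullet> D x v = 0"
proof -
  assume x: "x \<in> W"
  then have "D x v \<in> tangent_plane M (\<psi> x)"
    unfolding tangent_plane_def D_def using lp half by blast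
  then show ?thesis using gm in_M[OF x] by (auto simp: gauss_map_def)
qed

lemma norm_N: "x \<in> W \<Longrightarrow> norm (N (\<psi> x)) = 1"
  using gm in_M by (auto simp: gauss_map_def)

lemma \<nu>_D: "x \<in> W \<Longrightarrow> \<nu> x \<bullet> D x v = 0"
  using linear_vec2[OF linD, of x v] by (simp add: \<nu>_def inner_add_right dot_cross_self)

lemma N_eq:
  assumes x: "x \<in> W"
  shows "\<nu> x = (N (\<psi> x) \<bullet> \<nu> x) *\<^sub>R N (\<psi> x)" "N (\<psi> x) \<bullet> \<nu> x \<noteq> 0"
proof -
  let ?n = "N (\<psi> x)"
  have "cross3 ?n (\<nu> x) = (?n \<bullet> D x (axis 2 1)) *\<^sub>R D x (axis 1 1) - (?n \<bullet> D x (axis 1 1)) *\<^sub>R D x (axis 2 1)"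
    unfolding \<nu>_def by (rule Lagrange)
  then have "cross3 ?n (\<nu> x) = 0" by (simp add: normal_D[OF x])
  moreover have "cross3 (cross3 ?n (\<nu> x)) ?n = (?n \<bullet> ?n) *\<^sub>R \<nu> x - (?n \<bullet> \<nu> x) *\<^sub>R ?n"
    by (simp add: Lagrange Lagrange_left inner_commute)
  ultimately show "\<nu> x = (N (\<psi> x) \<bullet> \<nu> x) *\<^sub>R N (\<psi> x)"
    using norm_N[OF x] by (simp add: norm_eq_1)
  then show "N (\<psi> x) \<bullet> \<nu> x \<noteq> 0" using \<nu>_nz[OF x] by auto
qed

lemma \<nu>_inner: "x \<in> W \<Longrightarrow> \<nu> x \<bullet> b = (N (\<psi> x) \<bullet> \<nu> x) * (N (\<psi> x) \<bullet> b)"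
  using N_eq(1) by (metis inner_scaleR_left)

lemma \<nu>_quot: "x \<in> W \<Longrightarrow> (\<nu> x \<bullet> e) / (\<nu> x \<bullet> b) = (N (\<psi> x) \<bullet> e) / (N (\<psi> x) \<bullet> b)"
  using N_eq(2)[of x] by (simp add: \<nu>_inner[of x e] \<nu>_inner[of x b])

lemma d_proj:
  assumes "x \<in> W"
  shows "((\<lambda>x. proj e1 e2 (\<psi> x)) has_derivative (\<lambda>v. proj e1 e2 (D x v))) (at x)"
  unfolding proj_def vector2_eq using d\<psi>[OF assms] by (auto intro!: derivative_eq_intros)

lemma proj_D_inj:
  assumes x: "x \<in> W" and f: "frame e1 e2 b" and nz: "\<nu> x \<bullet> b \<noteq> 0"
  shows "inj (\<lambda>v. proj e1 e2 (D x v))"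
proof -
  have lin: "linear (\<lambda>v. proj e1 e2 (D x v))"
    using d_proj[OF x] has_derivative_linear by blast
  show ?thesis
    unfolding linear_injective_0[OF lin]
  proof (intro allI impI)
    fix v assume "proj e1 e2 (D x v) = 0"
    then have 0: "D x v \<bullet> e1 = 0" "D x v \<bullet> e2 = 0" using proj_nth by (metis zero_index)+
    then have e: "D x v = (D x v \<bullet> b) *\<^sub>R b" using frame_expand[OF f, of "D x v"] by simp
    have "(D x v \<bullet> b) * (\<nu> x \<bullet> b) = 0" using \<nu>_D[OF x, of v] by (subst (asm) e) simp
    then have "D x v = D x 0" using e nz linear_0[OF linD[OF x]] by simp
    then show "v = 0" using injD[OF x] by (simp add: inj_eq)
  qed
qed

text \<open>The inverse function theorem for the projected parametrization. It is applied on the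
  open set where \<open>\<nu> x \<bullet> b\<close> is nonzero, so that transversality to
  \<open>b\<close> holds on all of \<open>V\<close>.\<close>

lemma proj_inverse:
  assumes x0: "x0 \<in> W" and f: "frame e1 e2 b" and nz: "\<nu> x0 \<bullet> b \<noteq> 0"
  obtains V s s' where "open V" "proj e1 e2 (\<psi> x0) \<in> V" "s (proj e1 e2 (\<psi> x0)) = x0"
    "\<And>y. y \<in> V \<Longrightarrow> s y \<in> W \<and> \<nu> (s y) \<bullet> b \<noteq> 0 \<and> proj e1 e2 (\<psi> (s y)) = y"
    "\<And>y. y \<in> V \<Longrightarrow> (s has_derivative s' y) (at y)"
proof -
  define U where "U = {x \<in> W. \<nu> x \<bullet> b \<noteq> 0}"
  have c\<nu>: "continuous_on W (\<lambda>x. \<nu> x \<bullet> b)"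
    unfolding \<nu>_def by (intro continuous_intros continuous_on_cross cD)
  have "open U"
  proof -
    have "U = W \<inter> (\<lambda>x. \<nu> x \<bullet> b) -` (- {0})" by (auto simp: U_def)
    then show ?thesis using continuous_open_preimage[OF c\<nu> op open_Compl[OF closed_singleton]] by metis
  qed
  define L where "L x = Blinfun (\<lambda>v. proj e1 e2 (D x v))" for x
  have bl: "bounded_linear (\<lambda>v. proj e1 e2 (D x v))" if "x \<in> W" for x
    using d_proj[OF that] has_derivative_bounded_linear by blast
  have L: "blinfun_apply (L x) = (\<lambda>v. proj e1 e2 (D x v))" if "x \<in> W" for x
    unfolding L_def by (rule bounded_linear_Blinfun_apply[OF bl[OF that]])
  have cL: "continuous_on U L"
  proof (rule continuous_on_blinfun_componentwise)
    fix i
    have "continuous_on U (\<lambda>x. proj e1 e2 (D x i))"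
      unfolding proj_def vector2_eq
      by (intro continuous_intros continuous_on_subset[OF cD]) (auto simp: U_def)
    then show "continuous_on U (\<lambda>x. blinfun_apply (L x) i)"
      by (rule continuous_on_eq) (auto simp: L U_def)
  qed
  obtain g where g: "linear g" "g \<circ> (\<lambda>v. proj e1 e2 (D x0 v)) = id"
    using linear_injective_left_inverse[OF _ proj_D_inj[OF x0 f nz]] bl[OF x0] bounded_linear.linear by blast
  have inv: "Blinfun g o\<^sub>L L x0 = id_blinfun"
    using g by (intro blinfun_eqI) (simp add: L[OF x0] bounded_linear_Blinfun_apply linear_linear fun_eq_iff)
  have der: "((\<lambda>x. proj e1 e2 (\<psi> x)) has_derivative blinfun_apply (L x)) (at x)" if "x \<in> U" for x
    using d_proj that by (simp add: L U_def)
  have x0U: "x0 \<in> U" using x0 nz by (simp add: U_def)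
  show ?thesis
  proof (rule inverse_function_theorem[OF \<open>open U\<close> der cL x0U inv])
    fix U' V s s'
    assume *: "U' \<subseteq> U" "x0 \<in> U'" "open V" "proj e1 e2 (\<psi> x0) \<in> V"
      "homeomorphism U' V (\<lambda>x. proj e1 e2 (\<psi> x)) s" "\<And>y. y \<in> V \<Longrightarrow> (s has_derivative s' y) (at y)"
    show ?thesis
    proof (rule that[of V s s'])
      show "s y \<in> W \<and> \<nu> (s y) \<bullet> b \<noteq> 0 \<and> proj e1 e2 (\<psi> (s y)) = y" if "y \<in> V" for y
        using *(1,5) that by (auto simp: homeomorphism_def U_def)
      show "s (proj e1 e2 (\<psi> x0)) = x0" using *(2,5) by (auto simp: homeomorphism_def)
    qed (use * in auto)
  qed
qed

lemma d\<nu>: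
  assumes x: "x \<in> W"
  shows "(\<nu> has_derivative (\<lambda>v. cross3 (D2 x (axis 1 1) v) (D x (axis 2 1)) + cross3 (D x (axis 1 1)) (D2 x (axis 2 1) v))) (at x)"
proof -
  have "bounded_bilinear cross3"
    using bilinear_cross bilinear_conv_bounded_bilinear by blast
  from bounded_bilinear.FDERIV[OF this dD[OF x] dD[OF x]]
  show ?thesis unfolding \<nu>_def by (simp add: add.commute)
qed

lemma c\<nu>: "continuous_on W \<nu>"
  unfolding \<nu>_def by (intro continuous_intros continuous_on_cross cD)

text \<open>The equation comes from the trace of the shape operator, because the component of the Gauss map
  orthogonal to \<open>b\<close> is, up to sign, the unit gradient \<open>G / slope G\<close>.\<close>

lemma local_graph:
  assumes x0: "x0 \<in> W" and f: "frame e1 e2 b" and nz: "N (\<psi> x0) \<bullet> b \<noteq> 0"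
    and curv: "\<And>p. p \<in> M \<Longrightarrow> \<exists>H. has_mean_curvature M N p H \<and> 2 * H = \<alpha> * ((N p \<bullet> a) / (p \<bullet> a))"
  obtains V s G G' where "open V" "proj e1 e2 (\<psi> x0) \<in> V" "s (proj e1 e2 (\<psi> x0)) = x0"
    "\<And>y. y \<in> V \<Longrightarrow> s y \<in> W" "\<And>y. y \<in> V \<Longrightarrow> proj e1 e2 (\<psi> (s y)) = y"
    "\<And>y. y \<in> V \<Longrightarrow> N (\<psi> (s y)) \<bullet> b \<noteq> 0"
    "\<And>y. y \<in> V \<Longrightarrow> ((\<lambda>y. \<psi> (s y) \<bullet> b) has_derivative (\<lambda>v. G y \<bullet> v)) (at y)"
    "\<And>y. y \<in> V \<Longrightarrow> (G has_derivative G' y) (at y)"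
    "\<And>v. continuous_on V (\<lambda>y. G' y v)"
    "\<And>y. y \<in> V \<Longrightarrow> G y = - (1 / (N (\<psi> (s y)) \<bullet> b)) *\<^sub>R proj e1 e2 (N (\<psi> (s y)))"
    "\<And>y. y \<in> V \<Longrightarrow> mc_op (G' y) (G y) =
       \<alpha> * ((b - G y $ 1 *\<^sub>R e1 - G y $ 2 *\<^sub>R e2) \<bullet> a) * (slope (G y))\<^sup>2 / (\<psi> (s y) \<bullet> a)"
proof -
  note fi = frame_inner[OF f]
  have nz': "\<nu> x0 \<bullet> b \<noteq> 0" using N_eq(2)[OF x0] nz by (simp add: \<nu>_inner[OF x0])
  obtain V s s' where V: "open V" "proj e1 e2 (\<psi> x0) \<in> V" "s (proj e1 e2 (\<psi> x0)) = x0"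
    "\<And>y. y \<in> V \<Longrightarrow> s y \<in> W \<and> \<nu> (s y) \<bullet> b \<noteq> 0 \<and> proj e1 e2 (\<psi> (s y)) = y"
    and ds: "\<And>y. y \<in> V \<Longrightarrow> (s has_derivative s' y) (at y)"
    using proj_inverse[OF x0 f nz'] by metis
  have sW: "s y \<in> W" and \<nu>b: "\<nu> (s y) \<bullet> b \<noteq> 0" and ps: "proj e1 e2 (\<psi> (s y)) = y" if "y \<in> V" for y
    using V(4)[OF that] by auto
  have Nb: "N (\<psi> (s y)) \<bullet> b \<noteq> 0" if "y \<in> V" for y
    using \<nu>b[OF that] \<nu>_inner[OF sW[OF that], of b] by auto
  have cs: "continuous_on V s"
    using ds by (meson has_derivative_continuous continuous_at_imp_continuous_on)
  \<comment> \<open>The components of the gradient in terms of the smooth normal.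
    \<open>\<gamma>N\<close> replaces it by the parallel Gauss map afterwards.\<close>
  define \<gamma> where "\<gamma> e x = - ((\<nu> x \<bullet> e) / (\<nu> x \<bullet> b))" for e x
  define \<nu>' where "\<nu>' x v = cross3 (D2 x (axis 1 1) v) (D x (axis 2 1)) + cross3 (D x (axis 1 1)) (D2 x (axis 2 1) v)" for x v
  define \<gamma>' where "\<gamma>' e x v = - ((\<nu>' x v \<bullet> e) / (\<nu> x \<bullet> b) - (\<nu> x \<bullet> e) * (\<nu>' x v \<bullet> b) / (\<nu> x \<bullet> b)\<^sup>2)" for e x v
  have d\<gamma>: "(\<gamma> e has_derivative \<gamma>' e x) (at x)" if x: "x \<in> W" "\<nu> x \<bullet> b \<noteq> 0" for e x
    unfolding \<gamma>_def \<gamma>'_def \<nu>'_def using d\<nu>[OF x(1)] x(2)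
    by (auto intro!: derivative_eq_intros simp: field_simps power2_eq_square)
  define G where "G y = \<gamma> e1 (s y) *\<^sub>R axis 1 1 + \<gamma> e2 (s y) *\<^sub>R (axis 2 1 :: real^2)" for y
  have G12: "G y $ 1 = \<gamma> e1 (s y)" "G y $ 2 = \<gamma> e2 (s y)" for y by (simp_all add: G_def axis_def)
  define T where "T y v = D (s y) (s' y v)" for y v
  have dpt: "((\<lambda>y. \<psi> (s y)) has_derivative T y) (at y)" if "y \<in> V" for y
    unfolding T_def using has_derivative_compose[OF ds[OF that] d\<psi>[OF sW[OF that]]] by simp
  have T12: "T y v \<bullet> e1 = v $ 1" "T y v \<bullet> e2 = v $ 2" if y: "y \<in> V" for y v
  proof -
    have "((\<lambda>y. proj e1 e2 (\<psi> (s y))) has_derivative (\<lambda>v. proj e1 e2 (T y v))) (at y)"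
      unfolding proj_def vector2_eq using dpt[OF y] by (auto intro!: derivative_eq_intros)
    moreover have "((\<lambda>y. proj e1 e2 (\<psi> (s y))) has_derivative (\<lambda>v. v)) (at y)"
      by (rule has_derivative_transform_within_open[OF has_derivative_ident V(1) y]) (simp add: ps)
    ultimately have "(\<lambda>v. proj e1 e2 (T y v)) = (\<lambda>v. v)" by (rule has_derivative_unique)
    then have "proj e1 e2 (T y v) = v" by metis
    then show "T y v \<bullet> e1 = v $ 1" "T y v \<bullet> e2 = v $ 2" using proj_nth by metis+
  qed
  have Tb: "T y v \<bullet> b = G y \<bullet> v" if y: "y \<in> V" for y v
  proof -
    have "\<nu> (s y) \<bullet> T y v = 0" unfolding T_def by (rule \<nu>_D[OF sW[OF y]])
    moreover have "T y v = v $ 1 *\<^sub>R e1 + v $ 2 *\<^sub>R e2 + (T y v \<bullet> b) *\<^sub>R b"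
      using frame_expand[OF f, of "T y v"] by (simp add: T12[OF y])
    ultimately have "v $ 1 * (\<nu> (s y) \<bullet> e1) + v $ 2 * (\<nu> (s y) \<bullet> e2) + (T y v \<bullet> b) * (\<nu> (s y) \<bullet> b) = 0"
      by (metis inner_add_right inner_scaleR_right)
    then show ?thesis using \<nu>b[OF y] by (simp add: inner_vec2 G12 \<gamma>_def field_simps)
  qed
  have Teq: "T y v = v $ 1 *\<^sub>R e1 + v $ 2 *\<^sub>R e2 + (G y \<bullet> v) *\<^sub>R b" if y: "y \<in> V" for y v
    using frame_expand[OF f, of "T y v"] by (simp add: T12[OF y] Tb[OF y])
  have du: "((\<lambda>y. \<psi> (s y) \<bullet> b) has_derivative (\<lambda>v. G y \<bullet> v)) (at y)" if y: "y \<in> V" for y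
    using has_derivative_inner_left[OF dpt[OF y], of b] by (simp add: Tb[OF y])
  define G' where "G' y v = \<gamma>' e1 (s y) (s' y v) *\<^sub>R axis 1 1 + \<gamma>' e2 (s y) (s' y v) *\<^sub>R (axis 2 1 :: real^2)" for y v
  have dG: "(G has_derivative G' y) (at y)" if y: "y \<in> V" for y
    unfolding G_def G'_def
    using has_derivative_compose[OF ds[OF y] d\<gamma>[OF sW[OF y] \<nu>b[OF y]]] by (auto intro!: derivative_eq_intros)
  have cG: "continuous_on V G"
    using dG by (meson has_derivative_continuous continuous_at_imp_continuous_on)
  have cc: "continuous_on V (\<lambda>y. h (s y))" if "continuous_on W h" for h :: "real^2 \<Rightarrow> real^3"
    by (rule continuous_on_compose2[OF that cs]) (use sW in auto)
  have c\<nu>': "continuous_on W (\<lambda>x. \<nu>' x v)" for v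
    unfolding \<nu>'_def by (intro continuous_intros continuous_on_cross cD cD2)
  have \<nu>\<nu>: "\<nu> (s y) \<bullet> \<nu> (s y) \<noteq> 0" if "y \<in> V" for y using \<nu>_nz[OF sW[OF that]] by simp
  \<comment> \<open>Cramer's rule in the basis of the two coordinate tangent vectors. The derivative
    \<open>s'\<close> comes without continuity; \<open>T\<close> is continuous, being explicit in
    terms of \<open>G\<close> by \<open>Teq\<close>, and passes this on to
    \<open>s'\<close>.\<close>
  have s'_eq: "s' y v $ 1 = (cross3 (T y v) (D (s y) (axis 2 1)) \<bullet> \<nu> (s y)) / (\<nu> (s y) \<bullet> \<nu> (s y))"
    "s' y v $ 2 = (cross3 (D (s y) (axis 1 1)) (T y v) \<bullet> \<nu> (s y)) / (\<nu> (s y) \<bullet> \<nu> (s y))" if y: "y \<in> V" for y v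
  proof -
    have T: "T y v = s' y v $ 1 *\<^sub>R D (s y) (axis 1 1) + s' y v $ 2 *\<^sub>R D (s y) (axis 2 1)"
      unfolding T_def by (rule linear_vec2[OF linD[OF sW[OF y]]])
    have "cross3 (T y v) (D (s y) (axis 2 1)) = s' y v $ 1 *\<^sub>R \<nu> (s y)"
      "cross3 (D (s y) (axis 1 1)) (T y v) = s' y v $ 2 *\<^sub>R \<nu> (s y)"
      unfolding T \<nu>_def by (simp_all add: cross_add_left cross_add_right cross_mult_left cross_mult_right)
    then show "s' y v $ 1 = (cross3 (T y v) (D (s y) (axis 2 1)) \<bullet> \<nu> (s y)) / (\<nu> (s y) \<bullet> \<nu> (s y))"
      "s' y v $ 2 = (cross3 (D (s y) (axis 1 1)) (T y v) \<bullet> \<nu> (s y)) / (\<nu> (s y) \<bullet> \<nu> (s y))"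
      using \<nu>\<nu>[OF y] by simp_all
  qed
  have cT: "continuous_on V (\<lambda>y. T y v)" for v
    by (rule continuous_on_eq[of _ "\<lambda>y. v $ 1 *\<^sub>R e1 + v $ 2 *\<^sub>R e2 + (G y \<bullet> v) *\<^sub>R b"])
      (auto intro!: continuous_intros cG simp: Teq)
  have cs': "continuous_on V (\<lambda>y. s' y v $ 1)" "continuous_on V (\<lambda>y. s' y v $ 2)" for v
  proof -
    have "continuous_on V (\<lambda>y. (cross3 (T y v) (D (s y) (axis 2 1)) \<bullet> \<nu> (s y)) / (\<nu> (s y) \<bullet> \<nu> (s y)))"
      "continuous_on V (\<lambda>y. (cross3 (D (s y) (axis 1 1)) (T y v) \<bullet> \<nu> (s y)) / (\<nu> (s y) \<bullet> \<nu> (s y)))"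
      using \<nu>\<nu> by (auto intro!: continuous_intros continuous_on_cross cT cc[OF cD] cc[OF c\<nu>])
    then show "continuous_on V (\<lambda>y. s' y v $ 1)" "continuous_on V (\<lambda>y. s' y v $ 2)"
      by (auto elim!: continuous_on_eq simp: s'_eq)
  qed
  have c\<gamma>': "continuous_on V (\<lambda>y. \<gamma>' e (s y) (s' y v))" for e v
  proof -
    have 1: "continuous_on V (\<lambda>y. \<gamma>' e (s y) w)" for w
      unfolding \<gamma>'_def using \<nu>b by (intro continuous_intros cc[OF c\<nu>'] cc[OF c\<nu>]) auto
    have "continuous_on V (\<lambda>y. s' y v $ 1 *\<^sub>R \<gamma>' e (s y) (axis 1 1) + s' y v $ 2 *\<^sub>R \<gamma>' e (s y) (axis 2 1))"
      by (intro continuous_intros cs' 1)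
    moreover have "s' y v $ 1 *\<^sub>R \<gamma>' e (s y) (axis 1 1) + s' y v $ 2 *\<^sub>R \<gamma>' e (s y) (axis 2 1) = \<gamma>' e (s y) (s' y v)"
      if "y \<in> V" for y
      using linear_vec2[OF has_derivative_linear[OF d\<gamma>[OF sW[OF that] \<nu>b[OF that]]]] by metis
    ultimately show ?thesis by (rule continuous_on_eq) 
  qed
  have cG': "continuous_on V (\<lambda>y. G' y v)" for v
    unfolding G'_def by (intro continuous_intros c\<gamma>')
  have \<gamma>N: "\<gamma> e (s y) = - ((N (\<psi> (s y)) \<bullet> e) / (N (\<psi> (s y)) \<bullet> b))" if "y \<in> V" for e y
    unfolding \<gamma>_def using \<nu>_quot[OF sW[OF that]] by simp
  have GN: "G y = - (1 / (N (\<psi> (s y)) \<bullet> b)) *\<^sub>R proj e1 e2 (N (\<psi> (s y)))" if "y \<in> V" for y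
    by (simp add: vec_eq_iff forall_2 G12 proj_nth \<gamma>N[OF that])
  have mc: "mc_op (G' y) (G y) =
       \<alpha> * ((b - G y $ 1 *\<^sub>R e1 - G y $ 2 *\<^sub>R e2) \<bullet> a) * (slope (G y))\<^sup>2 / (\<psi> (s y) \<bullet> a)" if y: "y \<in> V" for y
  proof -
    define p where "p = \<psi> (s y)"
    define n where "n = N p"
    have ptM: "\<psi> (s y') \<in> M" if "y' \<in> V" for y' using in_M[OF sW[OF that]] .
    obtain H k1 k2 N' u w where H: "2 * H = \<alpha> * ((n \<bullet> a) / (p \<bullet> a))" "H = (k1 + k2) / 2"
      and N': "(N has_derivative N') (at p within M)" "u \<in> tangent_plane M p" "w \<in> tangent_plane M p"
        "norm u = 1" "norm w = 1" "u \<bullet> w = 0" "- N' u = k1 *\<^sub>R u" "- N' w = k2 *\<^sub>R w"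
      using curv[OF ptM[OF y]] unfolding has_mean_curvature_def principal_curvatures_def p_def n_def by metis
    have dN: "((\<lambda>y. N (\<psi> (s y))) has_derivative (\<lambda>v. N' (T y v))) (at y)"
    proof -
      \<comment> \<open>\<open>N\<close> has a derivative within \<open>M\<close> only, so the chain
        rule is applied within the image of \<open>V\<close>, which is contained in
        \<open>M\<close>.\<close>
      have "(N has_derivative N') (at (\<psi> (s y)) within (\<lambda>y. \<psi> (s y)) ` V)"
        by (rule has_derivative_subset[OF N'(1)[unfolded p_def]]) (use ptM in blast)
      from has_derivative_in_compose[OF has_derivative_at_withinI[OF dpt[OF y]] this]
      show ?thesis using at_within_open[OF y V(1)] by simp
    qed
    have tr: "N' (T y (axis 1 1)) \<bullet> e1 + N' (T y (axis 2 1)) \<bullet> e2 = - (k1 + k2)"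
    proof (rule shape_operator_trace[OF f N'(4-6), where L = N' and n = n and ?t1.0 = "T y (axis 1 1)"
          and ?t2.0 = "T y (axis 2 1)"])
      show "n \<bullet> u = 0" "n \<bullet> w = 0" using gm N'(2,3) ptM[OF y] by (auto simp: gauss_map_def n_def p_def)
      show "n \<bullet> T y (axis 1 1) = 0" "n \<bullet> T y (axis 2 1) = 0"
        unfolding n_def p_def T_def by (rule normal_D[OF sW[OF y]])+
      show "linear N'" using N'(1) by (rule has_derivative_linear)
    qed (use N' Nb[OF y] in \<open>auto simp: T12[OF y] n_def p_def axis_def\<close>)
    define \<sigma> where "\<sigma> = sgn (n \<bullet> b)"
    have nb: "n \<bullet> b \<noteq> 0" using Nb[OF y] by (simp add: n_def p_def)
    define Y where "Y y = (1 / slope (G y)) *\<^sub>R G y" for y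
    define DY where "DY v = (1 / slope (G y)) *\<^sub>R G' y v - ((G y \<bullet> G' y v) / (slope (G y)) ^ 3) *\<^sub>R G y" for v
    have dY: "(Y has_derivative DY) (at y)"
      unfolding Y_def DY_def by (rule has_derivative_unit_gradient[OF dG[OF y]])
    have sl: "slope (G y') = 1 / \<bar>N (\<psi> (s y')) \<bullet> b\<bar>" if "y' \<in> V" for y'
      unfolding GN[OF that] by (rule slope_of_normal[OF f norm_N[OF sW[OF that]] Nb[OF that]])
    have cN: "continuous_on V (\<lambda>y. N (\<psi> (s y)) \<bullet> b)"
    proof -
      have "continuous_on W \<psi>" using d\<psi> by (meson has_derivative_continuous continuous_at_imp_continuous_on)
      moreover have "continuous_on M N" using gm by (simp add: gauss_map_def)
      ultimately have "continuous_on W (\<lambda>x. N (\<psi> x))"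
        by (intro continuous_on_compose2[of M N W \<psi>]) (use in_M in auto)
      then show ?thesis by (intro continuous_intros cc)
    qed
    \<comment> \<open>A neighbourhood on which \<open>N \<bullet> b\<close> keeps the sign \<sigma>.
      It resolves the absolute value in \<open>slope\<close>, so that the unit gradient equals
      \<open>- \<sigma>\<close> times the projection of \<open>N\<close>.\<close>
    define V1 where "V1 = V \<inter> (\<lambda>y. N (\<psi> (s y)) \<bullet> b) -` {t. 0 < \<sigma> * t}"
    have "open {t. 0 < \<sigma> * t}" by (intro open_Collect_less continuous_intros)
    then have oV1: "open V1" unfolding V1_def by (rule continuous_open_preimage[OF cN V(1)])
    have yV1: "y \<in> V1" using y nb by (simp add: V1_def \<sigma>_def n_def[symmetric] p_def[symmetric] sgn_mult_self_eq abs_sgn_eq linorder_neq_iff)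
       (auto simp: sgn_if)
    have YN: "Y y' $ 1 = - \<sigma> * (N (\<psi> (s y')) \<bullet> e1)" "Y y' $ 2 = - \<sigma> * (N (\<psi> (s y')) \<bullet> e2)" if "y' \<in> V1" for y'
    proof -
      have y'V: "y' \<in> V" and pos: "0 < \<sigma> * (N (\<psi> (s y')) \<bullet> b)" using that by (auto simp: V1_def)
      have "\<bar>N (\<psi> (s y')) \<bullet> b\<bar> = \<sigma> * (N (\<psi> (s y')) \<bullet> b)"
        using pos nb by (auto simp: \<sigma>_def sgn_if split: if_splits)
      then show "Y y' $ 1 = - \<sigma> * (N (\<psi> (s y')) \<bullet> e1)" "Y y' $ 2 = - \<sigma> * (N (\<psi> (s y')) \<bullet> e2)"
        using Nb[OF y'V] by (simp_all add: Y_def sl[OF y'V] G12 \<gamma>N[OF y'V])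
    qed
    have DYi: "DY v $ 1 = - \<sigma> * (N' (T y v) \<bullet> e1)" "DY v $ 2 = - \<sigma> * (N' (T y v) \<bullet> e2)" for v
    proof -
      have dYi: "((\<lambda>y. Y y $ i) has_derivative (\<lambda>v. DY v $ i)) (at y)" for i
        by (rule bounded_linear.has_derivative[OF bounded_linear_vec_nth dY])
      have dNe: "((\<lambda>y. - \<sigma> * (N (\<psi> (s y)) \<bullet> e)) has_derivative (\<lambda>v. - \<sigma> * (N' (T y v) \<bullet> e))) (at y)" for e
        by (intro has_derivative_mult_right has_derivative_inner_left dN)
      have "((\<lambda>y. Y y $ 1) has_derivative (\<lambda>v. - \<sigma> * (N' (T y v) \<bullet> e1))) (at y)"
        by (rule has_derivative_transform_within_open[OF dNe oV1 yV1]) (simp only: YN)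
      from has_derivative_unique[OF dYi this] show "DY v $ 1 = - \<sigma> * (N' (T y v) \<bullet> e1)" by metis
      have "((\<lambda>y. Y y $ 2) has_derivative (\<lambda>v. - \<sigma> * (N' (T y v) \<bullet> e2))) (at y)"
        by (rule has_derivative_transform_within_open[OF dNe oV1 yV1]) (simp only: YN)
      from has_derivative_unique[OF dYi this] show "DY v $ 2 = - \<sigma> * (N' (T y v) \<bullet> e2)" by metis
    qed
    have "mc_op (G' y) (G y) / (slope (G y)) ^ 3 = DY (axis 1 1) $ 1 + DY (axis 2 1) $ 2"
      unfolding DY_def by (rule div_unit_gradient[OF has_derivative_linear[OF dG[OF y]], symmetric])
    also have "\<dots> = - \<sigma> * (N' (T y (axis 1 1)) \<bullet> e1 + N' (T y (axis 2 1)) \<bullet> e2)"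
      unfolding DYi by (simp add: algebra_simps)
    also have "\<dots> = \<sigma> * (\<alpha> * ((n \<bullet> a) / (p \<bullet> a)))"
    proof -
      have kk: "\<alpha> * ((n \<bullet> a) / (p \<bullet> a)) = k1 + k2"
        unfolding H(1)[symmetric] H(2) by simp
      show ?thesis unfolding tr kk by (simp add: algebra_simps)
    qed
    finally have 1: "mc_op (G' y) (G y) = (slope (G y)) ^ 3 * (\<sigma> * (\<alpha> * ((n \<bullet> a) / (p \<bullet> a))))"
      using slope_nz[of "G y"] by (simp add: field_simps)
    \<comment> \<open>The second factor is the normal of the graph with \<open>b\<close>-component
      1. In this way \<open>n \<bullet> a\<close> becomes an expression in \<open>G\<close> for
      every position of \<open>a\<close> in the frame; both \<open>a = b\<close> and
      \<open>a = e2\<close> occur later.\<close>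
    have "n = (n \<bullet> b) *\<^sub>R (b - G y $ 1 *\<^sub>R e1 - G y $ 2 *\<^sub>R e2)"
      using frame_expand[OF f, of n] nb
      by (simp add: G12 \<gamma>N[OF y] n_def p_def algebra_simps)
    then have na: "n \<bullet> a = (n \<bullet> b) * ((b - G y $ 1 *\<^sub>R e1 - G y $ 2 *\<^sub>R e2) \<bullet> a)"
      by (metis inner_scaleR_left)
    have sn: "slope (G y) * (\<sigma> * (n \<bullet> b)) = 1"
      using nb by (simp add: sl[OF y] n_def[symmetric] p_def[symmetric] \<sigma>_def abs_sgn mult.commute sgn_eq_0_iff)
    have "mc_op (G' y) (G y) = (slope (G y) * (\<sigma> * (n \<bullet> b))) *
        (\<alpha> * ((b - G y $ 1 *\<^sub>R e1 - G y $ 2 *\<^sub>R e2) \<bullet> a) * (slope (G y))\<^sup>2 / (p \<bullet> a))"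
      unfolding 1 na by (simp add: power2_eq_square power3_eq_cube)
    then show ?thesis unfolding sn by (simp add: p_def)
  qed
  show ?thesis
    by (rule that[of V s G G']) (use V(1-3) sW ps Nb du dG cG' GN mc in auto)
qed

end

section \<open>Singular minimal graphs and their area\<close>

lemma graph_on_unique:
  assumes g: "graph_on {p. p \<bullet> a = c} a M" and a: "norm a = 1"
    and p: "p \<in> M" "p' \<in> M" "p - p' = t *\<^sub>R a"
  shows "p = p'"
proof -
  obtain D u where D: "D \<subseteq> {p. p \<bullet> a = c}" "M = {q + u q *\<^sub>R a | q. q \<in> D}"
    using g unfolding graph_on_def planar_domain_def by blast
  obtain q q' where q: "p = q + u q *\<^sub>R a" "p' = q' + u q' *\<^sub>R a" "q \<bullet> a = c" "q' \<bullet> a = c"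
    using p D by blast
  have aa: "a \<bullet> a = 1" using a by (simp add: norm_eq_1)
  have "(p - p') \<bullet> a = u q - u q'" using q aa by (simp add: inner_diff_left inner_add_left)
  then have "t = u q - u q'" using p(3) aa by simp
  then have "(q + u q *\<^sub>R a) - (q' + u q' *\<^sub>R a) = (u q - u q') *\<^sub>R a" using p(3) q(1,2) by simp
  then have "q = q'" by (simp add: algebra_simps)
  then show ?thesis using q by simp
qed

text \<open>The parameter of \<open>p\<close> is off the edge of the half-plane, since
  \<open>p\<close> would otherwise belong to \<open>surface_boundary M\<close>; the chart can thus
  be cut down to the open half-plane. The smaller image is open in the larger one by the
  homeomorphism, hence open in \<open>M\<close>.\<close>

lemma interior_chart_exists:
  assumes "smooth_surface M" "p \<in> M" "p \<notin> surface_boundary M" "gauss_map M N"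
  obtains W \<psi> x where "interior_chart M W \<psi> N" "x \<in> W" "\<psi> x = p"
proof -
  obtain W \<psi> where lp: "local_parametrization M W \<psi>" and pW: "p \<in> \<psi> ` (W \<inter> half_plane)"
    using assms(1,2) unfolding smooth_surface_def by blast
  then obtain x where x: "x \<in> W" "x \<in> half_plane" "p = \<psi> x" by blast
  have "x $ 2 \<noteq> 0"
  proof
    assume "x $ 2 = 0"
    then have "p \<in> surface_boundary M" unfolding surface_boundary_def using lp x by blast
    then show False using assms(3) by simp
  qed
  then have x2: "0 < x $ 2" using x by (simp add: half_plane_def)
  define W' where "W' = W \<inter> {x. 0 < x $ 2}"
  have oW: "open W" using lp by (simp add: local_parametrization_def)
  have oW': "open W'" unfolding W'_def
    using oW by (intro open_Int open_Collect_less continuous_intros)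
  have h: "W' \<inter> half_plane = W'" by (auto simp: W'_def half_plane_def)
  have sub: "W' \<subseteq> W \<inter> half_plane" by (auto simp: W'_def half_plane_def)
  have "Ck_on k f W' " if "Ck_on k f W" for k and f :: "real^2 \<Rightarrow> real^3"
    using that by (induction k arbitrary: f) (auto simp: W'_def intro: continuous_on_subset)
  then have sm: "smooth_on \<psi> W'" using lp by (simp add: local_parametrization_def smooth_on_def)
  obtain g where hom: "homeomorphism (W \<inter> half_plane) (\<psi> ` (W \<inter> half_plane)) \<psi> g"
    using lp by (auto simp: local_parametrization_def)
  have hom': "homeomorphism W' (\<psi> ` W') \<psi> g"
    by (rule homeomorphism_of_subsets[OF hom sub]) auto
  have "openin (top_of_set (W \<inter> half_plane)) W'"
    using oW' sub by (auto simp: openin_open intro!: exI[of _ W'])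
  then have "openin (top_of_set (\<psi> ` (W \<inter> half_plane))) (\<psi> ` W')"
    using homeomorphism_imp_open_map[OF hom] by blast
  moreover have "openin (top_of_set M) (\<psi> ` (W \<inter> half_plane))" using lp by (simp add: local_parametrization_def)
  ultimately have op: "openin (top_of_set M) (\<psi> ` W')" by (rule openin_trans)
  have "local_parametrization M W' \<psi>"
    unfolding local_parametrization_def h
    using oW' sm op hom' lp by (auto simp: local_parametrization_def W'_def half_plane_def)
  then have "interior_chart M W' \<psi> N" by unfold_locales (use assms in \<open>auto simp: W'_def\<close>)
  moreover have "x \<in> W'" using x x2 by (simp add: W'_def)
  ultimately show ?thesis using that x by blast
qed

text \<open>The equation is odd in the gradient, so a decreasing graph can be replaced by its
  negative.\<close>

lemma mc_op_uminus:
  assumes "linear B"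
  shows "mc_op (\<lambda>v. - B v) (- G) = - mc_op B G" "slope (- G) = slope G"
proof -
  have "rot (- G) = - rot G" by (simp add: rot_def vec_eq_iff forall_2)
  then show "mc_op (\<lambda>v. - B v) (- G) = - mc_op B G"
    using assms by (simp add: mc_op_def linear_neg)
  show "slope (- G) = slope G" by (simp add: slope_def)
qed

text \<open>The increments \<open>g (y + t e) - g y\<close> with \<open>t > 0\<close> are parametrized by a convex set and never vanish,
  so they all have the same sign.\<close>

lemma injective_imp_monotone:
  fixes g :: "real^2 \<Rightarrow> real"
  assumes V: "convex V" and cg: "continuous_on V g"
    and inj: "\<And>y t. y \<in> V \<Longrightarrow> 0 < t \<Longrightarrow> y + t *\<^sub>R e \<in> V \<Longrightarrow> g y \<noteq> g (y + t *\<^sub>R e)"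
  shows "(\<forall>y t. y \<in> V \<longrightarrow> 0 < t \<longrightarrow> y + t *\<^sub>R e \<in> V \<longrightarrow> g y < g (y + t *\<^sub>R e)) \<or>
    (\<forall>y t. y \<in> V \<longrightarrow> 0 < t \<longrightarrow> y + t *\<^sub>R e \<in> V \<longrightarrow> g (y + t *\<^sub>R e) < g y)"
proof (rule ccontr)
  assume neg: "\<not> ?thesis"
  define P where "P = {(y, t). y \<in> V \<and> 0 < t \<and> y + t *\<^sub>R e \<in> V}"
  define F where "F = (\<lambda>(y, t). g (y + t *\<^sub>R e) - g y)"
  have "convex P"
    unfolding convex_def
  proof (clarsimp simp: P_def)
    fix y t y' t' and u v :: real
    assume *: "y \<in> V" "0 < t" "y + t *\<^sub>R e \<in> V" "y' \<in> V" "0 < t'" "y' + t' *\<^sub>R e \<in> V" "0 \<le> u" "0 \<le> v" "u + v = 1"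
    have "u *\<^sub>R (y + t *\<^sub>R e) + v *\<^sub>R (y' + t' *\<^sub>R e) \<in> V" using * by (intro convexD[OF V]) auto
    moreover have "u *\<^sub>R y + v *\<^sub>R y' \<in> V" using * by (intro convexD[OF V]) auto
    moreover have "0 < u * t + v * t'"
      using * by (cases "u = 0") (auto intro!: add_pos_nonneg)
    ultimately show "u *\<^sub>R y + v *\<^sub>R y' \<in> V \<and> 0 < u * t + v * t' \<and> u *\<^sub>R y + v *\<^sub>R y' + (u * t + v * t') *\<^sub>R e \<in> V"
      by (simp add: algebra_simps)
  qed
  moreover have "continuous_on P F"
    unfolding F_def split_beta
    by (intro continuous_intros continuous_on_compose2[OF cg]) (auto simp: P_def)
  ultimately have conn: "connected (F ` P)"
    by (intro connected_continuous_image convex_connected)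
  obtain x x' where x: "x \<in> P" "\<not> 0 < F x" "x' \<in> P" "\<not> F x' < 0"
    using neg by (auto simp: P_def F_def)
  have "F x \<in> F ` P" "F x' \<in> F ` P" using x by auto
  then have "{F x..F x'} \<subseteq> F ` P" by (rule connected_contains_Icc[OF conn])
  moreover have "0 \<in> {F x..F x'}" using x by auto
  ultimately have "0 \<in> F ` P" by blast
  then obtain y t where "(y, t) \<in> P" "F (y, t) = 0" by auto
  then show False using inj[of y t] by (auto simp: P_def F_def)
qed

section \<open>Compact graphs: transversality and the height function\<close>

locale singular_graph =
  fixes \<alpha> c :: real and a e1 e2 :: "real^3" and M :: "(real^3) set" and N :: "real^3 \<Rightarrow> real^3"
  assumes \<alpha>: "\<alpha> < 0" and c: "0 < c" and cM: "compact M" and fr: "frame e1 e2 a"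
    and sm: "smooth_surface M" and pos: "\<And>p. p \<in> M \<Longrightarrow> 0 < p \<bullet> a" and gm: "gauss_map M N"
    and curv: "\<And>p. p \<in> M \<Longrightarrow> \<exists>H. has_mean_curvature M N p H \<and> 2 * H = \<alpha> * ((N p \<bullet> a) / (p \<bullet> a))"
    and gr: "graph_on {p. p \<bullet> a = c} a M" and bd: "surface_boundary M \<subseteq> {p. p \<bullet> a = c}"
begin

lemma norm_a: "norm a = 1"
  using frame_inner(3)[OF fr] by (simp add: norm_eq_1)

lemma chart:
  assumes "p \<in> M" "c < p \<bullet> a"
  obtains W \<psi> x where "interior_chart M W \<psi> N" "x \<in> W" "\<psi> x = p"
proof -
  have "p \<notin> surface_boundary M" using bd assms by auto
  then show ?thesis using interior_chart_exists[OF sm assms(1) _ gm] that by blast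
qed

lemma transversal:
  assumes p: "p \<in> M" "c < p \<bullet> a"
  shows "N p \<bullet> a \<noteq> 0"
proof
  assume vert: "N p \<bullet> a = 0"
  obtain W \<psi> x where ch: "interior_chart M W \<psi> N" and x: "x \<in> W" "\<psi> x = p" using chart[OF p] .
  interpret interior_chart M W \<psi> N by (rule ch)
  \<comment> \<open>With a horizontal normal at \<open>p\<close>, the surface is near
    \<open>p\<close> a graph in direction \<open>N p\<close> over the plane spanned by
    \<open>e\<close> and \<open>a\<close>. The order of the frame makes the second coordinate the
    height.\<close>
  define b where "b = N p"
  have nb: "norm b = 1" using norm_N[OF x(1)] x by (simp add: b_def)
  have bb: "b \<bullet> b = 1" using nb by (simp add: norm_eq_1)
  define e where "e = cross3 a b"
  have f: "frame e a b"
    unfolding e_def using frame_completion(2)[OF norm_a nb] vert by (simp add: b_def inner_commute)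
  have Nb: "N (\<psi> x) \<bullet> b \<noteq> 0" using bb by (simp add: x b_def)
  show False
  proof (rule local_graph[OF x(1) f Nb curv])
    fix V s G G'
    assume V: "open V" "proj e a (\<psi> x) \<in> V" "s (proj e a (\<psi> x)) = x"
      and sW: "\<And>y. y \<in> V \<Longrightarrow> s y \<in> W" and ps: "\<And>y. y \<in> V \<Longrightarrow> proj e a (\<psi> (s y)) = y"
      and "\<And>y. y \<in> V \<Longrightarrow> N (\<psi> (s y)) \<bullet> b \<noteq> 0"
      and dg: "\<And>y. y \<in> V \<Longrightarrow> ((\<lambda>y. \<psi> (s y) \<bullet> b) has_derivative (\<lambda>v. G y \<bullet> v)) (at y)"
      and dG: "\<And>y. y \<in> V \<Longrightarrow> (G has_derivative G' y) (at y)"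
      and cG': "\<And>v. continuous_on V (\<lambda>y. G' y v)"
      and GN: "\<And>y. y \<in> V \<Longrightarrow> G y = - (1 / (N (\<psi> (s y)) \<bullet> b)) *\<^sub>R proj e a (N (\<psi> (s y)))"
      and mc: "\<And>y. y \<in> V \<Longrightarrow> mc_op (G' y) (G y) =
         \<alpha> * ((b - G y $ 1 *\<^sub>R e - G y $ 2 *\<^sub>R a) \<bullet> a) * (slope (G y))\<^sup>2 / (\<psi> (s y) \<bullet> a)"
    define y0 where "y0 = proj e a p"
    have y0: "y0 \<in> V" "s y0 = x" using V x by (auto simp: y0_def)
    have G0: "G y0 $ 2 = 0" using GN[OF y0(1)] y0 x vert by (simp add: proj_nth)
    obtain \<rho> where \<rho>: "0 < \<rho>" "ball y0 \<rho> \<subseteq> V" using V(1) y0(1) openE by blast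
    have inV: "y \<in> V" if "y \<in> ball y0 \<rho>" for y using that \<rho> by blast
    define g where "g y = \<psi> (s y) \<bullet> b" for y
    have z: "\<psi> (s y) \<bullet> a = y $ 2" if "y \<in> V" for y using ps[OF that] proj_nth(2) by metis
    have zpos: "0 < y $ 2" if "y \<in> V" for y using pos[OF in_M[OF sW[OF that]]] z[OF that] by simp
    \<comment> \<open>\<open>b\<close> and \<open>e\<close> are orthogonal to \<open>a\<close>, so
      the normal of the graph paired with \<open>a\<close> is \<open>- G y $ 2\<close>.\<close>
    have eqn: "mc_op (G' y) (G y) = - \<alpha> * G y $ 2 * (slope (G y))\<^sup>2 / y $ 2" if "y \<in> V" for y
      unfolding mc[OF that] z[OF that] using frame_inner[OF f] by (simp add: inner_diff_left)
    have cg: "continuous_on (ball y0 \<rho>) g"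
      unfolding g_def using dg[OF inV] by (meson has_derivative_continuous continuous_at_imp_continuous_on)
    \<comment> \<open>Equal values of \<open>g\<close> would give two distinct points of
      \<open>M\<close> whose difference is a multiple of \<open>a\<close>.\<close>
    have inj: "g y \<noteq> g (y + t *\<^sub>R axis 2 1)" if y: "y \<in> ball y0 \<rho>" "0 < t" "y + t *\<^sub>R axis 2 1 \<in> ball y0 \<rho>" for y t
    proof
      assume eq: "g y = g (y + t *\<^sub>R axis 2 1)"
      let ?y = "y + t *\<^sub>R axis 2 1"
      note yV = inV[OF y(1)] and yV' = inV[OF y(3)]
      have "\<psi> (s ?y) - \<psi> (s y) = t *\<^sub>R a"
      proof (rule frame_eqI[OF f])
        show "(\<psi> (s ?y) - \<psi> (s y)) \<bullet> b = t *\<^sub>R a \<bullet> b" using eq frame_inner[OF f] by (simp add: g_def inner_diff_left)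
        show "(\<psi> (s ?y) - \<psi> (s y)) \<bullet> a = t *\<^sub>R a \<bullet> a" using z[OF yV] z[OF yV'] frame_inner[OF f] by (simp add: inner_diff_left)
        have "\<psi> (s w) \<bullet> e = w $ 1" if "w \<in> V" for w using ps[OF that] proj_nth(1) by metis
        then show "(\<psi> (s ?y) - \<psi> (s y)) \<bullet> e = t *\<^sub>R a \<bullet> e"
          using yV yV' frame_inner[OF f] by (simp add: inner_diff_left axis_def)
      qed
      then have "\<psi> (s ?y) = \<psi> (s y)"
        using graph_on_unique[OF gr norm_a in_M[OF sW[OF yV']] in_M[OF sW[OF yV]]] by blast
      then have "?y = y" using ps[OF yV] ps[OF yV'] by metis
      then show False using y(2) by (simp add: axis_eq_0_iff)
    qed
    have y0b: "y0 \<in> ball y0 \<rho>" using \<rho> by simp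
    consider "\<And>y t. y \<in> ball y0 \<rho> \<Longrightarrow> 0 < t \<Longrightarrow> y + t *\<^sub>R axis 2 1 \<in> ball y0 \<rho> \<Longrightarrow> g y < g (y + t *\<^sub>R axis 2 1)"
      | "\<And>y t. y \<in> ball y0 \<rho> \<Longrightarrow> 0 < t \<Longrightarrow> y + t *\<^sub>R axis 2 1 \<in> ball y0 \<rho> \<Longrightarrow> - g y < - g (y + t *\<^sub>R axis 2 1)"
      using injective_imp_monotone[OF convex_ball cg inj] by auto
    then show False
    proof cases
      case 1
      have "G y0 $ 2 \<noteq> 0"
      proof (rule hopf_monotone_graph[OF open_ball y0b \<alpha>, of g G G'])
        fix y assume "y \<in> ball y0 \<rho>"
        note y = inV[OF this]
        show "(g has_derivative (\<bullet>) (G y)) (at y)" unfolding g_def by (rule dg[OF y])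
        show "(G has_derivative G' y) (at y)" by (rule dG[OF y])
        show "mc_op (G' y) (G y) = - \<alpha> * G y $ 2 * (slope (G y))\<^sup>2 / y $ 2" by (rule eqn[OF y])
        show "0 < y $ 2" by (rule zpos[OF y])
      qed (use 1 in \<open>auto intro!: continuous_on_subset[OF cG' \<rho>(2)]\<close>)
      then show False using G0 by simp
    next
      case 2
      have "(- G y0) $ 2 \<noteq> 0"
      proof (rule hopf_monotone_graph[OF open_ball y0b \<alpha>, of "\<lambda>y. - g y" "\<lambda>y. - G y" "\<lambda>y v. - G' y v"])
        fix y assume "y \<in> ball y0 \<rho>"
        note y = inV[OF this]
        show "((\<lambda>y. - g y) has_derivative (\<bullet>) (- G y)) (at y)"
        proof -
          have eq: "(\<bullet>) (- G y) = (\<lambda>v. - (G y \<bullet> v))" by (simp add: fun_eq_iff)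
          show ?thesis unfolding g_def eq by (rule has_derivative_minus[OF dg[OF y]])
        qed
        show "((\<lambda>y. - G y) has_derivative (\<lambda>v. - G' y v)) (at y)"
          by (rule has_derivative_minus[OF dG[OF y]])
        show "mc_op (\<lambda>v. - G' y v) (- G y) = - \<alpha> * (- G y) $ 2 * (slope (- G y))\<^sup>2 / y $ 2"
          unfolding mc_op_uminus[OF has_derivative_linear[OF dG[OF y]]] eqn[OF y] by simp
        show "0 < y $ 2" by (rule zpos[OF y])
      qed (use 2 in \<open>auto intro!: continuous_intros continuous_on_subset[OF cG' \<rho>(2)]\<close>)
      then show False using G0 by simp
    qed
  qed
qed

definition lift :: "real^2 \<Rightarrow> real^3" where
  "lift q = inv_into M (proj e1 e2) q"

definition \<Omega> :: "(real^2) set" where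
  "\<Omega> = proj e1 e2 ` {p \<in> M. c < p \<bullet> a}"

definition u :: "real^2 \<Rightarrow> real" where
  "u q = lift q \<bullet> a"

text \<open>Taken from the normal at the lifted point, before \<open>u\<close> is known to be
  differentiable. It is independent of charts, and \<open>height_local\<close> identifies it with
  the gradient found in any of them.\<close>

definition G :: "real^2 \<Rightarrow> real^2" where
  "G q = - (1 / (N (lift q) \<bullet> a)) *\<^sub>R proj e1 e2 (N (lift q))"

lemma inj_proj: "inj_on (proj e1 e2) M"
proof (rule inj_onI)
  fix p p' assume p: "p \<in> M" "p' \<in> M" "proj e1 e2 p = proj e1 e2 p'"
  have "p \<bullet> e1 = p' \<bullet> e1" "p \<bullet> e2 = p' \<bullet> e2" using p(3) proj_nth by metis+
  then have z: "(p - p') \<bullet> e1 = 0" "(p - p') \<bullet> e2 = 0" by (simp_all add: inner_diff_left)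
  have "p - p' = ((p - p') \<bullet> a) *\<^sub>R a"
    using frame_expand[OF fr, of "p - p'"] unfolding z by (simp only: scaleR_zero_left add_0_left)
  then show "p = p'" using graph_on_unique[OF gr norm_a p(1,2)] by blast
qed

lemma lift_proj: "p \<in> M \<Longrightarrow> lift (proj e1 e2 p) = p"
  unfolding lift_def by (rule inv_into_f_f[OF inj_proj])

lemma cproj: "continuous_on A (proj e1 e2)"
  unfolding proj_def vector2_eq by (intro continuous_intros)

lemma clift: "continuous_on (proj e1 e2 ` M) lift"
  by (rule continuous_on_inv[OF cproj cM]) (simp add: lift_proj)

lemma \<Omega>_lift: "q \<in> \<Omega> \<Longrightarrow> lift q \<in> M \<and> c < u q \<and> proj e1 e2 (lift q) = q"
  by (auto simp: \<Omega>_def u_def lift_proj)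

lemma height_local:
  assumes q: "q \<in> \<Omega>"
  obtains V G' where "open V" "q \<in> V" "V \<subseteq> \<Omega>"
    "\<forall>y\<in>V. (u has_derivative (\<lambda>v. G y \<bullet> v)) (at y)"
    "\<forall>y\<in>V. (G has_derivative G' y) (at y)"
    "\<forall>y\<in>V. mc_op (G' y) (G y) = \<alpha> * (slope (G y))\<^sup>2 / u y"
    "\<forall>v. continuous_on V (\<lambda>y. G' y v)"
proof -
  define p where "p = lift q"
  have p: "p \<in> M" "c < p \<bullet> a" "proj e1 e2 p = q" using \<Omega>_lift[OF q] by (auto simp: p_def u_def)
  obtain W \<psi> x where ch: "interior_chart M W \<psi> N" and x: "x \<in> W" "\<psi> x = p" using chart[OF p(1,2)] .
  interpret ch: interior_chart M W \<psi> N by (rule ch)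
  have Nb: "N (\<psi> x) \<bullet> a \<noteq> 0" using transversal[OF p(1,2)] x by simp
  show ?thesis
  proof (rule ch.local_graph[OF x(1) fr Nb curv])
    fix V s H H'
    assume V: "open V" "proj e1 e2 (\<psi> x) \<in> V" "s (proj e1 e2 (\<psi> x)) = x"
      and sW: "\<And>y. y \<in> V \<Longrightarrow> s y \<in> W" and ps: "\<And>y. y \<in> V \<Longrightarrow> proj e1 e2 (\<psi> (s y)) = y"
      and "\<And>y. y \<in> V \<Longrightarrow> N (\<psi> (s y)) \<bullet> a \<noteq> 0"
      and dg: "\<And>y. y \<in> V \<Longrightarrow> ((\<lambda>y. \<psi> (s y) \<bullet> a) has_derivative (\<lambda>v. H y \<bullet> v)) (at y)"
      and dH: "\<And>y. y \<in> V \<Longrightarrow> (H has_derivative H' y) (at y)"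
      and cH': "\<And>v. continuous_on V (\<lambda>y. H' y v)"
      and HN: "\<And>y. y \<in> V \<Longrightarrow> H y = - (1 / (N (\<psi> (s y)) \<bullet> a)) *\<^sub>R proj e1 e2 (N (\<psi> (s y)))"
      and mc: "\<And>y. y \<in> V \<Longrightarrow> mc_op (H' y) (H y) =
         \<alpha> * ((a - H y $ 1 *\<^sub>R e1 - H y $ 2 *\<^sub>R e2) \<bullet> a) * (slope (H y))\<^sup>2 / (\<psi> (s y) \<bullet> a)"
    have lift_eq: "lift y = \<psi> (s y)" if "y \<in> V" for y
      using lift_proj[OF ch.in_M[OF sW[OF that]]] ps[OF that] by simp
    define V1 where "V1 = V \<inter> (\<lambda>y. \<psi> (s y) \<bullet> a) -` {c<..}"
    have cg: "continuous_on V (\<lambda>y. \<psi> (s y) \<bullet> a)"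
      using dg by (meson has_derivative_continuous continuous_at_imp_continuous_on)
    have oV1: "open V1" unfolding V1_def by (rule continuous_open_preimage[OF cg V(1)]) simp
    have qV1: "q \<in> V1" using V p x by (auto simp: V1_def)
    have V1: "y \<in> V" "c < \<psi> (s y) \<bullet> a" if "y \<in> V1" for y using that by (auto simp: V1_def)
    have GH: "G y = H y" "u y = \<psi> (s y) \<bullet> a" if "y \<in> V1" for y
      using HN[OF V1(1)[OF that]] lift_eq[OF V1(1)[OF that]] by (simp_all add: G_def u_def)
    show ?thesis
    proof (rule that[of V1 H']; (intro ballI allI)?)
      show "V1 \<subseteq> \<Omega>"
      proof
        fix y assume y: "y \<in> V1"
        then show "y \<in> \<Omega>" unfolding \<Omega>_def using ps[OF V1(1)[OF y]] V1[OF y] ch.in_M[OF sW[OF V1(1)[OF y]]]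
          by (intro image_eqI[of _ _ "\<psi> (s y)"]) auto
      qed
    next
      fix y assume y: "y \<in> V1"
      show "(u has_derivative (\<bullet>) (G y)) (at y)"
        unfolding GH(1)[OF y]
        by (rule has_derivative_transform_within_open[OF dg[OF V1(1)[OF y]] oV1 y]) (simp add: GH)
      show "(G has_derivative H' y) (at y)"
        by (rule has_derivative_transform_within_open[OF dH[OF V1(1)[OF y]] oV1 y]) (simp add: GH)
      show "mc_op (H' y) (G y) = \<alpha> * (slope (G y))\<^sup>2 / u y"
        unfolding GH[OF y] mc[OF V1(1)[OF y]] using frame_inner[OF fr] by (simp add: inner_diff_left)
    next
      show "continuous_on V1 (\<lambda>y. H' y v)" for v
        by (rule continuous_on_subset[OF cH']) (auto simp: V1_def)
    qed (use oV1 qV1 in auto)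
  qed
qed

lemma superlevel: "{q \<in> \<Omega>. t \<le> u q} = proj e1 e2 ` {p \<in> M. t \<le> p \<bullet> a}" if "c < t" for t
proof
  show "{q \<in> \<Omega>. t \<le> u q} \<subseteq> proj e1 e2 ` {p \<in> M. t \<le> p \<bullet> a}"
    by (auto simp: \<Omega>_def u_def lift_proj)
  show "proj e1 e2 ` {p \<in> M. t \<le> p \<bullet> a} \<subseteq> {q \<in> \<Omega>. t \<le> u q}"
    using that by (auto simp: \<Omega>_def u_def lift_proj)
qed

lemma compact_superlevel: "compact {p \<in> M. t \<le> p \<bullet> a}"
proof -
  have "{p \<in> M. t \<le> p \<bullet> a} = M \<inter> {p. t \<le> p \<bullet> a}" by auto
  moreover have "closed {p. t \<le> p \<bullet> a}" by (intro closed_Collect_le continuous_intros)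
  ultimately show ?thesis using cM by (simp add: compact_Int_closed)
qed

text \<open>In \<open>height_local\<close> the derivative of \<open>G\<close> is named locally;
  \<open>frechet_derivative\<close> gives it one name on all of \<Omega>.\<close>

sublocale singular_height \<Omega> u G "\<lambda>q. frechet_derivative G (at q)" \<alpha> c
proof
  show "open \<Omega>"
  proof (rule Topological_Spaces.openI)
    fix q assume q: "q \<in> \<Omega>"
    obtain V G' where "open V" "q \<in> V" "V \<subseteq> \<Omega>"
      "\<forall>y\<in>V. (u has_derivative (\<lambda>v. G y \<bullet> v)) (at y)"
      "\<forall>y\<in>V. (G has_derivative G' y) (at y)"
      "\<forall>y\<in>V. mc_op (G' y) (G y) = \<alpha> * (slope (G y))\<^sup>2 / u y"
      "\<forall>v. continuous_on V (\<lambda>y. G' y v)" using height_local[OF q] .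
    then show "\<exists>T. open T \<and> q \<in> T \<and> T \<subseteq> \<Omega>" by blast
  qed
  fix q assume q: "q \<in> \<Omega>"
  obtain V G' where V: "open V" "q \<in> V" "V \<subseteq> \<Omega>"
    "\<forall>y\<in>V. (u has_derivative (\<lambda>v. G y \<bullet> v)) (at y)"
    "\<forall>y\<in>V. (G has_derivative G' y) (at y)"
    "\<forall>y\<in>V. mc_op (G' y) (G y) = \<alpha> * (slope (G y))\<^sup>2 / u y"
    "\<forall>v. continuous_on V (\<lambda>y. G' y v)" using height_local[OF q] .
  show "(u has_derivative (\<bullet>) (G q)) (at q)" using bspec[OF V(4) V(2)] .
  have G': "frechet_derivative G (at q) = G' q" using frechet_derivative_at[OF bspec[OF V(5) V(2)]] by simp
  show "(G has_derivative frechet_derivative G (at q)) (at q)" unfolding G' by (rule bspec[OF V(5) V(2)])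
  show "mc_op (frechet_derivative G (at q)) (G q) = \<alpha> * (slope (G q))\<^sup>2 / u q" unfolding G' by (rule bspec[OF V(6) V(2)])
  show "c < u q" using \<Omega>_lift[OF q] by simp
next
  fix v
  show "continuous_on \<Omega> (\<lambda>q. frechet_derivative G (at q) v)"
    unfolding continuous_on_eq_continuous_within
  proof
    fix q assume q: "q \<in> \<Omega>"
    obtain V G' where V: "open V" "q \<in> V" "V \<subseteq> \<Omega>"
      "\<forall>y\<in>V. (u has_derivative (\<lambda>v. G y \<bullet> v)) (at y)"
      "\<forall>y\<in>V. (G has_derivative G' y) (at y)"
      "\<forall>y\<in>V. mc_op (G' y) (G y) = \<alpha> * (slope (G y))\<^sup>2 / u y"
      "\<forall>v. continuous_on V (\<lambda>y. G' y v)" using height_local[OF q] .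
    have "continuous_on V (\<lambda>q. frechet_derivative G (at q) v)"
      by (rule continuous_on_eq[OF V(7)[rule_format]]) (simp add: frechet_derivative_at[OF bspec[OF V(5)], symmetric])
    then show "continuous (at q within \<Omega>) (\<lambda>q. frechet_derivative G (at q) v)"
      using V(1,2) by (simp add: continuous_on_eq_continuous_at continuous_at_imp_continuous_at_within)
  qed
next
  show "compact {q \<in> \<Omega>. t \<le> u q}" if "c < t" for t
    unfolding superlevel[OF that] by (intro compact_continuous_image cproj compact_superlevel)
qed (use c \<alpha> in auto)

end

section \<open>The area of the part above a level\<close>

lemma borel_vimage_continuous_on:
  assumes "A \<in> sets borel" "continuous_on A f" "B \<in> sets borel"
  shows "A \<inter> f -` B \<in> sets borel"
proof -
  have "f -` B \<inter> space (restrict_space borel A) \<in> sets (restrict_space borel A)"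
    by (rule measurable_sets[OF borel_measurable_continuous_on_restrict[OF assms(2)] assms(3)])
  then show ?thesis using assms(1) by (simp add: sets_restrict_space_iff space_restrict_space Int_commute)
qed

lemma integral_change_of_variables_scalar:
  fixes f :: "real^2 \<Rightarrow> real" and g :: "real^2 \<Rightarrow> real^2"
  assumes "S \<in> sets lebesgue" "\<And>x. x \<in> S \<Longrightarrow> (g has_derivative g' x) (at x within S)" "inj_on g S"
    and f: "f absolutely_integrable_on g ` S"
  shows "((\<lambda>x. \<bar>det (matrix (g' x))\<bar> * f (g x)) has_integral integral (g ` S) f) S"
proof -
  have "(\<lambda>x. vec (f x) :: real^1) absolutely_integrable_on g ` S \<and>
      integral (g ` S) (\<lambda>x. vec (f x) :: real^1) = vec (integral (g ` S) f)"
    using f by (simp add: absolutely_integrable_on_1_iff integral_on_1_eq)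
  from iffD2[OF has_absolute_integral_change_of_variables[OF assms(1-3)] this]
  show ?thesis
    by (simp add: absolutely_integrable_on_1_iff integral_on_1_eq vec_eq_iff has_integral_iff set_lebesgue_integral_eq_integral)
qed

context singular_graph
begin

lemma superlevel_integrable:
  assumes t: "c < t" and B: "B \<in> sets borel" "B \<subseteq> {q \<in> \<Omega>. t \<le> u q}"
  shows "(\<lambda>q. slope (G q)) absolutely_integrable_on B"
proof -
  let ?K = "{q \<in> \<Omega>. t \<le> u q}"
  have "integrable lborel (\<lambda>q. indicator ?K q *\<^sub>R slope (G q))"
    by (rule borel_integrable_compact[OF cpt[OF t]]) (auto intro: continuous_on_subset[OF cslope])
  then have "(\<lambda>q. slope (G q)) absolutely_integrable_on ?K"
    unfolding set_integrable_def by (subst integrable_completion) (auto dest: borel_measurable_integrable)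
  then show ?thesis by (rule set_integrable_subset) (use B in auto)
qed

text \<open>The projection has the continuous inverse \<open>lift\<close> on the image of the
  compact set \<open>M\<close>, so the image of a Borel set is a preimage under
  \<open>lift\<close>.\<close>

lemma borel_proj_image:
  assumes "B \<in> sets borel" "B \<subseteq> M"
  shows "proj e1 e2 ` B \<in> sets borel"
proof -
  have "closed (proj e1 e2 ` M)"
    by (intro compact_imp_closed compact_continuous_image cproj cM)
  then have "proj e1 e2 ` M \<inter> lift -` B \<in> sets borel"
    by (intro borel_vimage_continuous_on clift assms) simp
  moreover have "proj e1 e2 ` M \<inter> lift -` B = proj e1 e2 ` B"
    using assms(2) by (auto simp: lift_proj subset_eq) 
  ultimately show ?thesis by simp
qed

text \<open>The Jacobian of the projected parametrization is the \<open>a\<close>-component of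
  \<nu>, and \<open>slope\<close> is the reciprocal of that component of the unit normal. Their
  product is the area element \<open>norm \<nu>\<close>, and the claim is a change of
  variables.\<close>

lemma piece_area:
  assumes ch: "interior_chart M W \<psi> N" and t: "c < t"
    and B: "B \<in> sets borel" "B \<subseteq> \<psi> ` W" "B \<subseteq> {p \<in> M. t \<le> p \<bullet> a}"
  defines "K \<equiv> W \<inter> \<psi> -` B"
  shows "K \<in> sets borel" "\<psi> ` K = B"
    "parametrized_area \<psi> K = ennreal (integral (proj e1 e2 ` B) (\<lambda>q. slope (G q)))"
proof -
  interpret ch: interior_chart M W \<psi> N by (rule ch)
  have c\<psi>: "continuous_on W \<psi>"
    using ch.d\<psi> by (meson has_derivative_continuous continuous_at_imp_continuous_on)
  show K: "K \<in> sets borel"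
    unfolding K_def using ch.op by (intro borel_vimage_continuous_on c\<psi> B(1)) simp
  show im: "\<psi> ` K = B" using B(2) by (auto simp: K_def)
  have inj\<psi>: "inj_on \<psi> W"
    using ch.lp unfolding local_parametrization_def ch.half homeomorphism_def by (metis inj_on_inverseI)
  let ?g = "\<lambda>x. proj e1 e2 (\<psi> x)"
  have im': "?g ` K = proj e1 e2 ` B" by (simp add: im[symmetric] image_image)
  have KW: "K \<subseteq> W" by (simp add: K_def)
  have "((\<lambda>x. \<bar>det (matrix (\<lambda>v. proj e1 e2 (ch.D x v)))\<bar> * slope (G (?g x))) has_integral
      integral (?g ` K) (\<lambda>q. slope (G q))) K"
  proof (rule integral_change_of_variables_scalar)
    show "K \<in> sets lebesgue" using K by simp
    show "(?g has_derivative (\<lambda>v. proj e1 e2 (ch.D x v))) (at x within K)" if "x \<in> K" for x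
      using ch.d_proj[of x] that KW by (auto intro: has_derivative_at_withinI)
    have "inj_on (proj e1 e2 \<circ> \<psi>) K"
      using KW ch.in_M by (intro comp_inj_on inj_on_subset[OF inj\<psi>] inj_on_subset[OF inj_proj]) auto
    then show "inj_on ?g K" by (simp add: o_def)
    show "(\<lambda>q. slope (G q)) absolutely_integrable_on ?g ` K"
      unfolding im' using B(3) superlevel[OF t]
      by (intro superlevel_integrable[OF t] borel_proj_image B(1)) auto
  qed
  moreover have "\<bar>det (matrix (\<lambda>v. proj e1 e2 (ch.D x v)))\<bar> * slope (G (?g x)) = norm (ch.\<nu> x)" if x: "x \<in> K" for x
  proof -
    have xW: "x \<in> W" using x KW by auto
    have "\<psi> x \<in> B" using x by (simp add: K_def)
    then have p: "\<psi> x \<in> M" "c < \<psi> x \<bullet> a" using B(3) t by auto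
    have d: "det (matrix (\<lambda>v. proj e1 e2 (ch.D x v))) = ch.\<nu> x \<bullet> a"
      by (simp add: det_2 matrix_def proj_nth ch.\<nu>_def inner_cross_frame[OF fr] mult.commute)
    have s: "slope (G (?g x)) = 1 / \<bar>N (\<psi> x) \<bullet> a\<bar>"
      unfolding G_def lift_proj[OF p(1)] by (rule slope_of_normal[OF fr ch.norm_N[OF xW] transversal[OF p]])
    have "norm (ch.\<nu> x) = \<bar>N (\<psi> x) \<bullet> ch.\<nu> x\<bar>"
      by (subst ch.N_eq(1)[OF xW]) (simp add: ch.norm_N[OF xW])
    then show ?thesis
      unfolding d s using ch.\<nu>_inner[OF xW, of a] transversal[OF p] by (simp add: abs_mult)
  qed
  ultimately have "((\<lambda>x. norm (ch.\<nu> x)) has_integral integral (?g ` K) (\<lambda>q. slope (G q))) K"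
    by (rule has_integral_eq[rotated])
  then have "(\<integral>\<^sup>+x. ennreal (norm (ch.\<nu> x)) * indicator K x \<partial>lborel) = ennreal (integral (?g ` K) (\<lambda>q. slope (G q)))"
    by (intro nn_integral_has_integral_lebesgue') auto
  then show "parametrized_area \<psi> K = ennreal (integral (proj e1 e2 ` B) (\<lambda>q. slope (G q)))"
    unfolding im' parametrized_area_def ch.\<nu>_def ch.D_def .
qed

text \<open>Induction on the charts. The image of a chart is the trace on \<open>M\<close> of an
  open set \<open>T\<close> of space, so \<open>B \<inter> T\<close> and \<open>B - T\<close> remain
  Borel; the former is one piece, the latter is left to the other charts. Recording the union of the
  pieces makes disjointness available in the next step.\<close>

lemma disjoint_pieces_cover:
  assumes t: "c < t" and fin: "finite \<C>" and ch: "\<And>W \<psi>. (W, \<psi>) \<in> \<C> \<Longrightarrow> interior_chart M W \<psi> N"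
    and B: "B \<in> sets borel" "B \<subseteq> {p \<in> M. t \<le> p \<bullet> a}" "B \<subseteq> (\<Union>(W, \<psi>)\<in>\<C>. \<psi> ` W)"
  shows "\<exists>F. disjoint_pieces M F \<and> (\<Union>(\<psi>, K)\<in>F. \<psi> ` K) = B \<and>
    (\<Sum>(\<psi>, K)\<in>F. parametrized_area \<psi> K) = ennreal (integral (proj e1 e2 ` B) (\<lambda>q. slope (G q)))"
  using fin ch B
proof (induction \<C> arbitrary: B rule: finite_induct)
  case empty
  then show ?case by (intro exI[of _ "{}"]) (auto simp: disjoint_pieces_def)
next
  case (insert X \<C>)
  obtain W \<psi> where X: "X = (W, \<psi>)" by (cases X)
  have ch: "interior_chart M W \<psi> N" using insert.prems(1) X by simp
  interpret ch: interior_chart M W \<psi> N by (rule ch)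
  have "openin (top_of_set M) (\<psi> ` W)" using ch.lp ch.half by (simp add: local_parametrization_def)
  then obtain T where T: "open T" "\<psi> ` W = M \<inter> T" by (auto simp: openin_open)
  define B1 where "B1 = B \<inter> T"
  define B2 where "B2 = B - T"
  have BM: "B \<subseteq> M" using insert.prems(3) by auto
  have B1: "B1 \<in> sets borel" "B1 \<subseteq> \<psi> ` W" "B1 \<subseteq> {p \<in> M. t \<le> p \<bullet> a}"
    using insert.prems T BM by (auto simp: B1_def)
  have B2: "B2 \<in> sets borel" "B2 \<subseteq> {p \<in> M. t \<le> p \<bullet> a}" "B2 \<subseteq> (\<Union>(W, \<psi>)\<in>\<C>. \<psi> ` W)"
    using insert.prems(2,3) T by (auto simp: B2_def) (use insert.prems(4) X T in blast)
  obtain F where F: "disjoint_pieces M F" "(\<Union>(\<psi>, K)\<in>F. \<psi> ` K) = B2"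
    "(\<Sum>(\<psi>, K)\<in>F. parametrized_area \<psi> K) = ennreal (integral (proj e1 e2 ` B2) (\<lambda>q. slope (G q)))"
    using insert.IH[OF insert.prems(1) B2] by auto
  show ?case
  \<comment> \<open>Pieces are collected in a set, so the sum splits only if the new pair is not in
    \<open>F\<close>; for nonempty \<open>B1\<close> this follows from disjointness.\<close>
  proof (cases "B1 = {}")
    case True
    then have "B2 = B" by (auto simp: B1_def B2_def)
    then show ?thesis using F by auto
  next
    case False
    define K where "K = W \<inter> \<psi> -` B1"
    note K = piece_area[OF ch t B1, folded K_def]
    have sub: "\<psi>' ` K' \<subseteq> B2" if "(\<psi>', K') \<in> F" for \<psi>' K' using F(2) that by auto
    have disj: "B1 \<inter> B2 = {}" by (auto simp: B1_def B2_def)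
    have nin: "(\<psi>, K) \<notin> F" using sub[of \<psi> K] K(2) disj False by auto
    have "disjoint_pieces M (insert (\<psi>, K) F)"
      unfolding disjoint_pieces_def
    proof (intro conjI)
      show "finite (insert (\<psi>, K) F)" using F(1) by (simp add: disjoint_pieces_def)
      show "\<forall>(\<psi>, K)\<in>insert (\<psi>, K) F. K \<in> sets borel \<and> (\<exists>W. local_parametrization M W \<psi> \<and> K \<subseteq> W \<inter> half_plane)"
        using F(1) K(1) ch.lp ch.half by (auto simp: disjoint_pieces_def K_def)
      show "pairwise (\<lambda>(\<psi>, K) (\<psi>', K'). disjnt (\<psi> ` K) (\<psi>' ` K')) (insert (\<psi>, K) F)"
        using F(1) sub disj K(2) unfolding disjoint_pieces_def pairwise_insert disjnt_def by fastforce
    qed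
    moreover have "(\<Union>(\<psi>, K)\<in>insert (\<psi>, K) F. \<psi> ` K) = B"
      using F(2) K(2) by (auto simp: B1_def B2_def)
    moreover have "(\<Sum>(\<psi>, K)\<in>insert (\<psi>, K) F. parametrized_area \<psi> K) = ennreal (integral (proj e1 e2 ` B) (\<lambda>q. slope (G q)))"
    proof -
      have int: "(\<lambda>q. slope (G q)) integrable_on proj e1 e2 ` C" if "C \<in> sets borel" "C \<subseteq> {p \<in> M. t \<le> p \<bullet> a}" for C
        using superlevel_integrable[OF t, of "proj e1 e2 ` C"] borel_proj_image[of C] that superlevel[OF t]
        by (auto intro: set_lebesgue_integral_eq_integral(1))
      have "proj e1 e2 ` B1 \<inter> proj e1 e2 ` B2 = {}"
        using inj_on_image_Int[OF inj_proj, of B1 B2] B1(3) B2(2) disj by auto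
      then have "((\<lambda>q. slope (G q)) has_integral integral (proj e1 e2 ` B1) (\<lambda>q. slope (G q))
          + integral (proj e1 e2 ` B2) (\<lambda>q. slope (G q))) (proj e1 e2 ` B1 \<union> proj e1 e2 ` B2)"
        using int[OF B1(1,3)] int[OF B2(1,2)] by (intro has_integral_Un integrable_integral) auto
      moreover have "proj e1 e2 ` B1 \<union> proj e1 e2 ` B2 = proj e1 e2 ` B" by (auto simp: B1_def B2_def)
      ultimately have "integral (proj e1 e2 ` B) (\<lambda>q. slope (G q)) =
          integral (proj e1 e2 ` B1) (\<lambda>q. slope (G q)) + integral (proj e1 e2 ` B2) (\<lambda>q. slope (G q))"
        by (simp add: integral_unique)
      moreover have "0 \<le> integral (proj e1 e2 ` C) (\<lambda>q. slope (G q))" if "C \<in> sets borel" "C \<subseteq> {p \<in> M. t \<le> p \<bullet> a}" for C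
        using int[OF that] slope_pos by (intro integral_nonneg) (auto intro: less_imp_le)
      ultimately show ?thesis
        using F(1) F(3) K(3) nin B1 B2 by (simp add: disjoint_pieces_def ennreal_plus)
    qed
    ultimately show ?thesis by blast
  qed
qed

text \<open>Finitely many interior charts cover the compact part at or above \<open>t\<close>, and
  cutting it along them yields one competitor in the supremum.\<close>

lemma area_ge_integral:
  assumes t: "c < t"
  shows "ennreal (integral {q \<in> \<Omega>. t \<le> u q} (\<lambda>q. slope (G q))) \<le> surface_area M"
proof -
  let ?K = "{p \<in> M. t \<le> p \<bullet> a}"
  have "\<exists>X. interior_chart M (fst X) (fst (snd X)) N \<and> p \<in> snd (snd X) \<and> open (snd (snd X))
      \<and> fst (snd X) ` fst X = M \<inter> snd (snd X)" if p: "p \<in> ?K" for p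
  proof -
    have "p \<in> M" "c < p \<bullet> a" using p t by auto
    then obtain W \<psi> x where ch: "interior_chart M W \<psi> N" and x: "x \<in> W" "\<psi> x = p" by (rule chart)
    interpret ch: interior_chart M W \<psi> N by (rule ch)
    have "openin (top_of_set M) (\<psi> ` W)" using ch.lp ch.half by (simp add: local_parametrization_def)
    then obtain T where "open T" "\<psi> ` W = M \<inter> T" by (auto simp: openin_open)
    then show ?thesis using ch x by (intro exI[of _ "(W, \<psi>, T)"]) auto
  qed
  then have "\<forall>p\<in>?K. \<exists>X. interior_chart M (fst X) (fst (snd X)) N \<and> p \<in> snd (snd X) \<and> open (snd (snd X))
      \<and> fst (snd X) ` fst X = M \<inter> snd (snd X)" by (intro ballI)
  then obtain X where X': "\<forall>p\<in>?K. interior_chart M (fst (X p)) (fst (snd (X p))) N \<and> p \<in> snd (snd (X p))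
      \<and> open (snd (snd (X p))) \<and> fst (snd (X p)) ` fst (X p) = M \<inter> snd (snd (X p))"
    unfolding bchoice_iff by (elim exE)
  have X: "interior_chart M (fst (X p)) (fst (snd (X p))) N" "p \<in> snd (snd (X p))" "open (snd (snd (X p)))"
    "fst (snd (X p)) ` fst (X p) = M \<inter> snd (snd (X p))" if "p \<in> ?K" for p
    using bspec[OF X' that] by simp_all
  obtain C where C: "C \<subseteq> ?K" "finite C" "?K \<subseteq> (\<Union>p\<in>C. snd (snd (X p)))"
    by (rule compactE_image[OF compact_superlevel, of ?K "\<lambda>p. snd (snd (X p))"]) (use X in auto)
  define \<C> where "\<C> = (\<lambda>p. (fst (X p), fst (snd (X p)))) ` C"
  have "\<exists>F. disjoint_pieces M F \<and> (\<Union>(\<psi>, K)\<in>F. \<psi> ` K) = ?K \<and>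
    (\<Sum>(\<psi>, K)\<in>F. parametrized_area \<psi> K) = ennreal (integral (proj e1 e2 ` ?K) (\<lambda>q. slope (G q)))"
  proof (rule disjoint_pieces_cover[OF t, of \<C>])
    show "finite \<C>" using C by (simp add: \<C>_def)
    show "interior_chart M W \<psi> N" if "(W, \<psi>) \<in> \<C>" for W \<psi> using that X(1) C(1) by (auto simp: \<C>_def)
    show "?K \<in> sets borel" using compact_imp_closed[OF compact_superlevel] by simp
    show "?K \<subseteq> (\<Union>(W, \<psi>)\<in>\<C>. \<psi> ` W)"
    proof
      fix p assume p: "p \<in> ?K"
      then obtain p' where p': "p' \<in> C" "p \<in> snd (snd (X p'))" using C(3) by blast
      then have "p \<in> fst (snd (X p')) ` fst (X p')" using X(4)[of p'] C(1) p by auto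
      then show "p \<in> (\<Union>(W, \<psi>)\<in>\<C>. \<psi> ` W)" using p'(1) by (auto simp: \<C>_def)
    qed
  qed simp
  then obtain F where F: "disjoint_pieces M F"
    "(\<Sum>(\<psi>, K)\<in>F. parametrized_area \<psi> K) = ennreal (integral {q \<in> \<Omega>. t \<le> u q} (\<lambda>q. slope (G q)))"
    unfolding superlevel[OF t] by blast
  show ?thesis unfolding surface_area_def F(2)[symmetric] using F(1) by (intro SUP_upper) simp
qed

text \<open>The integral of \<open>slope\<close> over the superlevel set is a suitable
  \<open>A\<close> in \<open>height_bound\<close>, since it dominates all weights with values in
  \<open>[0, 1]\<close> that vanish up to \<open>t\<close>.\<close>

lemma area_ge:
  assumes h: "c < t" "t < T" "T < h" and p: "p \<in> M" "p \<bullet> a = h"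
  shows "ennreal (- (2 * pi / \<alpha>) * (T\<^sup>2 - t\<^sup>2)) \<le> surface_area M"
proof -
  let ?B = "{q \<in> \<Omega>. t \<le> u q}"
  define A where "A = integral ?B (\<lambda>q. slope (G q))"
  have x0: "proj e1 e2 p \<in> \<Omega>" "u (proj e1 e2 p) = h"
    using p h by (auto simp: \<Omega>_def u_def lift_proj)
  have iB: "(\<lambda>q. slope (G q)) integrable_on ?B"
    using superlevel_integrable[OF h(1), of ?B] compact_imp_closed[OF cpt[OF h(1)]]
    by (auto intro: set_lebesgue_integral_eq_integral(1))
  have "2 * pi * (T\<^sup>2 - t\<^sup>2) \<le> - \<alpha> * A"
  proof (rule height_bound[OF h(1,2) _ x0(1)])
    show "T < u (proj e1 e2 p)" using x0 h by simp
    fix \<psi> :: "real \<Rightarrow> real"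
    assume \<psi>: "continuous_on UNIV \<psi>" "\<And>s. 0 \<le> \<psi> s \<and> \<psi> s \<le> 1" "\<And>s. s \<le> t \<Longrightarrow> \<psi> s = 0"
    have "adm (\<lambda>x. \<psi> (u x))" by (rule adm_comp[OF \<psi>(1) h(1) \<psi>(3)])
    then have "adm (\<lambda>x. \<psi> (u x) * slope (G x))"
      unfolding adm_def by (auto intro!: continuous_intros cslope)
    then have "E (\<lambda>x. \<psi> (u x) * slope (G x)) \<le> integral UNIV (\<lambda>x. if x \<in> ?B then slope (G x) else 0)"
      unfolding E_def
    proof (intro integral_le adm_int)
      show "(\<lambda>x. if x \<in> ?B then slope (G x) else 0) integrable_on UNIV"
        using iB by (simp only: integrable_restrict_UNIV)
      show "(if x \<in> \<Omega> then \<psi> (u x) * slope (G x) else 0) \<le> (if x \<in> ?B then slope (G x) else 0)" for x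
        using \<psi>(2)[of "u x"] \<psi>(3)[of "u x"] slope_pos[of "G x"] by (auto simp: mult_left_le_one_le)
    qed
    then show "E (\<lambda>x. \<psi> (u x) * slope (G x)) \<le> A" by (simp only: integral_restrict_UNIV A_def)
  qed
  then have "- (2 * pi / \<alpha>) * (T\<^sup>2 - t\<^sup>2) \<le> A"
    using \<alpha> by (simp add: field_simps)
  then show ?thesis using area_ge_integral[OF h(1)] by (auto simp: A_def intro: order_trans ennreal_leI)
qed

end

theorem theorem3p4:
  fixes \<alpha> c h :: real and a :: "real^3" and M :: "(real^3) set"
  assumes "\<alpha> < 0"
    and "norm a = 1"
    and "c > 0"
    and "compact M"
    and "singular_minimal_surface \<alpha> a M"
    and "graph_on {p. p \<bullet> a = c} a M"
    and "surface_boundary M \<subseteq> {p. p \<bullet> a = c}"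
    and "h \<in> (\<lambda>p. p \<bullet> a) ` M" and "\<forall>p\<in>M. p \<bullet> a \<le> h"
  shows "surface_area M \<ge> ennreal (- (2 * pi / \<alpha>) * (h\<^sup>2 - c\<^sup>2))"
proof -
  obtain p where p: "p \<in> M" "p \<bullet> a = h" using assms(8) by auto
  obtain N where N: "gauss_map M N"
    "\<And>p. p \<in> M \<Longrightarrow> \<exists>H. has_mean_curvature M N p H \<and> 2 * H = \<alpha> * ((N p \<bullet> a) / (p \<bullet> a))"
    using assms(5) unfolding singular_minimal_surface_def by blast
  have pos: "\<And>p. p \<in> M \<Longrightarrow> 0 < p \<bullet> a" and sm: "smooth_surface M"
    using assms(5) unfolding singular_minimal_surface_def by auto
  show ?thesis
  proof (cases "c < h")
    \<comment> \<open>The bound is nonpositive here, and \<open>ennreal\<close> sends it to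
      0.\<close>
    case False
    have "0 < h" using pos[OF p(1)] p(2) by simp
    then have "h\<^sup>2 \<le> c\<^sup>2" using False by (intro power_mono) auto
    then have "- (2 * pi / \<alpha>) * (h\<^sup>2 - c\<^sup>2) \<le> 0"
      using assms(1) by (intro mult_nonneg_nonpos) (auto simp: divide_nonneg_neg)
    then show ?thesis by (simp add: ennreal_neg)
  next
    case True
    obtain e1 :: "real^3" where e1: "e1 \<noteq> 0" "orthogonal a e1"
      using orthogonal_to_vector_exists[of a] by auto
    define e where "e = (1 / norm e1) *\<^sub>R e1"
    have "norm e = 1" "e \<bullet> a = 0" using e1 by (auto simp: e_def orthogonal_def inner_commute)
    then have fr: "frame e (cross3 a e) a" using frame_completion(1) assms(2) by blast
    interpret singular_graph \<alpha> c a e "cross3 a e" M N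
      by unfold_locales (use assms fr sm pos N in auto)
    \<comment> \<open>At most a third of the gap, so that
      \<open>c + \<delta> n < h - \<delta> n\<close> for every \<open>n\<close>.\<close>
    define \<delta> where "\<delta> n = (h - c) / 3 * inverse (real (Suc n))" for n
    have \<delta>0: "\<delta> \<longlonglongrightarrow> 0"
      unfolding \<delta>_def by (intro tendsto_mult_right_zero LIMSEQ_inverse_real_of_nat)
    have "ennreal (- (2 * pi / \<alpha>) * ((h - \<delta> n)\<^sup>2 - (c + \<delta> n)\<^sup>2)) \<le> surface_area M" for n
    proof (rule area_ge[OF _ _ _ p])
      have "\<delta> n \<le> (h - c) / 3 * 1"
        unfolding \<delta>_def using True by (intro mult_left_mono) (auto simp: inverse_le_1_iff)
      moreover have "0 < \<delta> n" using True by (simp add: \<delta>_def)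
      ultimately have "0 < \<delta> n" "3 * \<delta> n \<le> h - c" by auto
      then show "c < c + \<delta> n" "c + \<delta> n < h - \<delta> n" "h - \<delta> n < h" by auto
    qed
    moreover have "(\<lambda>n. ennreal (- (2 * pi / \<alpha>) * ((h - \<delta> n)\<^sup>2 - (c + \<delta> n)\<^sup>2)))
        \<longlonglongrightarrow> ennreal (- (2 * pi / \<alpha>) * ((h - 0)\<^sup>2 - (c + 0)\<^sup>2))"
      by (intro tendsto_ennrealI tendsto_intros \<delta>0)
    ultimately have "ennreal (- (2 * pi / \<alpha>) * ((h - 0)\<^sup>2 - (c + 0)\<^sup>2)) \<le> surface_area M"
      by (intro LIMSEQ_le_const2) auto
    then show ?thesis by simp
  qed
qed

end
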